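(* Let $p>1$ and $r\ge 1$ be integers, let $K=\frac p2+\frac1{p+1}$ and $N=\frac{p(p+1)}2+r$. On the domain $Y_{II}=Y_{II}(r,p;K)\subset\mathbb{C}^N$ put $X=|w|^2\det(I-Z\overline Z)^{-1/K}$ and $$g(z,w)=\log\Big[\frac{1}{1-X}\,\det(I-Z\overline Z)^{-\frac1K}\,K^{\frac{r-N}{1+N}}\Big].$$ Then $g$ is the unique solution to the boundary problem of the complex Monge–Ampère equation $$\det\Big(\frac{\partial^2 g}{\partial z_\alpha\,\partial\overline z_\beta}\Big)_{1\le\alpha,\beta\le N}=e^{(N+1)g}\ \text{ on } Y_{II},\qquad g=\infty\ \text{ on }\partial Y_{II}$$ (the boundary condition meaning $g(z,w)\to+\infty$ as $(z,w)\to\partial Y_{II}$), i.e. $g$ is the generating function of the complete Einstein–Kähler metric of $Y_{II}(r,p;K)$: this metric is $$\sum_{\alpha,\beta=1}^N\frac{\partial^2 g}{\partial z_\alpha\,\partial\overline z_\beta}\,dz_\alpha\,\overline{dz_\beta}.$$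
   Context: $R_{II}(p)$ is the classical symmetric domain of the second type: the set of complex symmetric $p\times p$ matrices $Z$ with $I-Z\overline Z$ positive definite. Its coordinates are $z=(z_{11},z_{12},\dots,z_{1p},z_{22},\dots,z_{2p},\dots,z_{pp})$, where the diagonal entries of $Z$ are $z_{kk}$ and the off-diagonal entries (in positions $(k,l)$ and $(l,k)$, $k<l$) are $\frac1{\sqrt2}z_{kl}$. For $K>0$, $$Y_{II}(r,p;K)=\{(Z,w): w\in\mathbb{C}^r,\ Z\in R_{II}(p),\ |w|^2<\det(I-Z\overline Z)^{1/K}\},$$ with $|w|^2=|w_1|^2+\dots+|w_r|^2$. Its dimension is $N=\frac{p(p+1)}2+r$, and its coordinates are $(z,w)=(z_{11},z_{12},\dots,z_{pp},w_1,\dots,w_r)=(z_1,\dots,z_N)$. A Kähler metric is Einstein–Kähler if its Ricci form $-\partial\overline\partial\log\det(g_{i\overline j})$ is proportional to its Kähler form. A bounded pseudoconvex domain $D\subset\mathbb{C}^n$ (and $Y_{II}(r,p;K)$ is one) admits a unique complete Einstein–Kähler metric $\sum\frac{\partial^2 g}{\partial z_i\partial\overline z_j}dz_i\overline{dz_j}$ whose generating function $g$ is the unique solution (among real $C^\infty$ functions for which this form is a complete Kähler metric) of $\det\big(\frac{\partial^2 g}{\partial z_i\partial\overline z_j}\big)=e^{(n+1)g}$ in $D$, $g=\infty$ on $\partial D$ (Cheng–Yau, Mok–Yau). *)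

theory Defs
  imports "HOL-Analysis.Analysis" "HOL-Library.Uprod"
begin

section \<open>Functions of class \<open>C\<^sup>k\<close> and Wirtinger derivatives\<close>

text \<open>
  These notions are meant for open \<open>S\<close>; \<open>complex ^ 'n\<close> is regarded as a real vector space.
\<close>

fun Ck_on :: "nat \<Rightarrow> ('a::real_normed_vector \<Rightarrow> 'b::real_normed_vector) \<Rightarrow> 'a set \<Rightarrow> bool" where
  "Ck_on 0 f S \<longleftrightarrow> continuous_on S f"
| "Ck_on (Suc k) f S \<longleftrightarrow>
     (\<forall>x\<in>S. f differentiable (at x)) \<and>
     (\<forall>v. Ck_on k (\<lambda>x. frechet_derivative f (at x) v) S)"

definition smooth_on :: "('a::real_normed_vector \<Rightarrow> 'b::real_normed_vector) \<Rightarrow> 'a set \<Rightarrow> bool" where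
  "smooth_on f S \<longleftrightarrow> (\<forall>k. Ck_on k f S)"

definition wirtinger :: "'n \<Rightarrow> (complex ^ 'n::finite \<Rightarrow> complex) \<Rightarrow> complex ^ 'n \<Rightarrow> complex" where
  "wirtinger i f z =
     (frechet_derivative f (at z) (axis i 1) - \<i> * frechet_derivative f (at z) (axis i \<i>)) / 2"

definition wirtinger_bar :: "'n \<Rightarrow> (complex ^ 'n::finite \<Rightarrow> complex) \<Rightarrow> complex ^ 'n \<Rightarrow> complex" where
  "wirtinger_bar j f z =
     (frechet_derivative f (at z) (axis j 1) + \<i> * frechet_derivative f (at z) (axis j \<i>)) / 2"

definition complex_hessian :: "(complex ^ 'n::finite \<Rightarrow> real) \<Rightarrow> complex ^ 'n \<Rightarrow> complex ^ 'n ^ 'n" where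
  "complex_hessian g z = (\<chi> i j. wirtinger i (wirtinger_bar j (\<lambda>x. complex_of_real (g x))) z)"


section \<open>Kaehler metrics on domains of \<open>complex ^ 'n\<close>\<close>

definition hermitian_pos_def :: "complex ^ 'n ^ 'n::finite \<Rightarrow> bool" where
  "hermitian_pos_def A \<longleftrightarrow>
     (\<forall>i j. A $ j $ i = cnj (A $ i $ j)) \<and>
     (\<forall>v. v \<noteq> 0 \<longrightarrow> 0 < Re (\<Sum>i\<in>UNIV. \<Sum>j\<in>UNIV. A $ i $ j * v $ i * cnj (v $ j)))"

text \<open>
  A matrix field \<open>H\<close> stands for the tensor with entries \<open>H z $ i $ j\<close> at \<open>dz\<^sub>i \<otimes> d\<close>-bar \<open>z\<^sub>j\<close>.
  The last clause says that the associated (1,1)-form is closed: for Hermitian \<open>H\<close> the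
  vanishing of its (2,1)-part implies that of its (1,2)-part, which is the conjugate.
\<close>

definition kaehler_metric_on :: "(complex ^ 'n::finite) set \<Rightarrow> (complex ^ 'n \<Rightarrow> complex ^ 'n ^ 'n) \<Rightarrow> bool" where
  "kaehler_metric_on D H \<longleftrightarrow>
     (\<forall>i j. smooth_on (\<lambda>z. H z $ i $ j) D) \<and>
     (\<forall>z\<in>D. hermitian_pos_def (H z)) \<and>
     (\<forall>z\<in>D. \<forall>i j k. wirtinger k (\<lambda>x. H x $ i $ j) z = wirtinger i (\<lambda>x. H x $ k $ j) z)"

definition speed :: "(complex ^ 'n::finite \<Rightarrow> complex ^ 'n ^ 'n) \<Rightarrow> (real \<Rightarrow> complex ^ 'n) \<Rightarrow> real \<Rightarrow> real" where
  "speed H \<gamma> t =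
     (let v = vector_derivative \<gamma> (at t)
      in sqrt (Re (\<Sum>i\<in>UNIV. \<Sum>j\<in>UNIV. H (\<gamma> t) $ i $ j * v $ i * cnj (v $ j))))"

text \<open>
  A \<^const>\<open>valid_path\<close> may have unbounded derivative near its exceptional points and hence infinite
  length, for which \<^const>\<open>integral\<close> would return 0; so integrability of the speed is required.
\<close>

definition metric_dist ::
    "(complex ^ 'n::finite) set \<Rightarrow> (complex ^ 'n \<Rightarrow> complex ^ 'n ^ 'n) \<Rightarrow> complex ^ 'n \<Rightarrow> complex ^ 'n \<Rightarrow> real" where
  "metric_dist D H x y =
     (if x \<in> D \<and> y \<in> D
      then Inf {integral {0..1} (speed H \<gamma>) | \<gamma>.
             valid_path \<gamma> \<and> path_image \<gamma> \<subseteq> D \<and> pathstart \<gamma> = x \<and> pathfinish \<gamma> = y \<and>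
             speed H \<gamma> integrable_on {0..1}}
      else 0)"

text \<open>The default value 0 outside \<open>D\<close> only serves the unguarded axioms of \<^locale>\<open>Metric_space\<close>.\<close>

definition complete_kaehler_metric_on ::
    "(complex ^ 'n::finite) set \<Rightarrow> (complex ^ 'n \<Rightarrow> complex ^ 'n ^ 'n) \<Rightarrow> bool" where
  "complete_kaehler_metric_on D H \<longleftrightarrow>
     kaehler_metric_on D H \<and>
     Metric_space D (metric_dist D H) \<and> Metric_space.mcomplete D (metric_dist D H)"

text \<open>The determinant of a positive definite Hermitian matrix is real and positive.\<close>

definition einstein_on :: "(complex ^ 'n::finite) set \<Rightarrow> (complex ^ 'n \<Rightarrow> complex ^ 'n ^ 'n) \<Rightarrow> bool" where
  "einstein_on D H \<longleftrightarrow>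
     (\<exists>c::real. \<forall>z\<in>D. \<forall>i j.
        - complex_hessian (\<lambda>x. ln (Re (det (H x)))) z $ i $ j = complex_of_real c * H z $ i $ j)"

definition monge_ampere_solution :: "(complex ^ 'n::finite) set \<Rightarrow> (complex ^ 'n \<Rightarrow> real) \<Rightarrow> bool" where
  "monge_ampere_solution D g \<longleftrightarrow>
     smooth_on g D \<and>
     complete_kaehler_metric_on D (complex_hessian g) \<and>
     (\<forall>z\<in>D. det (complex_hessian g z) = complex_of_real (exp ((real CARD('n) + 1) * g z))) \<and>
     (\<forall>b\<in>frontier D. filterlim g at_top (at b within D))"


section \<open>The domains\<close>

definition R_II :: "(complex ^ 'p ^ 'p::finite) set" where
  "R_II = {Z. transpose Z = Z \<and> hermitian_pos_def (mat 1 - Z ** map_matrix cnj Z)}"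

text \<open>
  The coordinates \<open>z\<^sub>k\<^sub>l\<close> with \<open>k \<le> l\<close> are indexed by the unordered pairs \<open>Upair k l\<close> (\<open>k = l\<close>
  allowed), so that \<open>complex ^ ('p uprod + 'r)\<close> is the coordinate space of dimension
  \<open>p (p + 1) / 2 + r\<close> for \<open>p = CARD('p)\<close>, \<open>r = CARD('r)\<close>.
\<close>

instance uprod :: (finite) finite
  by standard simp

lemma card_coordinates:
  "CARD('p::finite uprod + 'r::finite) = CARD('p) * (CARD('p) + 1) div 2 + CARD('r)"
  by (simp add: card_UNIV_uprod)

definition Z_part :: "complex ^ ('p::finite uprod + 'r::finite) \<Rightarrow> complex ^ 'p ^ 'p" where
  "Z_part x = (\<chi> k l. if k = l then x $ Inl (Upair k k)
                       else x $ Inl (Upair k l) / complex_of_real (sqrt 2))"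

definition w_part :: "complex ^ ('p::finite uprod + 'r::finite) \<Rightarrow> complex ^ 'r" where
  "w_part x = (\<chi> j. x $ Inr j)"

text \<open>
  For \<open>Z\<close> in \<^const>\<open>R_II\<close> the determinant of \<open>I - Z Z\<close>-bar is real and positive; the norm of
  \<open>complex ^ 'r\<close> is the standard Hermitian one.
\<close>

definition det_II :: "complex ^ 'p ^ 'p::finite \<Rightarrow> real" where
  "det_II Z = Re (det (mat 1 - Z ** map_matrix cnj Z))"

definition Y_II :: "real \<Rightarrow> (complex ^ ('p::finite uprod + 'r::finite)) set" where
  "Y_II K = {x. Z_part x \<in> R_II \<and> (norm (w_part x))\<^sup>2 < det_II (Z_part x) powr (1 / K)}"

end

theory Submission
  imports Defs
begin

text \<open>
  Put \<open>\<phi> = det (I - Z Z-bar)\<^sup>1\<^sup>/\<^sup>K - |w|\<^sup>2\<close>, so that \<open>g = - ln \<phi>\<close> up to a constant. With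
  \<open>a = - (1/K) ln det (I - Z Z-bar)\<close> and the twisted differential \<open>\<theta> = dw + w \<partial>a\<close>, the Hessian of \<open>g\<close> is
  the sum of \<open>e\<^sup>-\<^sup>a/\<phi>\<close> times the Hessian of \<open>a\<close>, \<open>|\<theta>|\<^sup>2/\<phi>\<close> and \<open>|(\<theta>,w)|\<^sup>2/\<phi>\<^sup>2\<close>. The change of coframe from \<open>dw\<close>
  to \<open>\<theta>\<close> is unipotent, hence the determinant is a product. Its first factor is the determinant of
  \<open>V \<mapsto> M V M\<^sup>T\<close> on symmetric matrices with \<open>M = (I - Z Z-bar)\<^sup>-\<^sup>1\<close>, namely \<open>det M\<^sup>p\<^sup>+\<^sup>1\<close>, and the value of \<open>K\<close> is
  exactly the one for which the powers of \<open>det M\<close> add up to \<open>e\<^sup>(\<^sup>N\<^sup>+\<^sup>1\<^sup>)\<^sup>g\<close>.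

  Completeness: the metric dominates a multiple of the Euclidean one, and the exhaustion function \<open>g\<close>
  has bounded gradient, so a Cauchy sequence converges in the Euclidean sense to a point where \<open>g\<close> is
  finite. Uniqueness needs no generalized maximum principle: the closed domain is shrunk into the open
  one by dilations, so that a solution can be compared with the dilation of another one, which is
  bounded, by the ordinary maximum principle.
\<close>

section \<open>Determinants of complex matrices\<close>

text \<open>Put n = p(p+1)/2, so that N = n + r. The n directions of Z and the rank-one part of the
  w-block contribute (e^-a)^(n+1) to the determinant, against det M^(p+1); as e^-a = det(I - Z
  Z-bar)^(1/K), they cancel exactly when K (p+1) = n + 1. What is left is K^-n phi^-(N+1), and the
  exponent (r-N)/(1+N) = -n/(N+1) of K in g absorbs K^-n. Plain differentiation of -ln phi leaves a
  negative multiple of the square of the differential of a; positivity and the two estimates behind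
  completeness become visible only after the regrouping. The gradient estimate comes down to tr(Z
  Z-bar) \<le> p: this trace is the squared length of the gradient of ln det(I - Z Z-bar) in the
  metric of its own potential. The obstacle to uniqueness is that the difference of two functions
  infinite on the boundary is uncontrolled there; dilating one of them costs only a multiple of ln
  t, which disappears as t tends to 1.\<close>

lemma has_derivative_vecI:
  fixes f :: "'a::real_normed_vector \<Rightarrow> 'b::euclidean_space ^ 'n::finite"
  assumes "\<And>i. ((\<lambda>x. f x $ i) has_derivative (\<lambda>v. f' v $ i)) (at a within S)"
  shows "(f has_derivative f') (at a within S)"
  by (subst has_derivative_componentwise_within)
     (auto simp: Basis_vec_def inner_axis intro!: has_derivative_inner_left assms)

text \<open>The source of the distributivity laws, the commutation with sums and the product rule
  for matrix products used throughout.\<close>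

lemma bounded_bilinear_matrix_mult:
  "bounded_bilinear ((**) :: complex^'n^'m \<Rightarrow> complex^'k^'n \<Rightarrow> complex^'k^'m)"
  unfolding bilinear_conv_bounded_bilinear[symmetric] bilinear_def linear_iff
  by (auto simp: matrix_matrix_mult_def vec_eq_iff distrib_left distrib_right sum.distrib
      scaleR_right.sum)

lemmas matrix_mult_diff_left = bounded_bilinear.diff_left [OF bounded_bilinear_matrix_mult]
lemmas matrix_mult_diff_right = bounded_bilinear.diff_right [OF bounded_bilinear_matrix_mult]
lemmas matrix_mult_add_left = bounded_bilinear.add_left [OF bounded_bilinear_matrix_mult]
lemmas matrix_mult_add_right = bounded_bilinear.add_right [OF bounded_bilinear_matrix_mult]
lemmas matrix_mult_minus_left = bounded_bilinear.minus_left [OF bounded_bilinear_matrix_mult]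
lemmas matrix_mult_minus_right = bounded_bilinear.minus_right [OF bounded_bilinear_matrix_mult]
lemmas matrix_mult_scaleR_left = bounded_bilinear.scaleR_left [OF bounded_bilinear_matrix_mult]
lemmas matrix_mult_scaleR_right = bounded_bilinear.scaleR_right [OF bounded_bilinear_matrix_mult]
lemmas has_derivative_matrix_mult = bounded_bilinear.FDERIV [OF bounded_bilinear_matrix_mult]

lemma bounded_linear_trace: "bounded_linear (trace :: complex^'n^'n \<Rightarrow> complex)"
  unfolding linear_conv_bounded_linear[symmetric] linear_iff
  by (auto simp: trace_def sum.distrib scaleR_right.sum)

lemmas trace_scaleR = linear.scaleR [OF bounded_linear.linear [OF bounded_linear_trace]]
lemmas trace_minus = linear_neg [OF bounded_linear.linear [OF bounded_linear_trace]]

text \<open>Row \<open>i\<close> of \<open>C ** A\<close> is a combination of the rows of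
  \<open>A\<close>; every term but the one with \<open>A $ i\<close> itself repeats a row and
  vanishes. This evaluates the row derivatives in Jacobi's formula.\<close>

lemma det_replace_row_mult:
  fixes A C :: "complex^'n^'n"
  shows "det (\<chi> k. if k = i then (C ** A) $ i else A $ k) = C $ i $ i * det A"
proof -
  have row: "(C ** A) $ i = (\<Sum>k\<in>UNIV. C $ i $ k *s A $ k)"
    by (simp add: vec_eq_iff matrix_matrix_mult_def)
  have zero: "det (\<chi> l. if l = i then A $ k else A $ l) = 0" if "k \<noteq> i" for k
    by (rule det_identical_rows[of i k]) (use that in \<open>auto simp: row_def vec_eq_iff\<close>)
  have "det (\<chi> k. if k = i then (C ** A) $ i else A $ k)
      = (\<Sum>k\<in>UNIV. det (\<chi> l. if l = i then C $ i $ k *s A $ k else A $ l))"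
    unfolding row by (rule det_linear_row_sum) simp
  also have "\<dots> = (\<Sum>k\<in>UNIV. C $ i $ k * det (\<chi> l. if l = i then A $ k else A $ l))"
    by (simp add: det_row_mul)
  also have "\<dots> = (\<Sum>k\<in>UNIV. if k = i then C $ i $ i * det A else 0)"
  proof (rule sum.cong)
    fix k :: 'n
    have "(\<chi> l. if l = k then A $ k else A $ l) = A" by (simp add: vec_eq_iff)
    then show "C $ i $ k * det (\<chi> l. if l = i then A $ k else A $ l)
        = (if k = i then C $ i $ i * det A else 0)"
      by (cases "k = i") (auto simp: zero)
  qed simp
  finally show ?thesis by simp
qed

text \<open>The product rule in each term of the Leibniz expansion, regrouped by the row that is
  differentiated. It holds at singular matrices too and so gives the continuity of
  \<open>det\<close>.\<close>

lemma has_derivative_det_rows: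
  "((det :: complex^'n^'n \<Rightarrow> complex) has_derivative
     (\<lambda>B. \<Sum>i\<in>UNIV. det (\<chi> k. if k = i then B $ i else A $ k))) (at A within S)"
proof -
  have 1: "((\<lambda>X. det X :: complex) has_derivative
      (\<lambda>B. \<Sum>p | p permutes (UNIV::'n set). of_int (sign p) *
          (\<Sum>i\<in>UNIV. B $ i $ p i * (\<Prod>j\<in>UNIV - {i}. A $ j $ p j)))) (at A within S)"
    unfolding det_def
    by (rule has_derivative_sum has_derivative_mult_right has_derivative_prod
        bounded_linear_imp_has_derivative bounded_linear_compose[OF bounded_linear_vec_nth]
        bounded_linear_vec_nth)+
  have 2: "det (\<chi> k. if k = i then B $ i else A $ k)
      = (\<Sum>p | p permutes (UNIV::'n set). of_int (sign p) *
          (B $ i $ p i * (\<Prod>j\<in>UNIV - {i}. A $ j $ p j)))" for i B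
    unfolding det_def
    by (intro sum.cong refl arg_cong2[where f="(*)"], subst prod.remove[of UNIV i])
       (auto intro!: prod.cong)
  show ?thesis
    using 1 unfolding 2 by (subst sum.swap) (simp add: sum_distrib_left)
qed

text \<open>Jacobi's formula: since \<open>B = B ** M ** A\<close>, replacing a row contributes a
  diagonal entry of \<open>B ** M\<close>. The inverse is a free variable so that explicit inverses
  can be supplied.\<close>

lemma has_derivative_det:
  fixes A :: "complex^'n^'n"
  assumes "M ** A = mat 1"
  shows "(det has_derivative (\<lambda>B. det A * trace (B ** M))) (at A within S)"
proof -
  have "det (\<chi> k. if k = i then B $ i else A $ k) = (B ** M) $ i $ i * det A" for i B
  proof -
    have "B ** M ** A = B" by (simp add: matrix_mul_assoc[symmetric] assms)
    then show ?thesis using det_replace_row_mult[of i "B ** M" A] by (simp only:)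
  qed
  then show ?thesis
    using has_derivative_det_rows[of A S]
    by (simp add: trace_def sum_distrib_left mult.commute)
qed

lemma matrix_inv_mult:
  fixes A :: "complex^'n^'n"
  assumes "det A \<noteq> 0"
  shows "A ** matrix_inv A = mat 1" and "matrix_inv A ** A = mat 1"
proof -
  obtain B where "A ** B = mat 1" "B ** A = mat 1"
    using assms unfolding invertible_det_nz[symmetric] invertible_def by blast
  then have "A ** matrix_inv A = mat 1 \<and> matrix_inv A ** A = mat 1"
    unfolding matrix_inv_def by (rule_tac someI[where x=B]) simp
  then show "A ** matrix_inv A = mat 1" and "matrix_inv A ** A = mat 1" by auto
qed

text \<open>Cramer's rule exhibits the entries of the inverse as quotients of determinants, which
  makes the differentiability of inversion visible.\<close>

lemma matrix_inv_cramer: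
  fixes A :: "complex^'n^'n"
  assumes "det A \<noteq> 0"
  shows "matrix_inv A $ k $ l
    = det (\<chi> i j. if j = k then axis l 1 $ i else A $ i $ j) / det A"
proof -
  have "A *v column l (matrix_inv A) = axis l 1"
    using matrix_inv_mult(1)[OF assms]
    by (auto simp: vec_eq_iff matrix_vector_mult_def matrix_matrix_mult_def column_def mat_def axis_def)
  then have "column l (matrix_inv A)
      = (\<chi> k. det (\<chi> i j. if j = k then axis l 1 $ i else A $ i $ j) / det A)"
    using cramer[OF assms] by blast
  then show ?thesis by (simp add: column_def vec_eq_iff)
qed

lemma open_det_nonzero: "open {A :: complex^'n^'n. det A \<noteq> 0}"
proof -
  have "isCont (det :: complex^'n^'n \<Rightarrow> complex) A" for A
    using has_derivative_continuous[OF has_derivative_det_rows] by blast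
  then have "continuous_on UNIV (det :: complex^'n^'n \<Rightarrow> complex)"
    by (simp add: continuous_at_imp_continuous_on)
  then have "open (det -` (- {0}) :: (complex^'n^'n) set)"
    by (rule open_vimage[rotated]) (simp add: open_Compl)
  then show ?thesis by (simp add: vimage_def)
qed

lemma differentiable_matrix_inv:
  fixes A :: "complex^'n^'n"
  assumes "det A \<noteq> 0"
  shows "matrix_inv differentiable (at A)"
proof -
  let ?R = "\<lambda>k l X. (\<chi> i j. if j = k then axis l 1 $ i else X $ i $ j) :: complex^'n^'n"
  let ?f = "\<lambda>X. (\<chi> k l. det (?R k l X) / det X) :: complex^'n^'n"
  have "\<exists>D. ((\<lambda>X. det (?R k l X) / det X) has_derivative D) (at A)" for k l
  proof -
    have "(?R k l has_derivative (\<lambda>B. \<chi> i j. if j = k then 0 else B $ i $ j)) (at A)"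
    proof (intro has_derivative_vecI)
      fix i j
      show "((\<lambda>X. ?R k l X $ i $ j) has_derivative (\<lambda>B. (\<chi> i j. if j = k then 0 else B $ i $ j) $ i $ j)) (at A)"
        by (cases "j = k") (auto intro!: bounded_linear_imp_has_derivative
          bounded_linear_compose[OF bounded_linear_vec_nth bounded_linear_vec_nth])
    qed
    from has_derivative_compose[OF this has_derivative_det_rows]
    have "(\<lambda>X. det (?R k l X)) differentiable (at A)" unfolding differentiable_def by blast
    moreover have "(det :: complex^'n^'n \<Rightarrow> complex) differentiable (at A)"
      unfolding differentiable_def using has_derivative_det_rows by blast
    ultimately have "(\<lambda>X. det (?R k l X) / det X) differentiable (at A)"
      using assms by (intro differentiable_divide)
    then show ?thesis unfolding differentiable_def .
  qed
  then have D: "((\<lambda>X. det (?R k l X) / det X) has_derivative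
      frechet_derivative (\<lambda>X. det (?R k l X) / det X) (at A)) (at A)" for k l
    unfolding frechet_derivative_works[symmetric] differentiable_def .
  define D where "D k l = frechet_derivative (\<lambda>X. det (?R k l X) / det X) (at A)" for k l
  have "(?f has_derivative (\<lambda>B. \<chi> k l. D k l B)) (at A)"
    using D by (intro has_derivative_vecI) (simp add: D_def)
  then have "(matrix_inv has_derivative (\<lambda>B. \<chi> k l. D k l B)) (at A)"
    by (rule has_derivative_transform_within_open[OF _ open_det_nonzero])
       (simp_all add: assms vec_eq_iff matrix_inv_cramer)
  then show ?thesis unfolding differentiable_def by blast
qed

text \<open>With differentiability already known, differentiating the constant X X^-1 determines the
  derivative.\<close>

lemma has_derivative_matrix_inv:
  fixes A :: "complex^'n^'n"
  assumes "det A \<noteq> 0"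
  shows "(matrix_inv has_derivative (\<lambda>B. - (matrix_inv A ** B ** matrix_inv A))) (at A)"
proof -
  obtain D where D: "(matrix_inv has_derivative D) (at A)"
    using differentiable_matrix_inv[OF assms] unfolding differentiable_def by blast
  have "((\<lambda>X. X ** matrix_inv X) has_derivative (\<lambda>B. A ** D B + B ** matrix_inv A)) (at A)"
    by (rule has_derivative_matrix_mult[OF has_derivative_ident D])
  moreover have "((\<lambda>X. X ** matrix_inv X) has_derivative (\<lambda>B. 0)) (at A)"
    by (rule has_derivative_transform_within_open[OF has_derivative_const[of "mat 1"] open_det_nonzero])
       (simp_all add: assms matrix_inv_mult)
  ultimately have "(\<lambda>B. A ** D B + B ** matrix_inv A) = (\<lambda>B. 0)"
    by (rule has_derivative_unique)
  then have "A ** D B = - (B ** matrix_inv A)" for B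
    by (metis (mono_tags, lifting) eq_neg_iff_add_eq_0)
  then have "matrix_inv A ** (A ** D B) = - (matrix_inv A ** B ** matrix_inv A)" for B
    by (simp add: matrix_mult_minus_right matrix_mul_assoc)
  then have "D B = - (matrix_inv A ** B ** matrix_inv A)" for B
    using matrix_inv_mult[OF assms] by (simp add: matrix_mul_assoc)
  then have "D = (\<lambda>B. - (matrix_inv A ** B ** matrix_inv A))" by blast
  then show ?thesis using D by simp
qed

lemma det_path_derivative:
  fixes M :: "real \<Rightarrow> complex^'n^'n"
  assumes "(M has_vector_derivative M') (at t within S)" and "N ** M t = mat 1"
  shows "((\<lambda>t. det (M t)) has_vector_derivative det (M t) * trace (M' ** N)) (at t within S)"
proof -
  have "(M has_derivative (\<lambda>h. h *\<^sub>R M')) (at t within S)"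
    using assms(1) by (simp add: has_vector_derivative_def)
  from has_derivative_compose[OF this has_derivative_det[OF assms(2)]]
  show ?thesis by (simp add: has_vector_derivative_def matrix_mult_scaleR_left trace_scaleR)
qed

text \<open>The quotient \<open>f / g\<close> has zero derivative. Nonvanishing is asked of
  \<open>g\<close> alone because \<open>f\<close> will be a determinant still to be
  evaluated.\<close>

lemma linear_ode_eq:
  fixes f g c :: "real \<Rightarrow> complex"
  assumes "\<And>t. t \<in> {0..1} \<Longrightarrow> (f has_vector_derivative f t * c t) (at t within {0..1})"
    and "\<And>t. t \<in> {0..1} \<Longrightarrow> (g has_vector_derivative g t * c t) (at t within {0..1})"
    and nz: "\<And>t. t \<in> {0..1} \<Longrightarrow> g t \<noteq> 0" and "f 0 = g 0"
  shows "f 1 = g 1"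
proof -
  have "((\<lambda>t. f t / g t) has_derivative (\<lambda>h. 0)) (at t within {0..1})" if "t \<in> {0..1}" for t
    by (rule has_derivative_eq_rhs, rule has_derivative_divide[OF assms(1)[OF that, unfolded has_vector_derivative_def]
        assms(2)[OF that, unfolded has_vector_derivative_def] nz[OF that]])
       (use nz[OF that] in \<open>auto simp: fun_eq_iff field_simps scaleR_conv_of_real\<close>)
  then have "f 1 / g 1 = f 0 / g 0"
    by (intro has_derivative_zero_unique[of "{0..1}" "\<lambda>t. f t / g t"]) auto
  then show ?thesis using nz[of 0] nz[of 1] assms(4) by (auto simp: field_simps)
qed

section \<open>Hermitian forms and positivity\<close>

definition hform :: "complex^'n^'n::finite \<Rightarrow> complex^'n \<Rightarrow> complex" where
  "hform A v = (\<Sum>i\<in>UNIV. \<Sum>j\<in>UNIV. A $ i $ j * v $ i * cnj (v $ j))"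

definition herm :: "complex^'n^'n \<Rightarrow> bool" where
  "herm A \<longleftrightarrow> (\<forall>i j. A $ j $ i = cnj (A $ i $ j))"

lemma hermD: "herm A \<Longrightarrow> A $ j $ i = cnj (A $ i $ j)"
  unfolding herm_def by blast

lemma herm_add: "herm A \<Longrightarrow> herm B \<Longrightarrow> herm (A + B)"
  unfolding herm_def[of "A + B"]
  by (simp only: vector_add_component complex_cnj_add) (auto simp only: intro!: arg_cong2[where f="(+)"] hermD)

lemma herm_diff: "herm A \<Longrightarrow> herm B \<Longrightarrow> herm (A - B)"
  unfolding herm_def[of "A - B"]
  by (simp only: vector_minus_component complex_cnj_diff) (auto simp only: intro!: arg_cong2[where f="(-)"] hermD)

lemma herm_scaleR: "herm A \<Longrightarrow> herm (c *\<^sub>R A)"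
  unfolding herm_def[of "c *\<^sub>R A"]
  by (simp only: vector_scaleR_component complex_cnj_scaleR) (auto simp only: intro!: arg_cong2[where f="(*\<^sub>R)"] hermD)

lemma herm_mat_1: "herm (mat 1)"
  by (auto simp: herm_def mat_def)

definition psd :: "complex^'n^'n::finite \<Rightarrow> bool" where
  "psd A \<longleftrightarrow> herm A \<and> (\<forall>v. 0 \<le> Re (hform A v))"

lemma hermitian_pos_def_iff:
  "hermitian_pos_def A \<longleftrightarrow> herm A \<and> (\<forall>v. v \<noteq> 0 \<longrightarrow> 0 < Re (hform A v))"
  by (simp add: hermitian_pos_def_def hform_def herm_def)

lemma hform_0 [simp]: "hform A 0 = 0"
  by (simp add: hform_def)

lemma hermitian_pos_def_imp_psd: "hermitian_pos_def A \<Longrightarrow> psd A"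
  unfolding hermitian_pos_def_iff psd_def by (metis hform_0 less_eq_real_def zero_complex.simps(1))

lemma hform_add_matrix: "hform (A + B) v = hform A v + hform B v"
  by (simp add: hform_def algebra_simps sum.distrib)

lemma hform_diff_matrix: "hform (A - B) v = hform A v - hform B v"
  by (simp add: hform_def algebra_simps sum_subtractf)

lemma hform_scaleR_matrix: "hform (c *\<^sub>R A) v = c *\<^sub>R hform A v"
  by (simp add: hform_def algebra_simps scaleR_right.sum)

lemma hform_mat_1: "hform (mat 1) v = complex_of_real ((norm v)\<^sup>2)"
proof -
  have "hform (mat 1) v = (\<Sum>i\<in>UNIV. v $ i * cnj (v $ i))"
    by (simp add: hform_def mat_def if_distrib[of "\<lambda>x. x * _"] cong: if_cong)
  also have "\<dots> = complex_of_real (\<Sum>i\<in>UNIV. (norm (v $ i))\<^sup>2)"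
    by (simp only: complex_norm_square of_real_sum)
  also have "(\<Sum>i\<in>UNIV. (norm (v $ i))\<^sup>2) = (norm v)\<^sup>2"
    by (simp add: norm_vec_def L2_set_def sum_nonneg)
  finally show ?thesis .
qed

lemma hermitian_pos_def_mat_1: "hermitian_pos_def (mat 1)"
  by (auto simp: hermitian_pos_def_iff hform_mat_1 herm_mat_1)

lemma hermitian_pos_def_add:
  "hermitian_pos_def A \<Longrightarrow> psd B \<Longrightarrow> hermitian_pos_def (A + B)"
  unfolding hermitian_pos_def_iff psd_def hform_add_matrix
  by (simp add: add_pos_nonneg herm_add)

lemma hermitian_pos_def_scaleR: "hermitian_pos_def A \<Longrightarrow> c > 0 \<Longrightarrow> hermitian_pos_def (c *\<^sub>R A)"
  unfolding hermitian_pos_def_iff hform_scaleR_matrix by (simp add: herm_scaleR)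

lemma psd_scaleR: "psd A \<Longrightarrow> c \<ge> 0 \<Longrightarrow> psd (c *\<^sub>R A)"
  unfolding psd_def hform_scaleR_matrix by (simp add: herm_scaleR)

lemma psd_add: "psd A \<Longrightarrow> psd B \<Longrightarrow> psd (A + B)"
  unfolding psd_def hform_add_matrix by (simp add: herm_add)

lemma hermitian_pos_def_segment:
  assumes "hermitian_pos_def A" "t \<in> {0..1}"
  shows "hermitian_pos_def ((1 - t) *\<^sub>R mat 1 + t *\<^sub>R A)"
\<comment> \<open>At this endpoint the weight of \<open>mat 1\<close> is zero, so positivity has to
  come from \<open>A\<close> itself.\<close>
proof (cases "t = 1")
  case False
  then show ?thesis using assms
    by (intro hermitian_pos_def_add hermitian_pos_def_scaleR psd_scaleR hermitian_pos_def_mat_1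
        hermitian_pos_def_imp_psd) auto
qed (use assms in simp)

text \<open>The form is v^T A conj(v), the convention of a tensor on dz_i and conj(dz_j); a kernel
  vector of \<open>A\<close> therefore yields a null vector of the form only after
  conjugation.\<close>

lemma hform_alt: "hform A v = (\<Sum>i\<in>UNIV. v $ i * (A *v (\<chi> j. cnj (v $ j))) $ i)"
  by (simp add: hform_def matrix_vector_mult_def sum_distrib_left mult_ac)

lemma hermitian_pos_def_det_nonzero:
  assumes "hermitian_pos_def A"
  shows "det A \<noteq> 0"
proof
  assume "det A = 0"
  then obtain x where x: "x \<noteq> 0" "A *v x = 0"
    using invertible_det_nz[of A] matrix_left_invertible_ker[of A] invertible_left_inverse[of A] by auto
  define v where "v = (\<chi> j. cnj (x $ j))"
  have "(\<chi> j. cnj (v $ j)) = x" "v \<noteq> 0" using x(1) by (auto simp: v_def vec_eq_iff)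
  then have "hform A v = 0" using x(2) by (simp add: hform_alt)
  then show False using assms \<open>v \<noteq> 0\<close> by (auto simp: hermitian_pos_def_iff)
qed

lemma det_cnj: "det (map_matrix cnj A) = cnj (det A)"
  by (simp add: det_def)

lemma herm_iff: "herm A \<longleftrightarrow> map_matrix cnj A = transpose A"
  by (simp add: herm_def vec_eq_iff transpose_def eq_commute)

lemma det_hermitian_real: "herm A \<Longrightarrow> Im (det A) = 0"
  using det_cnj[of A] unfolding herm_iff
  by (simp add: det_transpose complex_eq_iff)

lemma continuous_on_det: "continuous_on S (det :: complex^'n^'n \<Rightarrow> complex)"
  using has_derivative_continuous[OF has_derivative_det_rows]
  by (blast intro: continuous_at_imp_continuous_on)

text \<open>Along the segment to \<open>mat 1\<close> the determinant is real and never zero, so by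
  the intermediate value theorem it keeps the sign it has at \<open>mat 1\<close>.\<close>

lemma hermitian_pos_def_det_pos:
  assumes "hermitian_pos_def A"
  shows "0 < Re (det A)"
proof (rule ccontr)
  assume "\<not> 0 < Re (det A)"
  define M where "M t = (1 - t) *\<^sub>R mat 1 + t *\<^sub>R A" for t :: real
  have "continuous_on {0..1} (\<lambda>t. Re (det (M t)))"
    unfolding M_def
    by (intro continuous_on_Re continuous_on_compose2[OF continuous_on_det[of UNIV]])
       (auto intro!: continuous_intros)
  then obtain t where t: "t \<in> {0..1}" "Re (det (M t)) = 0"
    using IVT2'[of "\<lambda>t. Re (det (M t))" 1 0 0] \<open>\<not> 0 < Re (det A)\<close> by (auto simp: M_def)
  have "hermitian_pos_def (M t)"
    unfolding M_def using hermitian_pos_def_segment assms t(1) by blast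
  then show False
    using t(2) hermitian_pos_def_det_nonzero[of "M t"] det_hermitian_real[of "M t"]
    by (auto simp: hermitian_pos_def_iff complex_eq_iff)
qed

lemma hermitian_pos_def_det_eq:
  "hermitian_pos_def A \<Longrightarrow> det A = complex_of_real (Re (det A))"
  using det_hermitian_real[of A] by (simp add: hermitian_pos_def_iff complex_eq_iff)

section \<open>Positive definite Hermitian matrices\<close>

text \<open>Along a complex coordinate line the form is quadratic in \<open>c\<close>. Suitable
  choices of \<open>c\<close> give the vanishing of columns, one step of elimination and the
  description of null vectors.\<close>

lemma hform_add_axis:
  assumes "herm D"
  shows "Re (hform D (v + c *s axis i 1))
    = Re (hform D v) + 2 * Re (cnj c * (\<Sum>k\<in>UNIV. D $ k $ i * v $ k)) + (norm c)\<^sup>2 * Re (D $ i $ i)"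
proof -
  let ?s = "\<Sum>k\<in>UNIV. D $ k $ i * v $ k"
  have cs: "(\<Sum>j\<in>UNIV. D $ i $ j * cnj (v $ j)) = cnj ?s"
    using hermD[OF assms, of _ i] by simp
  have ax: "(\<Sum>k\<in>UNIV. f k * axis i 1 $ k) = f i" for f :: "'a \<Rightarrow> complex"
    by (simp add: axis_def if_distrib[of "\<lambda>x. _ * x"] cong: if_cong)
  have cax: "cnj (axis i 1 $ k) = axis i 1 $ k" for k :: 'a
    by (simp add: axis_def)
  have "hform D (v + c *s axis i 1)
     = (\<Sum>k\<in>UNIV. \<Sum>l\<in>UNIV. D $ k $ l * v $ k * cnj (v $ l))
     + (\<Sum>k\<in>UNIV. (\<Sum>l\<in>UNIV. D $ k $ l * v $ k * cnj c * axis i 1 $ l))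
     + (\<Sum>k\<in>UNIV. (c * (\<Sum>l\<in>UNIV. D $ k $ l * cnj (v $ l))) * axis i 1 $ k)
     + (\<Sum>k\<in>UNIV. (c * (\<Sum>l\<in>UNIV. D $ k $ l * cnj c * axis i 1 $ l)) * axis i 1 $ k)"
    by (simp add: hform_def cax algebra_simps sum.distrib sum_distrib_left sum_distrib_right)
  also have "\<dots> = hform D v + cnj c * ?s + c * cnj ?s + c * cnj c * D $ i $ i"
    unfolding ax cs by (simp add: hform_def sum_distrib_left mult_ac)
  finally have eq: "hform D (v + c *s axis i 1) = hform D v + cnj c * ?s + c * cnj ?s + c * cnj c * D $ i $ i" .
  have "Re (c * cnj c * D $ i $ i) = (norm c)\<^sup>2 * Re (D $ i $ i)"
    unfolding complex_norm_square[symmetric] by simp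
  moreover have "Re (cnj c * s) + Re (c * cnj s) = 2 * Re (cnj c * s)" for s by simp
  from this[of ?s] calculation show ?thesis unfolding eq plus_complex.sel by linarith
qed

lemma psd_diag_nonneg: "psd D \<Longrightarrow> 0 \<le> Re (D $ i $ i)"
  using hform_add_axis[of D 0 1 i] unfolding psd_def by simp (metis)

lemma psd_diag_real: "psd D \<Longrightarrow> D $ i $ i = complex_of_real (Re (D $ i $ i))"
  using hermD[of D i i] unfolding psd_def by (auto simp: complex_eq_iff)

text \<open>With a zero diagonal entry the form is affine along multiples of
  \<open>axis i 1\<close>, so a nonzero off-diagonal entry would drive it below zero.\<close>

lemma psd_diag_zero:
  assumes D: "psd D" and z: "D $ i $ i = 0"
  shows "D $ j $ i = 0"
proof (rule ccontr)
  assume nz: "D $ j $ i \<noteq> 0"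
  define s where "s = D $ j $ i"
  \<comment> \<open>Chosen so that t |s|^2 exceeds the entry \<open>D $ j $ j\<close> by |s|^2,
    which makes the value of the form negative.\<close>
  define t where "t = Re (D $ j $ j) / (norm s)\<^sup>2 + 1"
  have h: "herm D" and p: "\<And>v. 0 \<le> Re (hform D v)" using D by (auto simp: psd_def)
  have sum: "(\<Sum>k\<in>UNIV. D $ k $ i * axis j 1 $ k) = s"
    by (simp add: axis_def s_def if_distrib[of "\<lambda>x. _ * x"] cong: if_cong)
  have "Re (hform D (axis j 1)) = Re (D $ j $ j)"
    using hform_add_axis[OF h, of 0 1 j] by simp
  moreover have "Re (cnj (- (complex_of_real t * s)) * s) = - t * (norm s)\<^sup>2"
  proof -
    have "cnj (- (complex_of_real t * s)) * s = - complex_of_real t * (s * cnj s)" by simp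
    also have "\<dots> = complex_of_real (- t * (norm s)\<^sup>2)"
      by (simp only: complex_norm_square of_real_minus of_real_mult)
    finally show ?thesis by (simp only: Re_complex_of_real)
  qed
  ultimately have "0 \<le> Re (D $ j $ j) - 2 * t * (norm s)\<^sup>2"
    using p[of "axis j 1 + (- (complex_of_real t * s)) *s axis i 1"]
    unfolding hform_add_axis[OF h] sum by (simp add: z)
  moreover have "t * (norm s)\<^sup>2 = Re (D $ j $ j) + (norm s)\<^sup>2"
    using nz by (simp add: t_def s_def field_simps)
  moreover have "0 \<le> Re (D $ j $ j)" "0 < (norm s)\<^sup>2"
    using psd_diag_nonneg[OF D] nz by (auto simp: s_def)
  ultimately show False by linarith
qed

text \<open>Symmetric elimination, as in the Cholesky factorization: the induction runs over a set
  containing all indices with nonzero diagonal entry, and each pivot splits off one rank-one term.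
  This does the work of a spectral decomposition.\<close>

lemma psd_decompose_aux:
  fixes D :: "complex^'n^'n"
  assumes "finite S" "psd D" "{i. D $ i $ i \<noteq> 0} \<subseteq> S"
  shows "\<exists>q :: 'n \<Rightarrow> complex^'n. \<forall>i j. D $ i $ j = (\<Sum>k\<in>S. q k $ i * cnj (q k $ j))"
  using assms
proof (induction S arbitrary: D rule: finite_induct)
  case empty
  then have "D $ i $ j = 0" for i j using psd_diag_zero[of D] by auto
  then show ?case by simp
next
  case (insert i S)
  show ?case
  proof (cases "D $ i $ i = 0")
    case True
    then obtain q where q: "\<forall>k j. D $ k $ j = (\<Sum>l\<in>S. q l $ k * cnj (q l $ j))"
      using insert.IH[of D] insert.prems by blast
    have "(\<Sum>l\<in>S. (q(i := 0)) l $ k * cnj ((q(i := 0)) l $ j)) = (\<Sum>l\<in>S. q l $ k * cnj (q l $ j))" for k j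
      using insert.hyps by (intro sum.cong) auto
    then show ?thesis using q insert.hyps
      by (intro exI[of _ "q(i := 0)"]) (simp del: fun_upd_apply, simp)
  next
    case False
    define d where "d = Re (D $ i $ i)"
    have h: "herm D" and p: "\<And>v. 0 \<le> Re (hform D v)" using insert.prems by (auto simp: psd_def)
    have Dii: "D $ i $ i = complex_of_real d"
      using psd_diag_real[OF insert.prems(1)] by (simp add: d_def)
    have d: "d > 0"
    proof -
      have "0 \<le> d" unfolding d_def by (rule psd_diag_nonneg[OF insert.prems(1)])
      moreover have "d \<noteq> 0" using False Dii by auto
      ultimately show ?thesis by simp
    qed
    \<comment> \<open>The Schur complement of the pivot; its row and column \<open>i\<close>
      vanish.\<close>
    define D' where "D' = (\<chi> k l. D $ k $ l - D $ k $ i * cnj (D $ l $ i) / complex_of_real d)"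
    have D'h: "herm D'"
      unfolding herm_def
    proof (intro allI)
      fix k l
      show "D' $ l $ k = cnj (D' $ k $ l)"
        using hermD[OF h, of l k] by (simp add: D'_def)
    qed
    have "0 \<le> Re (hform D' v)" for v
    proof -
      let ?s = "\<Sum>k\<in>UNIV. D $ k $ i * v $ k"
      have "hform D' v = hform D v - (\<Sum>k\<in>UNIV. \<Sum>l\<in>UNIV. (D $ k $ i * v $ k) * cnj (D $ l $ i * v $ l)) / d"
        by (simp add: hform_def D'_def algebra_simps sum_subtractf sum_divide_distrib)
      also have "(\<Sum>k\<in>UNIV. \<Sum>l\<in>UNIV. (D $ k $ i * v $ k) * cnj (D $ l $ i * v $ l)) = ?s * cnj ?s"
        by (simp add: sum_product)
      also have "\<dots> = complex_of_real ((norm ?s)\<^sup>2)"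
        by (simp only: complex_norm_square)
      finally have 1: "Re (hform D' v) = Re (hform D v) - (norm ?s)\<^sup>2 / d"
        by (simp del: of_real_power of_real_divide add: of_real_divide[symmetric])
      \<comment> \<open>The coefficient -s/d minimizes the form of \<open>D\<close> along
        \<open>axis i 1\<close>, and the minimum is the form of \<open>D'\<close>, which is
        therefore nonnegative.\<close>
      have "Re (cnj (- ?s / d) * ?s) = - ((norm ?s)\<^sup>2 / d)"
      proof -
        have "cnj (- ?s / d) * ?s = - (?s * cnj ?s / d)" by simp
        also have "\<dots> = complex_of_real (- ((norm ?s)\<^sup>2 / d))"
          by (simp only: complex_norm_square of_real_minus of_real_divide)
        finally show ?thesis by (simp only: Re_complex_of_real)
      qed
      moreover have "(norm (- ?s / complex_of_real d))\<^sup>2 * d = (norm ?s)\<^sup>2 / d"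
        using d by (simp add: norm_divide power_divide power2_eq_square)
      ultimately have "Re (hform D (v + (- ?s / d) *s axis i 1)) = Re (hform D v) - (norm ?s)\<^sup>2 / d"
        unfolding hform_add_axis[OF h] Dii by (simp only: Re_complex_of_real)
      then show ?thesis using 1 p by metis
    qed
    then have "psd D'" using D'h by (simp add: psd_def)
    \<comment> \<open>Elimination creates no new nonzero diagonal entry: where \<open>D\<close> has
      a zero on the diagonal its whole column is zero, so nothing is subtracted there.\<close>
    moreover have "{k. D' $ k $ k \<noteq> 0} \<subseteq> S"
    proof
      fix k assume "k \<in> {k. D' $ k $ k \<noteq> 0}"
      then have k: "D' $ k $ k \<noteq> 0" by simp
      have "k \<noteq> i" using k d Dii by (auto simp: D'_def)
      moreover have "D $ k $ k \<noteq> 0"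
      proof
        assume z: "D $ k $ k = 0"
        then have "D $ i $ k = 0" using psd_diag_zero insert.prems by blast
        then have "D $ k $ i = 0" using hermD[OF h, of k i] by simp
        then show False using k z by (simp add: D'_def)
      qed
      ultimately show "k \<in> S" using insert.prems by auto
    qed
    ultimately obtain q where q: "\<forall>k j. D' $ k $ j = (\<Sum>l\<in>S. q l $ k * cnj (q l $ j))"
      using insert.IH[of D'] by blast
    define r where "r = q(i := (\<chi> k. D $ k $ i / complex_of_real (sqrt d)))"
    have "(\<Sum>l\<in>S. r l $ k * cnj (r l $ j)) = D' $ k $ j" for k j
      unfolding q[rule_format] r_def using insert.hyps by (intro sum.cong) auto
    moreover have "complex_of_real (sqrt d) * complex_of_real (sqrt d) = complex_of_real d"
      using d by (metis of_real_mult less_imp_le real_sqrt_mult_self abs_of_pos)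
    then have "r i $ k * cnj (r i $ j) = D $ k $ i * cnj (D $ j $ i) / complex_of_real d" for k j
      by (simp add: r_def)
    ultimately have "D $ k $ j = (\<Sum>l\<in>insert i S. r l $ k * cnj (r l $ j))" for k j
      using insert.hyps by (simp add: D'_def)
    then show ?thesis by blast
  qed
qed

text \<open>Splitting \<open>D\<close> into rank-one terms turns the trace into a sum of values of
  the form of \<open>C\<close>.\<close>

lemma trace_psd_mult_nonneg:
  fixes C D :: "complex^'n^'n"
  assumes "psd C" "psd D"
  shows "0 \<le> Re (trace (C ** D))"
proof -
  obtain q :: "'n \<Rightarrow> complex^'n" where "\<forall>i j. D $ i $ j = (\<Sum>k\<in>UNIV. q k $ i * cnj (q k $ j))"
    using psd_decompose_aux[OF finite assms(2) subset_UNIV] by blast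
  then have q: "D $ i $ j = (\<Sum>k\<in>UNIV. q k $ i * cnj (q k $ j))" for i j by blast
  have "trace (C ** D) = (\<Sum>i\<in>UNIV. \<Sum>j\<in>UNIV. \<Sum>k\<in>UNIV. C $ i $ j * cnj (q k $ i) * q k $ j)"
    by (simp add: trace_def matrix_matrix_mult_def q sum_distrib_left mult_ac)
  also have "\<dots> = (\<Sum>i\<in>UNIV. \<Sum>k\<in>UNIV. \<Sum>j\<in>UNIV. C $ i $ j * cnj (q k $ i) * q k $ j)"
    by (subst sum.swap) (rule refl)
  also have "\<dots> = (\<Sum>k\<in>UNIV. hform C (\<chi> i. cnj (q k $ i)))"
    by (subst sum.swap) (simp add: hform_def)
  finally show ?thesis using assms(1) by (simp add: psd_def sum_nonneg)
qed

lemma map_matrix_cnj_mult: "map_matrix cnj (A ** B) = map_matrix cnj A ** map_matrix cnj B"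
  by (simp add: vec_eq_iff matrix_matrix_mult_def)

lemma map_matrix_cnj_mat_1: "map_matrix cnj (mat 1) = mat 1"
  by (simp add: vec_eq_iff mat_def)

text \<open>With y = M conj(v), the value of the form of \<open>M\<close> at v is the conjugate of
  the value of the form of \<open>A\<close> at conj(y).\<close>

lemma hermitian_pos_def_inverse:
  assumes A: "hermitian_pos_def A" and AM: "A ** M = mat 1"
  shows "hermitian_pos_def M"
proof -
  have MA: "M ** A = mat 1" using AM by (simp add: matrix_left_right_inverse)
  have "map_matrix cnj A = transpose A" using A by (simp add: hermitian_pos_def_iff herm_iff)
  then have "transpose A ** map_matrix cnj M = mat 1"
    using map_matrix_cnj_mult[of A M] by (simp add: AM map_matrix_cnj_mat_1)
  moreover have "transpose M ** transpose A = mat 1"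
    by (simp add: AM flip: matrix_transpose_mul)
  ultimately have "map_matrix cnj M = transpose M"
    by (metis matrix_mul_assoc matrix_mul_lid matrix_mul_rid)
  then have h: "herm M" by (simp add: herm_iff)
  have "0 < Re (hform M v)" if "v \<noteq> 0" for v
  proof -
    define y where "y = M *v (\<chi> j. cnj (v $ j))"
    define u where "u = (\<chi> j. cnj (y $ j))"
    have "A *v y = (\<chi> j. cnj (v $ j))" by (simp add: y_def matrix_vector_mul_assoc AM)
    then have v: "v $ i = cnj ((A *v y) $ i)" for i by simp
    have cu: "(\<chi> j. cnj (u $ j)) = y" by (simp add: u_def vec_eq_iff)
    have "hform M v = (\<Sum>i\<in>UNIV. cnj ((A *v y) $ i) * y $ i)"
      unfolding hform_alt y_def[symmetric] v[symmetric] ..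
    also have "\<dots> = cnj (hform A u)"
      unfolding hform_alt cu by (simp add: u_def mult_ac)
    finally have "Re (hform M v) = Re (hform A u)" by simp
    moreover have "u \<noteq> 0"
    proof
      assume "u = 0"
      then have "y = 0" by (simp add: u_def vec_eq_iff)
      then have "A *v y = 0" by (simp only: matrix_vector_mult_0_right)
      then have "v = 0" using v by (simp add: vec_eq_iff)
      then show False using that by simp
    qed
    ultimately show ?thesis using A by (simp add: hermitian_pos_def_iff)
  qed
  then show ?thesis using h by (simp add: hermitian_pos_def_iff)
qed

lemma hermitian_pos_def_inverse_exists:
  assumes "hermitian_pos_def A"
  obtains M where "A ** M = mat 1" "M ** A = mat 1" "hermitian_pos_def M"
  using matrix_inv_mult[OF hermitian_pos_def_det_nonzero[OF assms]]
    hermitian_pos_def_inverse[OF assms] by blast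

text \<open>The logarithmic derivative of the determinant along the segment is the trace of a
  semidefinite matrix times a definite one. This is the ellipticity of the Monge-Ampere operator on
  which the comparison rests.\<close>

lemma Re_det_mono:
  assumes A: "hermitian_pos_def A" and BA: "psd (B - A)"
  shows "Re (det A) \<le> Re (det B)"
proof -
  define M where "M t = A + t *\<^sub>R (B - A)" for t :: real
  have "\<exists>y. ((\<lambda>t. Re (det (M t))) has_real_derivative y) (at t) \<and> 0 \<le> y" if "0 \<le> t" for t
  proof -
    have pd: "hermitian_pos_def (M t)"
      unfolding M_def using A BA that by (intro hermitian_pos_def_add psd_scaleR)
    then obtain N where N: "N ** M t = mat 1" "hermitian_pos_def N"
      using hermitian_pos_def_inverse_exists by blast
    have "(M has_vector_derivative (B - A)) (at t)"
      unfolding M_def by (auto intro!: derivative_eq_intros)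
    from det_path_derivative[OF this N(1)]
    have "((\<lambda>t. Re (det (M t))) has_vector_derivative Re (det (M t) * trace ((B - A) ** N))) (at t)"
      by (rule bounded_linear.has_vector_derivative[OF bounded_linear_Re])
    moreover have "Re (det (M t) * trace ((B - A) ** N)) = Re (det (M t)) * Re (trace ((B - A) ** N))"
      by (subst hermitian_pos_def_det_eq[OF pd]) simp
    moreover have "0 \<le> Re (det (M t)) * Re (trace ((B - A) ** N))"
      by (intro mult_nonneg_nonneg trace_psd_mult_nonneg BA hermitian_pos_def_imp_psd N(2)
          less_imp_le[OF hermitian_pos_def_det_pos[OF pd]])
    ultimately show ?thesis by (auto simp: has_real_derivative_iff_has_vector_derivative)
  qed
  then have "Re (det (M 0)) \<le> Re (det (M 1))"
    by (intro DERIV_nonneg_imp_nondecreasing[of 0 1 "\<lambda>t. Re (det (M t))"]) simp_all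
  then show ?thesis by (simp add: M_def)
qed

definition cadj :: "complex^'n^'m \<Rightarrow> complex^'m^'n" where
  "cadj A = map_matrix cnj (transpose A)"

text \<open>The form of the congruent matrix at \<open>v\<close> is that of \<open>M\<close> at
  \<open>v v* V\<close>.\<close>

lemma psd_congruence:
  assumes "psd M"
  shows "psd (V ** M ** cadj V)"
proof -
  have e: "(V ** M ** cadj V) $ i $ j = (\<Sum>b\<in>UNIV. \<Sum>a\<in>UNIV. V $ i $ a * M $ a $ b * cnj (V $ j $ b))" for i j
    by (simp add: matrix_matrix_mult_def cadj_def transpose_def sum_distrib_right)
  have "herm (V ** M ** cadj V)"
    unfolding herm_def
  proof (intro allI)
    have sym: "cnj (V $ i $ a * M $ a $ b * cnj (V $ j $ b)) = V $ j $ b * M $ b $ a * cnj (V $ i $ a)" for i j a b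
      using assms hermD[of M b a] by (simp add: psd_def)
    show "(V ** M ** cadj V) $ j $ i = cnj ((V ** M ** cadj V) $ i $ j)" for i j
      unfolding e cnj_sum sym by (rule sum.swap)
  qed
  moreover have "hform (V ** M ** cadj V) v = hform M (v v* V)" for v
  proof -
    have "hform (V ** M ** cadj V) v
      = (\<Sum>i\<in>UNIV. \<Sum>j\<in>UNIV. \<Sum>b\<in>UNIV. \<Sum>a\<in>UNIV. V $ i $ a * v $ i * M $ a $ b * cnj (V $ j $ b * v $ j))"
      by (simp add: hform_def e sum_distrib_left sum_distrib_right mult_ac)
    also have "\<dots> = (\<Sum>i\<in>UNIV. \<Sum>b\<in>UNIV. \<Sum>j\<in>UNIV. \<Sum>a\<in>UNIV. V $ i $ a * v $ i * M $ a $ b * cnj (V $ j $ b * v $ j))"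
      by (intro sum.cong refl sum.swap)
    also have "\<dots> = (\<Sum>b\<in>UNIV. \<Sum>i\<in>UNIV. \<Sum>j\<in>UNIV. \<Sum>a\<in>UNIV. V $ i $ a * v $ i * M $ a $ b * cnj (V $ j $ b * v $ j))"
      by (rule sum.swap)
    also have "\<dots> = (\<Sum>b\<in>UNIV. \<Sum>i\<in>UNIV. \<Sum>a\<in>UNIV. \<Sum>j\<in>UNIV. V $ i $ a * v $ i * M $ a $ b * cnj (V $ j $ b * v $ j))"
      by (intro sum.cong refl sum.swap)
    also have "\<dots> = (\<Sum>b\<in>UNIV. \<Sum>a\<in>UNIV. \<Sum>i\<in>UNIV. \<Sum>j\<in>UNIV. V $ i $ a * v $ i * M $ a $ b * cnj (V $ j $ b * v $ j))"
      by (intro sum.cong refl sum.swap)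
    also have "\<dots> = (\<Sum>a\<in>UNIV. \<Sum>b\<in>UNIV. \<Sum>i\<in>UNIV. \<Sum>j\<in>UNIV. V $ i $ a * v $ i * M $ a $ b * cnj (V $ j $ b * v $ j))"
      by (rule sum.swap)
    also have "\<dots> = hform M (v v* V)"
      by (simp add: hform_def vector_matrix_mult_def sum_distrib_left sum_distrib_right mult_ac)
    finally show ?thesis .
  qed
  ultimately show ?thesis using assms by (simp add: psd_def)
qed

lemma psd_transpose: assumes "psd M" shows "psd (transpose M)"
proof -
  have h: "herm M" using assms by (simp add: psd_def)
  have "herm (transpose M)" unfolding herm_def transpose_def by (simp add: hermD[OF h, symmetric])
  moreover have "hform (transpose M) v = hform M (\<chi> i. cnj (v $ i))" for v
    unfolding hform_def by (subst sum.swap) (simp add: transpose_def mult_ac)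
  ultimately show ?thesis using assms by (simp add: psd_def)
qed

lemma trace_congruence_nonneg:
  "psd C \<Longrightarrow> psd D \<Longrightarrow> 0 \<le> Re (trace (C ** V ** D ** cadj V))"
  using trace_psd_mult_nonneg[OF _ psd_congruence, of C D V] by (simp add: matrix_mul_assoc)

section \<open>Block matrices and two determinant formulas\<close>

lemma sum_UNIV_sum: "sum f (UNIV :: ('a::finite + 'b::finite) set)
    = (\<Sum>a\<in>UNIV. f (Inl a)) + (\<Sum>b\<in>UNIV. f (Inr b))"
  unfolding UNIV_Plus_UNIV[symmetric] by (subst sum.Plus) auto

definition block_diag :: "complex^'a^'a \<Rightarrow> complex^'b^'b \<Rightarrow> complex^('a+'b)^('a+'b)" where
  "block_diag A B = (\<chi> i j. case i of
     Inl a \<Rightarrow> (case j of Inl a' \<Rightarrow> A $ a $ a' | Inr b' \<Rightarrow> 0)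
   | Inr b \<Rightarrow> (case j of Inl a' \<Rightarrow> 0 | Inr b' \<Rightarrow> B $ b $ b'))"

lemma vec_sum_eq_iff: "(A :: complex^('a::finite+'b::finite)^('a+'b)) = B \<longleftrightarrow>
   (\<forall>a a'. A $ Inl a $ Inl a' = B $ Inl a $ Inl a') \<and> (\<forall>a b'. A $ Inl a $ Inr b' = B $ Inl a $ Inr b')
 \<and> (\<forall>b a'. A $ Inr b $ Inl a' = B $ Inr b $ Inl a') \<and> (\<forall>b b'. A $ Inr b $ Inr b' = B $ Inr b $ Inr b')"
  by (auto simp: vec_eq_iff split_sum_all)

lemma block_diag_mult:
  "block_diag A B ** block_diag C D = block_diag (A ** C) (B ** D :: complex^'b::finite^'b)"
  for A :: "complex^'a::finite^'a"
  by (simp add: vec_sum_eq_iff block_diag_def matrix_matrix_mult_def sum_UNIV_sum)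

lemma block_diag_mat_1: "block_diag (mat 1) (mat 1) = mat 1"
  by (simp add: vec_sum_eq_iff block_diag_def mat_def)

lemma trace_block_diag: "trace (block_diag A B) = trace A + trace B"
  by (simp add: trace_def block_diag_def sum_UNIV_sum)

lemma has_vector_derivative_segment:
  "((\<lambda>t. (1 - t) *\<^sub>R a + t *\<^sub>R b) has_vector_derivative (b - a)) (at t within S)"
  by (auto intro!: derivative_eq_intros)

text \<open>Both sides of such a determinant identity satisfy the same linear differential equation
  \<open>f' = f tr (M' M\<^sup>-\<^sup>1)\<close> along the segment from the identity matrix.\<close>

lemma det_block_diag:
  fixes A :: "complex^'a::finite^'a" and B :: "complex^'b::finite^'b"
  assumes A: "hermitian_pos_def A" and B: "hermitian_pos_def B"
  shows "det (block_diag A B) = det A * det B"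
proof -
  define M where "M t = (1 - t) *\<^sub>R mat 1 + t *\<^sub>R A" for t :: real
  define N where "N t = (1 - t) *\<^sub>R mat 1 + t *\<^sub>R B" for t :: real
  \<comment> \<open>The common logarithmic derivative of both sides.\<close>
  define c where "c t = trace ((A - mat 1) ** matrix_inv (M t)) + trace ((B - mat 1) ** matrix_inv (N t))" for t
  have Mpd: "hermitian_pos_def (M t)" and Npd: "hermitian_pos_def (N t)" if "t \<in> {0..1}" for t
    using hermitian_pos_def_segment assms that by (auto simp: M_def N_def)
  have Mi: "matrix_inv (M t) ** M t = mat 1" and Ni: "matrix_inv (N t) ** N t = mat 1" if "t \<in> {0..1}" for t
    using matrix_inv_mult hermitian_pos_def_det_nonzero Mpd Npd that by blast+
  have Md: "(M has_vector_derivative (A - mat 1)) (at t within {0..1})"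
    and Nd: "(N has_vector_derivative (B - mat 1)) (at t within {0..1})" for t
    unfolding M_def N_def by (rule has_vector_derivative_segment)+
  \<comment> \<open>Both blocks move with the same parameter, so the block matrix itself runs along
    a segment that starts at the identity.\<close>
  have eq: "block_diag (M t) (N t) = (1 - t) *\<^sub>R mat 1 + t *\<^sub>R block_diag A B" for t
    by (simp add: vec_sum_eq_iff block_diag_def M_def N_def mat_def)
  have eq': "block_diag A B - mat 1 = block_diag (A - mat 1) (B - mat 1)"
    by (simp add: vec_sum_eq_iff block_diag_def mat_def)
  have bd: "((\<lambda>t. block_diag (M t) (N t)) has_vector_derivative block_diag (A - mat 1) (B - mat 1)) (at t within {0..1})" for t
    unfolding eq eq'[symmetric] by (rule has_vector_derivative_segment)
  have "det (block_diag (M 1) (N 1)) = det (M 1) * det (N 1)"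
  proof (rule linear_ode_eq[where c = c])
    fix t :: real assume t: "t \<in> {0..1}"
    have inv: "block_diag (matrix_inv (M t)) (matrix_inv (N t)) ** block_diag (M t) (N t) = mat 1"
      by (simp only: block_diag_mult Mi[OF t] Ni[OF t] block_diag_mat_1)
    show "((\<lambda>t. det (block_diag (M t) (N t))) has_vector_derivative det (block_diag (M t) (N t)) * c t) (at t within {0..1})"
      using det_path_derivative[OF bd inv] by (simp add: block_diag_mult trace_block_diag c_def)
    show "((\<lambda>t. det (M t) * det (N t)) has_vector_derivative det (M t) * det (N t) * c t) (at t within {0..1})"
      using has_vector_derivative_mult[OF det_path_derivative[OF Md Mi] det_path_derivative[OF Nd Ni], OF t t]
      by (simp add: c_def algebra_simps)
    show "det (M t) * det (N t) \<noteq> 0"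
      using hermitian_pos_def_det_nonzero[OF Mpd[OF t]] hermitian_pos_def_det_nonzero[OF Npd[OF t]] by simp
  qed (simp add: M_def N_def block_diag_mat_1)
  then show ?thesis by (simp add: M_def N_def)
qed

text \<open>Covers the rank-one matrices, with m the squared length of the vector, and for m = 0 a
  matrix of square and trace zero, as it occurs in the unipotent change of coframe.\<close>

lemma det_mat_1_add:
  fixes P :: "complex^'n::finite^'n"
  assumes P: "P ** P = m *\<^sub>R P" "trace P = complex_of_real m" and m: "m \<ge> 0"
  shows "det (mat 1 + P) = complex_of_real (1 + m)"
proof -
  define c where "c t = complex_of_real (m / (1 + t * m))" for t
  have "det (mat 1 + 1 *\<^sub>R P) = complex_of_real (1 + 1 * m)"
  proof (rule linear_ode_eq[where c = c and f = "\<lambda>t. det (mat 1 + t *\<^sub>R P)"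
        and g = "\<lambda>t. complex_of_real (1 + t * m)"])
    fix t :: real assume t: "t \<in> {0..1}"
    have pos: "1 + t * m > 0" using t m by (simp add: add_pos_nonneg)
    \<comment> \<open>The inverse of I + t P, found from P^2 = m P as for a rank-one
      perturbation.\<close>
    let ?N = "mat 1 - (t / (1 + t * m)) *\<^sub>R P"
    have Pd: "((\<lambda>t. mat 1 + t *\<^sub>R P) has_vector_derivative P) (at t within {0..1})"
      by (auto intro!: derivative_eq_intros)
    have "?N ** (mat 1 + t *\<^sub>R P) = mat 1 + (t - t / (1 + t * m) - t / (1 + t * m) * t * m) *\<^sub>R P"
      by (simp add: matrix_mult_diff_left matrix_mult_add_right matrix_mult_scaleR_left
          matrix_mult_scaleR_right P(1) algebra_simps)
    also have "t - t / (1 + t * m) - t / (1 + t * m) * t * m = 0"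
      using pos by (simp add: field_simps)
    finally have inv: "?N ** (mat 1 + t *\<^sub>R P) = mat 1" by simp
    have "trace (P ** ?N) = m - t / (1 + t * m) * m * m"
      by (simp add: matrix_mult_diff_right matrix_mult_scaleR_right P trace_sub trace_scaleR)
         (simp add: scaleR_conv_of_real)
    also have "\<dots> = c t"
      using pos by (simp add: c_def field_simps flip: of_real_mult of_real_divide of_real_diff of_real_add)
    finally show "((\<lambda>t. det (mat 1 + t *\<^sub>R P)) has_vector_derivative det (mat 1 + t *\<^sub>R P) * c t) (at t within {0..1})"
      using det_path_derivative[OF Pd inv] by simp
    have "((\<lambda>t. complex_of_real (1 + t * m)) has_vector_derivative complex_of_real m) (at t within {0..1})"
      by (rule has_vector_derivative_of_real) (auto intro!: derivative_eq_intros simp flip: has_real_derivative_iff_has_vector_derivative)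
    moreover have "complex_of_real m = complex_of_real (1 + t * m) * c t"
      using pos unfolding c_def of_real_mult[symmetric] by simp
    ultimately show "((\<lambda>t. complex_of_real (1 + t * m)) has_vector_derivative complex_of_real (1 + t * m) * c t) (at t within {0..1})"
      by (rule has_vector_derivative_eq_rhs)
    show "complex_of_real (1 + t * m) \<noteq> 0" using pos by (metis less_irrefl of_real_eq_0_iff)
  qed simp
  then show ?thesis by simp
qed

section \<open>Smooth functions and Wirtinger calculus\<close>

lemma frechet_derivative_cong_open:
  assumes "open S" "x \<in> S" "\<And>y. y \<in> S \<Longrightarrow> f y = g y"
  shows "frechet_derivative f (at x) = frechet_derivative g (at x)"
proof -
  have "(f has_derivative f') (at x) \<longleftrightarrow> (g has_derivative f') (at x)" for f'
    using has_derivative_transform_within_open[OF _ assms(1,2)] assms(3) by metis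
  then show ?thesis by (simp add: frechet_derivative_def)
qed

lemma differentiable_cong_open:
  assumes "open S" "x \<in> S" "\<And>y. y \<in> S \<Longrightarrow> f y = g y"
  shows "f differentiable (at x) \<longleftrightarrow> g differentiable (at x)"
  unfolding differentiable_def using has_derivative_transform_within_open[OF _ assms(1,2)] assms(3) by metis

lemma Ck_on_cong:
  assumes "open S" "\<And>y. y \<in> S \<Longrightarrow> f y = g y"
  shows "Ck_on k f S \<longleftrightarrow> Ck_on k g S"
  using assms(2)
proof (induction k arbitrary: f g)
  case 0
  then show ?case using continuous_on_cong[of S S f g] by simp
next
  case (Suc k)
  have "Ck_on k (\<lambda>x. frechet_derivative f (at x) v) S \<longleftrightarrow> Ck_on k (\<lambda>x. frechet_derivative g (at x) v) S" for v
    by (rule Suc.IH) (simp add: frechet_derivative_cong_open[OF assms(1) _ Suc.prems])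
  then show ?case using differentiable_cong_open[OF assms(1) _ Suc.prems] by auto
qed

lemma Ck_on_SucD: "Ck_on (Suc k) f S \<Longrightarrow> Ck_on k f S"
proof (induction k arbitrary: f)
  case 0
  then show ?case
    by (auto intro!: continuous_at_imp_continuous_on differentiable_imp_continuous_within)
qed auto

text \<open>\<open>Ck_on\<close> speaks of \<open>frechet_derivative\<close>, a choice; this rule
  accepts any explicit derivative instead and drives the smoothness proofs below.\<close>

lemma Ck_on_SucI:
  assumes "open S" "\<And>x. x \<in> S \<Longrightarrow> (f has_derivative f' x) (at x)" "\<And>v. Ck_on k (\<lambda>x. f' x v) S"
  shows "Ck_on (Suc k) f S"
proof -
  have "frechet_derivative f (at x) = f' x" if "x \<in> S" for x
    using frechet_derivative_at[OF assms(2)[OF that]] by simp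
  then have "Ck_on k (\<lambda>x. frechet_derivative f (at x) v) S" for v
    using assms(3)[of v] Ck_on_cong[OF assms(1), of "\<lambda>x. frechet_derivative f (at x) v" "\<lambda>x. f' x v" k] by simp
  then show ?thesis using assms(2) by (auto simp: differentiable_def)
qed

lemma Ck_on_Suc_has_derivative:
  "Ck_on (Suc k) f S \<Longrightarrow> x \<in> S \<Longrightarrow> (f has_derivative frechet_derivative f (at x)) (at x)"
  by (simp add: frechet_derivative_works)

lemma Ck_on_const: "open S \<Longrightarrow> Ck_on k (\<lambda>_. c) S"
proof (induction k arbitrary: c)
  case (Suc k)
  then show ?case by (intro Ck_on_SucI[where f'="\<lambda>_ _. 0"]) auto
qed simp

lemma Ck_on_bounded_linear:
  assumes "bounded_linear L" "open S"
  shows "Ck_on k f S \<Longrightarrow> Ck_on k (\<lambda>x. L (f x)) S"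
proof (induction k arbitrary: f)
  case 0
  then show ?case using bounded_linear.continuous_on[OF assms(1)] by auto
next
  case (Suc k)
  show ?case
  proof (rule Ck_on_SucI[OF assms(2), where f'="\<lambda>x v. L (frechet_derivative f (at x) v)"])
    show "((\<lambda>x. L (f x)) has_derivative (\<lambda>v. L (frechet_derivative f (at x) v))) (at x)"
      if "x \<in> S" for x
      using Suc.prems that by (intro bounded_linear.has_derivative[OF assms(1)] Ck_on_Suc_has_derivative)
  qed (use Suc in auto)
qed

lemma Ck_on_ident:
  assumes "open S" shows "Ck_on k (\<lambda>x. x) S"
proof (cases k)
  case (Suc l)
  then show ?thesis using assms
    by (auto intro!: Ck_on_SucI[where f'="\<lambda>x v. v"] Ck_on_const simp del: Ck_on.simps)
qed simp

lemma Ck_on_add: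
  assumes S: "open S"
  shows "Ck_on k f S \<Longrightarrow> Ck_on k g S \<Longrightarrow> Ck_on k (\<lambda>x. f x + g x) S"
proof (induction k arbitrary: f g)
  case 0
  then show ?case by (auto intro: continuous_on_add)
next
  case (Suc k)
  show ?case
  proof (rule Ck_on_SucI[OF S, where f'="\<lambda>x v. frechet_derivative f (at x) v + frechet_derivative g (at x) v"])
    show "((\<lambda>x. f x + g x) has_derivative (\<lambda>v. frechet_derivative f (at x) v + frechet_derivative g (at x) v)) (at x)"
      if "x \<in> S" for x
      using Suc.prems that by (intro has_derivative_add Ck_on_Suc_has_derivative)
  qed (use Suc in auto)
qed

text \<open>The derivative of a product is a sum of two products of the same kind with one factor
  differentiated, hence the generalization over both factors in the induction.\<close>

lemma Ck_on_bilinear: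
  assumes bl: "bounded_bilinear p" and S: "open S"
  shows "Ck_on k f S \<Longrightarrow> Ck_on k g S \<Longrightarrow> Ck_on k (\<lambda>x. p (f x) (g x)) S"
proof (induction k arbitrary: f g)
  case 0
  then show ?case by (auto intro: bounded_bilinear.continuous_on[OF bl])
next
  case (Suc k)
  show ?case
  proof (rule Ck_on_SucI[OF S, where f'="\<lambda>x v. p (f x) (frechet_derivative g (at x) v) + p (frechet_derivative f (at x) v) (g x)"])
    show "((\<lambda>x. p (f x) (g x)) has_derivative (\<lambda>v. p (f x) (frechet_derivative g (at x) v) + p (frechet_derivative f (at x) v) (g x))) (at x)"
      if "x \<in> S" for x
      using Suc.prems that by (intro bounded_bilinear.FDERIV[OF bl] Ck_on_Suc_has_derivative)
    show "Ck_on k (\<lambda>x. p (f x) (frechet_derivative g (at x) v) + p (frechet_derivative f (at x) v) (g x)) S" for v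
      using Suc.prems Ck_on_SucD[OF Suc.prems(1)] Ck_on_SucD[OF Suc.prems(2)]
      by (intro Ck_on_add[OF S] Suc.IH) auto
  qed
qed

lemma smooth_on_cong:
  "open S \<Longrightarrow> (\<And>y. y \<in> S \<Longrightarrow> f y = g y) \<Longrightarrow> smooth_on f S \<longleftrightarrow> smooth_on g S"
  unfolding smooth_on_def using Ck_on_cong by blast

lemma smooth_on_subset: "smooth_on f T \<Longrightarrow> S \<subseteq> T \<Longrightarrow> smooth_on f S"
proof -
  have "Ck_on k f T \<Longrightarrow> S \<subseteq> T \<Longrightarrow> Ck_on k f S" for k and f :: "'a \<Rightarrow> 'b"
    by (induction k arbitrary: f) (auto intro: continuous_on_subset)
  then show "smooth_on f T \<Longrightarrow> S \<subseteq> T \<Longrightarrow> smooth_on f S" by (auto simp: smooth_on_def)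
qed

lemma smooth_on_has_derivative:
  "smooth_on f S \<Longrightarrow> x \<in> S \<Longrightarrow> (f has_derivative frechet_derivative f (at x)) (at x)"
  unfolding smooth_on_def by (metis Ck_on_Suc_has_derivative)

lemma smooth_on_differentiable: "smooth_on f S \<Longrightarrow> x \<in> S \<Longrightarrow> f differentiable (at x)"
  using smooth_on_has_derivative unfolding differentiable_def by blast

lemma smooth_on_continuous_on: "smooth_on f S \<Longrightarrow> continuous_on S f"
  unfolding smooth_on_def by (metis Ck_on.simps(1))

lemma smooth_on_frechet_derivative:
  "smooth_on f S \<Longrightarrow> smooth_on (\<lambda>x. frechet_derivative f (at x) v) S"
  unfolding smooth_on_def by (metis Ck_on.simps(2))

lemma smooth_on_const: "open S \<Longrightarrow> smooth_on (\<lambda>_. c) S"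
  by (simp add: smooth_on_def Ck_on_const)

lemma smooth_on_linear_compose:
  "bounded_linear L \<Longrightarrow> open S \<Longrightarrow> smooth_on f S \<Longrightarrow> smooth_on (\<lambda>x. L (f x)) S"
  by (simp add: smooth_on_def Ck_on_bounded_linear)

lemma smooth_on_linear: "bounded_linear L \<Longrightarrow> open S \<Longrightarrow> smooth_on L S"
  using smooth_on_linear_compose[of L S "\<lambda>x. x"] by (simp add: smooth_on_def Ck_on_ident)

lemma smooth_on_add: "open S \<Longrightarrow> smooth_on f S \<Longrightarrow> smooth_on g S \<Longrightarrow> smooth_on (\<lambda>x. f x + g x) S"
  unfolding smooth_on_def using Ck_on_add by blast

lemma smooth_on_bilinear:
  "bounded_bilinear p \<Longrightarrow> open S \<Longrightarrow> smooth_on f S \<Longrightarrow> smooth_on g S \<Longrightarrow> smooth_on (\<lambda>x. p (f x) (g x)) S"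
  unfolding smooth_on_def using Ck_on_bilinear by blast

lemma smooth_on_minus: "open S \<Longrightarrow> smooth_on f S \<Longrightarrow> smooth_on (\<lambda>x. - f x) S"
  by (rule smooth_on_linear_compose[OF bounded_linear_minus[OF bounded_linear_ident]])

lemma smooth_on_diff: "open S \<Longrightarrow> smooth_on f S \<Longrightarrow> smooth_on g S \<Longrightarrow> smooth_on (\<lambda>x. f x - g x) S"
  using smooth_on_add[of S f "\<lambda>x. - g x"] smooth_on_minus[of S g] by simp

lemmas smooth_on_mult = smooth_on_bilinear[OF bounded_bilinear_mult]

lemma smooth_on_sum:
  "open S \<Longrightarrow> (\<And>i. i \<in> I \<Longrightarrow> smooth_on (f i) S) \<Longrightarrow> smooth_on (\<lambda>x. \<Sum>i\<in>I. f i x) S"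
  by (induction I rule: infinite_finite_induct) (auto intro!: smooth_on_const smooth_on_add)

lemma smooth_on_prod:
  fixes f :: "'i \<Rightarrow> 'a::real_normed_vector \<Rightarrow> 'b::{real_normed_algebra, comm_ring_1}"
  shows "open S \<Longrightarrow> (\<And>i. i \<in> I \<Longrightarrow> smooth_on (f i) S) \<Longrightarrow> smooth_on (\<lambda>x. \<Prod>i\<in>I. f i x) S"
  by (induction I rule: infinite_finite_induct) (auto intro!: smooth_on_const smooth_on_mult)

text \<open>The induction keeps \<open>h\<close> fixed: the derivative of the reciprocal is a
  product of the reciprocal itself, twice, and a derivative of \<open>h\<close>.\<close>

lemma smooth_on_inverse:
  fixes h :: "'a::real_normed_vector \<Rightarrow> real"
  assumes "open S" "smooth_on h S" "\<And>x. x \<in> S \<Longrightarrow> h x \<noteq> 0"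
  shows "smooth_on (\<lambda>x. inverse (h x)) S"
proof -
  have hk: "Ck_on k h S" for k using assms(2) by (simp add: smooth_on_def)
  have "Ck_on k (\<lambda>x. inverse (h x)) S" for k
  proof (induction k)
    case 0
    then show ?case using hk[of 0] assms(3) by (auto intro: continuous_on_inverse)
  next
    case (Suc k)
    show ?case
    proof (rule Ck_on_SucI[OF assms(1), where f'="\<lambda>x v. - (inverse (h x) * frechet_derivative h (at x) v * inverse (h x))"])
      show "((\<lambda>x. inverse (h x)) has_derivative (\<lambda>v. - (inverse (h x) * frechet_derivative h (at x) v * inverse (h x)))) (at x)"
        if "x \<in> S" for x
        using that assms by (intro Deriv.has_derivative_inverse smooth_on_has_derivative)
      show "Ck_on k (\<lambda>x. - (inverse (h x) * frechet_derivative h (at x) v * inverse (h x))) S" for v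
        using hk[of "Suc k"]
        by (intro Ck_on_bounded_linear[OF bounded_linear_minus[OF bounded_linear_ident] assms(1)]
            Ck_on_bilinear[OF bounded_bilinear_mult assms(1)] Suc) simp
    qed
  qed
  then show ?thesis by (simp add: smooth_on_def)
qed

lemma smooth_on_exp:
  fixes h :: "'a::real_normed_vector \<Rightarrow> real"
  assumes "open S" "smooth_on h S"
  shows "smooth_on (\<lambda>x. exp (h x)) S"
proof -
  have hk: "Ck_on k h S" for k using assms(2) by (simp add: smooth_on_def)
  have "Ck_on k (\<lambda>x. exp (h x)) S" for k
  proof (induction k)
    case 0
    then show ?case using hk[of 0] by (auto intro: continuous_on_exp)
  next
    case (Suc k)
    show ?case
    proof (rule Ck_on_SucI[OF assms(1), where f'="\<lambda>x v. exp (h x) * frechet_derivative h (at x) v"])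
      show "((\<lambda>x. exp (h x)) has_derivative (\<lambda>v. exp (h x) * frechet_derivative h (at x) v)) (at x)"
        if "x \<in> S" for x
        using smooth_on_has_derivative[OF assms(2) that] by (auto intro!: derivative_eq_intros)
      show "Ck_on k (\<lambda>x. exp (h x) * frechet_derivative h (at x) v) S" for v
        using hk[of "Suc k"] by (intro Ck_on_bilinear[OF bounded_bilinear_mult assms(1)] Suc) simp
    qed
  qed
  then show ?thesis by (simp add: smooth_on_def)
qed

text \<open>One differentiation leaves the reciprocal, whose smoothness is known; this replaces an
  induction and is why the orders start at \<open>Suc k\<close>.\<close>

lemma smooth_on_ln:
  fixes h :: "'a::real_normed_vector \<Rightarrow> real"
  assumes "open S" "smooth_on h S" "\<And>x. x \<in> S \<Longrightarrow> h x > 0"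
  shows "smooth_on (\<lambda>x. ln (h x)) S"
proof -
  have "Ck_on (Suc k) (\<lambda>x. ln (h x)) S" for k
  proof (rule Ck_on_SucI[OF assms(1), where f'="\<lambda>x v. inverse (h x) * frechet_derivative h (at x) v"])
    show "((\<lambda>x. ln (h x)) has_derivative (\<lambda>v. inverse (h x) * frechet_derivative h (at x) v)) (at x)"
      if "x \<in> S" for x
      using smooth_on_has_derivative[OF assms(2) that] assms(3)[OF that]
      by (auto intro!: derivative_eq_intros simp: field_simps)
    show "Ck_on k (\<lambda>x. inverse (h x) * frechet_derivative h (at x) v) S" for v
      using smooth_on_mult[OF assms(1) smooth_on_inverse smooth_on_frechet_derivative] assms
      by (auto simp: smooth_on_def less_imp_neq[symmetric])
  qed
  then show ?thesis unfolding smooth_on_def using Ck_on_SucD by blast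
qed

section \<open>Symmetry of second derivatives\<close>

lemma line_has_vector_derivative:
  assumes "f differentiable (at (x + s *\<^sub>R u))"
  shows "((\<lambda>s. f (x + s *\<^sub>R u)) has_vector_derivative frechet_derivative f (at (x + s *\<^sub>R u)) u) (at s)"
proof -
  have "((\<lambda>s. x + s *\<^sub>R u) has_derivative (\<lambda>h. h *\<^sub>R u)) (at s)"
    by (auto intro!: derivative_eq_intros)
  moreover have "(f has_derivative frechet_derivative f (at (x + s *\<^sub>R u))) (at (x + s *\<^sub>R u))"
    using assms by (simp add: frechet_derivative_works)
  ultimately have d: "((\<lambda>s. f (x + s *\<^sub>R u)) has_derivative
      (\<lambda>h. frechet_derivative f (at (x + s *\<^sub>R u)) (h *\<^sub>R u))) (at s)"
    by (rule has_derivative_compose)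
  show ?thesis
    unfolding has_vector_derivative_def
    using d linear.scaleR[OF linear_frechet_derivative[OF assms]] by simp
qed

text \<open>The mean value theorem twice: for the increment in direction \<open>v\<close> as a
  function along \<open>u\<close>, and for the resulting difference of derivatives along
  \<open>v\<close>.\<close>

lemma second_difference_mvt:
  fixes f :: "'a::real_normed_vector \<Rightarrow> real"
  assumes f: "smooth_on f S" and h: "h > 0"
    and S: "\<And>s t. 0 \<le> s \<Longrightarrow> s \<le> h \<Longrightarrow> 0 \<le> t \<Longrightarrow> t \<le> h \<Longrightarrow> x + s *\<^sub>R u + t *\<^sub>R v \<in> S"
  shows "\<exists>s t. 0 < s \<and> s < h \<and> 0 < t \<and> t < h \<and>
    f (x + h *\<^sub>R u + h *\<^sub>R v) - f (x + h *\<^sub>R u) - (f (x + h *\<^sub>R v) - f x)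
    = h * (h * frechet_derivative (\<lambda>p. frechet_derivative f (at p) u) (at (x + s *\<^sub>R u + t *\<^sub>R v)) v)"
proof -
  let ?D = "\<lambda>p. frechet_derivative f (at p) u"
  have "((\<lambda>s. f (x + h *\<^sub>R v + s *\<^sub>R u) - f (x + s *\<^sub>R u)) has_real_derivative
       (?D (x + h *\<^sub>R v + s *\<^sub>R u) - ?D (x + s *\<^sub>R u))) (at s)" if "0 \<le> s" "s \<le> h" for s
  proof -
    have "x + s *\<^sub>R u + h *\<^sub>R v \<in> S" "x + s *\<^sub>R u + 0 *\<^sub>R v \<in> S" using S[of s h] S[of s 0] that h by auto
    then have "x + h *\<^sub>R v + s *\<^sub>R u \<in> S" "x + s *\<^sub>R u \<in> S" by (auto simp: algebra_simps)
    then show ?thesis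
      unfolding has_real_derivative_iff_has_vector_derivative
      by (intro has_vector_derivative_diff line_has_vector_derivative smooth_on_differentiable[OF f])
  qed
  then obtain s where s: "0 < s" "s < h"
    "f (x + h *\<^sub>R v + h *\<^sub>R u) - f (x + h *\<^sub>R u) - (f (x + h *\<^sub>R v + 0 *\<^sub>R u) - f (x + 0 *\<^sub>R u))
      = (h - 0) * (?D (x + h *\<^sub>R v + s *\<^sub>R u) - ?D (x + s *\<^sub>R u))"
    using MVT2[OF h, of "\<lambda>s. f (x + h *\<^sub>R v + s *\<^sub>R u) - f (x + s *\<^sub>R u)"
        "\<lambda>s. ?D (x + h *\<^sub>R v + s *\<^sub>R u) - ?D (x + s *\<^sub>R u)"] by blast
  have "((\<lambda>t. ?D (x + s *\<^sub>R u + t *\<^sub>R v)) has_real_derivative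
      frechet_derivative ?D (at (x + s *\<^sub>R u + t *\<^sub>R v)) v) (at t)" if "0 \<le> t" "t \<le> h" for t
    unfolding has_real_derivative_iff_has_vector_derivative
    by (rule line_has_vector_derivative, rule smooth_on_differentiable[OF smooth_on_frechet_derivative[OF f]])
       (use S s that in auto)
  then obtain t where t: "0 < t" "t < h"
    "?D (x + s *\<^sub>R u + h *\<^sub>R v) - ?D (x + s *\<^sub>R u + 0 *\<^sub>R v)
      = (h - 0) * frechet_derivative ?D (at (x + s *\<^sub>R u + t *\<^sub>R v)) v"
    using MVT2[OF h, of "\<lambda>t. ?D (x + s *\<^sub>R u + t *\<^sub>R v)"
        "\<lambda>t. frechet_derivative ?D (at (x + s *\<^sub>R u + t *\<^sub>R v)) v"] by blast
  have e: "x + h *\<^sub>R v + s *\<^sub>R u = x + s *\<^sub>R u + h *\<^sub>R v" for s by (simp add: algebra_simps)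
  show ?thesis
    using s t unfolding e by (intro exI[of _ s] exI[of _ t]) simp
qed

text \<open>The second difference does not change when \<open>u\<close> and \<open>v\<close> are
  exchanged, so a value of one mixed derivative equals a value of the other at points as close to
  \<open>x\<close> as desired; continuity does the rest.\<close>

lemma frechet_derivative_commute_real:
  fixes f :: "'a::real_normed_vector \<Rightarrow> real"
  assumes f: "smooth_on f S" and S: "open S" "x \<in> S"
  shows "frechet_derivative (\<lambda>p. frechet_derivative f (at p) u) (at x) v
       = frechet_derivative (\<lambda>p. frechet_derivative f (at p) v) (at x) u"
    (is "?A u v x = ?A v u x")
proof (rule ccontr)
  assume "?A u v x \<noteq> ?A v u x"
  define e where "e = \<bar>?A u v x - ?A v u x\<bar> / 2"
  have e: "e > 0" using \<open>?A u v x \<noteq> ?A v u x\<close> by (simp add: e_def)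
  have "continuous (at x) (?A u v)" "continuous (at x) (?A v u)"
    using smooth_on_continuous_on[OF smooth_on_frechet_derivative[OF smooth_on_frechet_derivative[OF f]]] S
    by (auto simp: continuous_on_eq_continuous_at)
  then obtain d1 d2 where d: "d1 > 0" "\<And>y. dist y x < d1 \<Longrightarrow> dist (?A u v y) (?A u v x) < e"
      "d2 > 0" "\<And>y. dist y x < d2 \<Longrightarrow> dist (?A v u y) (?A v u x) < e"
    using e unfolding continuous_at_eps_delta by metis
  obtain d3 where d3: "d3 > 0" "ball x d3 \<subseteq> S" using S by (meson open_contains_ball)
  define r where "r = Min {d1, d2, d3}"
  have r: "r > 0" "r \<le> d1" "r \<le> d2" "r \<le> d3" using d d3 by (auto simp: r_def)
  \<comment> \<open>Small enough for the whole parallelogram with sides \<open>h *\<^sub>R u\<close>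
    and \<open>h *\<^sub>R v\<close> to stay within distance \<open>r\<close> of \<open>x\<close>;
    the summand 1 keeps the denominator positive.\<close>
  define h where "h = r / (norm u + norm v + 1)"
  have pos: "norm u + norm v + 1 > 0" by (simp add: add_nonneg_pos)
  have h: "h > 0" unfolding h_def using r pos by simp
  have near: "dist (x + s *\<^sub>R u + t *\<^sub>R v) x < r" if "0 \<le> s" "s \<le> h" "0 \<le> t" "t \<le> h" for s t
  proof -
    have "dist (x + s *\<^sub>R u + t *\<^sub>R v) x = norm (s *\<^sub>R u + t *\<^sub>R v)" by (simp add: dist_norm add.assoc)
    also have "\<dots> \<le> s * norm u + t * norm v" by (rule norm_triangle_le) (use that in simp)
    also have "\<dots> \<le> h * norm u + h * norm v" using that by (intro add_mono mult_right_mono) auto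
    also have "\<dots> < h * (norm u + norm v + 1)" using h by (simp add: algebra_simps)
    also have "\<dots> = r" using pos by (simp add: h_def)
    finally show ?thesis .
  qed
  have inS: "x + s *\<^sub>R u + t *\<^sub>R v \<in> S" if "0 \<le> s" "s \<le> h" "0 \<le> t" "t \<le> h" for s t
    using near[OF that] d3(2) r(4) by (auto simp: subset_iff dist_commute)
  then have inS': "x + s *\<^sub>R v + t *\<^sub>R u \<in> S" if "0 \<le> s" "s \<le> h" "0 \<le> t" "t \<le> h" for s t
    using inS[of t s] that by (simp add: algebra_simps)
  obtain s t where st: "0 < s" "s < h" "0 < t" "t < h"
    "f (x + h *\<^sub>R u + h *\<^sub>R v) - f (x + h *\<^sub>R u) - (f (x + h *\<^sub>R v) - f x) = h * (h * ?A u v (x + s *\<^sub>R u + t *\<^sub>R v))"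
    using second_difference_mvt[OF f h inS] by blast
  obtain s' t' where st': "0 < s'" "s' < h" "0 < t'" "t' < h"
    "f (x + h *\<^sub>R v + h *\<^sub>R u) - f (x + h *\<^sub>R v) - (f (x + h *\<^sub>R u) - f x) = h * (h * ?A v u (x + s' *\<^sub>R v + t' *\<^sub>R u))"
    using second_difference_mvt[OF f h inS'] by blast
  have c: "x + h *\<^sub>R v + h *\<^sub>R u = x + h *\<^sub>R u + h *\<^sub>R v" "x + s' *\<^sub>R v + t' *\<^sub>R u = x + t' *\<^sub>R u + s' *\<^sub>R v"
    by (simp_all add: algebra_simps)
  have "h * (h * ?A u v (x + s *\<^sub>R u + t *\<^sub>R v)) = h * (h * ?A v u (x + t' *\<^sub>R u + s' *\<^sub>R v))"
    using st(5) st'(5) unfolding c by linarith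
  then have "?A u v (x + s *\<^sub>R u + t *\<^sub>R v) = ?A v u (x + t' *\<^sub>R u + s' *\<^sub>R v)" using h by simp
  moreover have "dist (?A u v (x + s *\<^sub>R u + t *\<^sub>R v)) (?A u v x) < e"
    using near[of s t] st r by (intro d(2)) auto
  moreover have "dist (?A v u (x + t' *\<^sub>R u + s' *\<^sub>R v)) (?A v u x) < e"
    using near[of t' s'] st' r by (intro d(4)) auto
  ultimately have "\<bar>?A u v x - ?A v u x\<bar> < 2 * e" by (simp add: dist_real_def)
  then show False by (simp add: e_def)
qed

lemma frechet_derivative_linear_compose:
  assumes "bounded_linear L" "f differentiable (at x)"
  shows "frechet_derivative (\<lambda>x. L (f x)) (at x) v = L (frechet_derivative f (at x) v)"
  using frechet_derivative_at[OF bounded_linear.has_derivative[OF assms(1) iffD1[OF frechet_derivative_works assms(2)]]]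
  by metis

lemma frechet_derivative_commute:
  fixes f :: "'a::real_normed_vector \<Rightarrow> complex"
  assumes f: "smooth_on f S" and S: "open S" "x \<in> S"
  shows "frechet_derivative (\<lambda>p. frechet_derivative f (at p) u) (at x) v
       = frechet_derivative (\<lambda>p. frechet_derivative f (at p) v) (at x) u"
proof -
  have L: "L (frechet_derivative (\<lambda>p. frechet_derivative f (at p) u) (at x) v)
     = frechet_derivative (\<lambda>p. frechet_derivative (\<lambda>y. L (f y)) (at p) u) (at x) v"
    if "bounded_linear L" for u v and L :: "complex \<Rightarrow> real"
  proof -
    have "L (frechet_derivative (\<lambda>p. frechet_derivative f (at p) u) (at x) v)
       = frechet_derivative (\<lambda>p. L (frechet_derivative f (at p) u)) (at x) v"
      using frechet_derivative_linear_compose[OF that smooth_on_differentiable[OF smooth_on_frechet_derivative[OF f] S(2)]]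
      by simp
    also have "\<dots> = frechet_derivative (\<lambda>p. frechet_derivative (\<lambda>y. L (f y)) (at p) u) (at x) v"
      by (subst frechet_derivative_cong_open[OF S, of "\<lambda>p. L (frechet_derivative f (at p) u)"
           "\<lambda>p. frechet_derivative (\<lambda>y. L (f y)) (at p) u"])
         (simp_all add: frechet_derivative_linear_compose[OF that smooth_on_differentiable[OF f]])
    finally show ?thesis .
  qed
  show ?thesis
    by (rule complex_eqI; simp only: L[OF bounded_linear_Re] L[OF bounded_linear_Im])
       (intro frechet_derivative_commute_real[OF smooth_on_linear_compose[OF _ S(1) f] S]
         bounded_linear_Re bounded_linear_Im)+
qed

section \<open>Wirtinger calculus\<close>

lemma wirtinger_has_derivative:
  "(f has_derivative f') (at z) \<Longrightarrow> wirtinger i f z = (f' (axis i 1) - \<i> * f' (axis i \<i>)) / 2"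
  "(f has_derivative f') (at z) \<Longrightarrow> wirtinger_bar i f z = (f' (axis i 1) + \<i> * f' (axis i \<i>)) / 2"
  unfolding wirtinger_def wirtinger_bar_def using frechet_derivative_at by metis+

lemma wirtinger_cong_open:
  assumes "open S" "x \<in> S" "\<And>y. y \<in> S \<Longrightarrow> f y = g y"
  shows "wirtinger i f x = wirtinger i g x" "wirtinger_bar i f x = wirtinger_bar i g x"
proof -
  have e: "frechet_derivative f (at x) = frechet_derivative g (at x)"
    by (rule frechet_derivative_cong_open[OF assms])
  show "wirtinger i f x = wirtinger i g x" "wirtinger_bar i f x = wirtinger_bar i g x"
    by (simp_all only: wirtinger_def wirtinger_bar_def e)
qed

lemma smooth_on_wirtinger:
  assumes "open S" "smooth_on f S"
  shows "smooth_on (wirtinger i f) S" "smooth_on (wirtinger_bar i f) S"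
  unfolding wirtinger_def[abs_def] wirtinger_bar_def[abs_def] divide_inverse
  by (intro smooth_on_mult smooth_on_diff smooth_on_add smooth_on_const smooth_on_frechet_derivative assms)+

lemma frechet_derivative_add_eq:
  assumes "f differentiable (at x)" "g differentiable (at x)"
  shows "frechet_derivative (\<lambda>x. f x + g x) (at x) v = frechet_derivative f (at x) v + frechet_derivative g (at x) v"
  using frechet_derivative_at[OF has_derivative_add[OF assms[unfolded frechet_derivative_works]]]
  by metis

lemma frechet_derivative_mult_eq:
  fixes f g :: "_ \<Rightarrow> complex"
  assumes "f differentiable (at x)" "g differentiable (at x)"
  shows "frechet_derivative (\<lambda>x. f x * g x) (at x) v = f x * frechet_derivative g (at x) v + frechet_derivative f (at x) v * g x"
  using frechet_derivative_at[OF has_derivative_mult[OF assms[unfolded frechet_derivative_works]]]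
  by metis

lemma wirtinger_mult:
  assumes "f differentiable (at z)" "g differentiable (at z)"
  shows "wirtinger i (\<lambda>x. f x * g x) z = f z * wirtinger i g z + wirtinger i f z * g z"
    and "wirtinger_bar i (\<lambda>x. f x * g x) z = f z * wirtinger_bar i g z + wirtinger_bar i f z * g z"
  unfolding wirtinger_def wirtinger_bar_def frechet_derivative_mult_eq[OF assms]
  by (simp_all add: field_simps)

lemma wirtinger_add:
  assumes "f differentiable (at z)" "g differentiable (at z)"
  shows "wirtinger i (\<lambda>x. f x + g x) z = wirtinger i f z + wirtinger i g z"
    and "wirtinger_bar i (\<lambda>x. f x + g x) z = wirtinger_bar i f z + wirtinger_bar i g z"
  unfolding wirtinger_def wirtinger_bar_def frechet_derivative_add_eq[OF assms]
  by (simp_all add: field_simps)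

lemma wirtinger_const: "wirtinger i (\<lambda>_. c) z = 0" "wirtinger_bar i (\<lambda>_. c) z = 0"
  by (simp_all add: wirtinger_def wirtinger_bar_def)

lemma wirtinger_cmult:
  assumes "f differentiable (at z)"
  shows "wirtinger i (\<lambda>x. c * f x) z = c * wirtinger i f z"
    and "wirtinger_bar i (\<lambda>x. c * f x) z = c * wirtinger_bar i f z"
  using wirtinger_mult[of "\<lambda>_. c" z f i] assms by (simp_all add: wirtinger_const)

lemma smooth_on_of_real:
  "open S \<Longrightarrow> smooth_on f S \<Longrightarrow> smooth_on (\<lambda>x. complex_of_real (f x)) S"
  by (rule smooth_on_linear_compose[OF bounded_linear_of_real])

lemma frechet_derivative_of_real:
  "f differentiable (at x) \<Longrightarrow>
    frechet_derivative (\<lambda>x. complex_of_real (f x)) (at x) v = complex_of_real (frechet_derivative f (at x) v)"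
  by (rule frechet_derivative_linear_compose[OF bounded_linear_of_real])

lemma wirtinger_bar_real:
  "f differentiable (at z) \<Longrightarrow>
    wirtinger_bar i (\<lambda>x. complex_of_real (f x)) z = cnj (wirtinger i (\<lambda>x. complex_of_real (f x)) z)"
  by (simp add: wirtinger_def wirtinger_bar_def frechet_derivative_of_real)

lemma wirtinger_compose_real:
  assumes f: "f differentiable (at z)" and F: "(F has_real_derivative F') (at (f z))"
  shows "wirtinger i (\<lambda>x. complex_of_real (F (f x))) z = complex_of_real F' * wirtinger i (\<lambda>x. complex_of_real (f x)) z"
    and "wirtinger_bar i (\<lambda>x. complex_of_real (F (f x))) z = complex_of_real F' * wirtinger_bar i (\<lambda>x. complex_of_real (f x)) z"
proof -
  have d: "((\<lambda>x. F (f x)) has_derivative (\<lambda>v. frechet_derivative f (at z) v * F')) (at z)"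
    using has_derivative_compose[OF f[unfolded frechet_derivative_works] F[unfolded has_field_derivative_def]]
    by (simp add: mult.commute)
  then have e: "frechet_derivative (\<lambda>x. F (f x)) (at z) = (\<lambda>v. frechet_derivative f (at z) v * F')"
    and dd: "(\<lambda>x. F (f x)) differentiable (at z)"
    using frechet_derivative_at[OF d] by (simp_all add: differentiable_def) (metis d)
  show "wirtinger i (\<lambda>x. complex_of_real (F (f x))) z = complex_of_real F' * wirtinger i (\<lambda>x. complex_of_real (f x)) z"
    and "wirtinger_bar i (\<lambda>x. complex_of_real (F (f x))) z = complex_of_real F' * wirtinger_bar i (\<lambda>x. complex_of_real (f x)) z"
    unfolding wirtinger_def wirtinger_bar_def frechet_derivative_of_real[OF dd] frechet_derivative_of_real[OF f] e
    by (simp_all add: algebra_simps)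
qed

lemma complex_hessian_cong_open:
  assumes "open S" "x \<in> S" "\<And>y. y \<in> S \<Longrightarrow> f y = g y"
  shows "complex_hessian f x = complex_hessian g x"
proof -
  have "wirtinger i (wirtinger_bar j (\<lambda>x. complex_of_real (f x))) x = wirtinger i (wirtinger_bar j (\<lambda>x. complex_of_real (g x))) x" for i j
    by (rule wirtinger_cong_open(1)[OF assms(1,2)], rule wirtinger_cong_open(2)[OF assms(1)])
       (auto simp: assms(3))
  then show ?thesis by (simp add: complex_hessian_def)
qed

text \<open>Used for the exponential of the logarithmic potential and for the negative logarithm of
  the defining function. The rule for \<open>F\<close> is required on all of \<open>S\<close>
  because the first derivative is differentiated once more.\<close>

lemma complex_hessian_compose:
  assumes S: "open S" "z \<in> S" and f: "smooth_on f S"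
    and F: "\<And>x. x \<in> S \<Longrightarrow> (F has_real_derivative F' (f x)) (at (f x))"
    and F': "(F' has_real_derivative F'') (at (f z))"
  shows "complex_hessian (\<lambda>x. F (f x)) z $ i $ j = complex_of_real (F' (f z)) * complex_hessian f z $ i $ j
    + complex_of_real F'' * wirtinger i (\<lambda>x. complex_of_real (f x)) z * cnj (wirtinger j (\<lambda>x. complex_of_real (f x)) z)"
proof -
  note fd = smooth_on_differentiable[OF f]
  have F'd: "(\<lambda>x. complex_of_real (F' (f x))) differentiable (at z)"
  proof -
    have "((\<lambda>x. F' (f x)) has_derivative (\<lambda>v. F'' * frechet_derivative f (at z) v)) (at z)"
      using has_derivative_compose[OF fd[OF S(2), unfolded frechet_derivative_works] F'[unfolded has_field_derivative_def]] .
    from has_derivative_of_real[OF this] show ?thesis unfolding differentiable_def by blast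
  qed
  have "wirtinger i (wirtinger_bar j (\<lambda>x. complex_of_real (F (f x)))) z
      = wirtinger i (\<lambda>x. complex_of_real (F' (f x)) * wirtinger_bar j (\<lambda>x. complex_of_real (f x)) x) z"
    by (rule wirtinger_cong_open(1)[OF S]) (simp add: wirtinger_compose_real[OF fd F])
  also have "\<dots> = complex_of_real (F' (f z)) * wirtinger i (wirtinger_bar j (\<lambda>x. complex_of_real (f x))) z
      + complex_of_real F'' * wirtinger i (\<lambda>x. complex_of_real (f x)) z * wirtinger_bar j (\<lambda>x. complex_of_real (f x)) z"
    by (subst wirtinger_mult(1)[OF F'd smooth_on_differentiable[OF smooth_on_wirtinger(2)[OF S(1) smooth_on_of_real[OF S(1) f]] S(2)]])
       (simp add: wirtinger_compose_real[OF fd[OF S(2)] F'])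
  finally show ?thesis
    by (simp add: complex_hessian_def wirtinger_bar_real[OF fd[OF S(2)]])
qed

lemma complex_hessian_add:
  assumes S: "open S" "z \<in> S" and f: "smooth_on f S" and g: "smooth_on g S"
  shows "complex_hessian (\<lambda>x. f x + g x) z = complex_hessian f z + complex_hessian g z"
proof -
  note fs = smooth_on_of_real[OF S(1) f] and gs = smooth_on_of_real[OF S(1) g]
  have "wirtinger i (wirtinger_bar j (\<lambda>x. complex_of_real (f x + g x))) z
    = wirtinger i (\<lambda>x. wirtinger_bar j (\<lambda>x. complex_of_real (f x)) x + wirtinger_bar j (\<lambda>x. complex_of_real (g x)) x) z" for i j
    by (rule wirtinger_cong_open(1)[OF S])
       (simp add: wirtinger_add smooth_on_differentiable[OF fs] smooth_on_differentiable[OF gs])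
  also have "\<dots> i j = wirtinger i (wirtinger_bar j (\<lambda>x. complex_of_real (f x))) z
     + wirtinger i (wirtinger_bar j (\<lambda>x. complex_of_real (g x))) z" for i j
    by (intro wirtinger_add(1) smooth_on_differentiable[OF smooth_on_wirtinger(2) S(2)] S fs gs)
  finally show ?thesis by (simp add: complex_hessian_def vec_eq_iff)
qed

lemma complex_hessian_cmult:
  assumes S: "open S" "z \<in> S" and f: "smooth_on f S"
  shows "complex_hessian (\<lambda>x. c * f x) z = c *\<^sub>R complex_hessian f z"
proof -
  have "complex_hessian (\<lambda>x. c * f x) z $ i $ j = complex_of_real c * complex_hessian f z $ i $ j" for i j
    using complex_hessian_compose[OF S f, of "\<lambda>t. c * t" "\<lambda>_. c" 0 i j]
    by (auto intro!: derivative_eq_intros)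
  then show ?thesis by (simp add: vec_eq_iff) (simp add: scaleR_conv_of_real)
qed

lemma wirtinger_frechet_derivative:
  assumes S: "open S" "z \<in> S" and f: "smooth_on f S"
  shows "frechet_derivative (wirtinger i f) (at z) v
    = (frechet_derivative (\<lambda>p. frechet_derivative f (at p) (axis i 1)) (at z) v
       - \<i> * frechet_derivative (\<lambda>p. frechet_derivative f (at p) (axis i \<i>)) (at z) v) / 2"
    and "frechet_derivative (wirtinger_bar i f) (at z) v
    = (frechet_derivative (\<lambda>p. frechet_derivative f (at p) (axis i 1)) (at z) v
       + \<i> * frechet_derivative (\<lambda>p. frechet_derivative f (at p) (axis i \<i>)) (at z) v) / 2"
proof -
  have d: "((\<lambda>p. frechet_derivative f (at p) u) has_derivative
      frechet_derivative (\<lambda>p. frechet_derivative f (at p) u) (at z)) (at z)" for u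
    by (rule smooth_on_has_derivative[OF smooth_on_frechet_derivative[OF f] S(2)])
  let ?D = "\<lambda>u. frechet_derivative (\<lambda>p. frechet_derivative f (at p) u) (at z)"
  have "(wirtinger i f has_derivative (\<lambda>v. (?D (axis i 1) v - \<i> * ?D (axis i \<i>) v) * inverse 2)) (at z)"
    unfolding wirtinger_def[abs_def] divide_inverse
    by (rule has_derivative_mult_left[OF has_derivative_diff[OF d has_derivative_mult_right[OF d]]])
  from fun_cong[OF frechet_derivative_at[OF this]] show
    "frechet_derivative (wirtinger i f) (at z) v = (?D (axis i 1) v - \<i> * ?D (axis i \<i>) v) / 2"
    unfolding divide_inverse by (rule sym)
  have "(wirtinger_bar i f has_derivative (\<lambda>v. (?D (axis i 1) v + \<i> * ?D (axis i \<i>) v) * inverse 2)) (at z)"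
    unfolding wirtinger_bar_def[abs_def] divide_inverse
    by (rule has_derivative_mult_left[OF has_derivative_add[OF d has_derivative_mult_right[OF d]]])
  from fun_cong[OF frechet_derivative_at[OF this]] show
    "frechet_derivative (wirtinger_bar i f) (at z) v = (?D (axis i 1) v + \<i> * ?D (axis i \<i>) v) / 2"
    unfolding divide_inverse by (rule sym)
qed

text \<open>Applied to an antiholomorphic derivative of a potential, this is the closedness of its
  Kaehler form.\<close>

lemma wirtinger_commute:
  assumes S: "open S" "z \<in> S" and f: "smooth_on f S"
  shows "wirtinger k (wirtinger i f) z = wirtinger i (wirtinger k f) z"
  unfolding wirtinger_def[of _ "wirtinger _ f"] wirtinger_frechet_derivative[OF assms]
  using frechet_derivative_commute[OF f S, of "axis i 1" "axis k 1"] frechet_derivative_commute[OF f S, of "axis i 1" "axis k \<i>"]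
    frechet_derivative_commute[OF f S, of "axis i \<i>" "axis k 1"] frechet_derivative_commute[OF f S, of "axis i \<i>" "axis k \<i>"]
  by (simp add: field_simps)

section \<open>Comparison of solutions of the Monge-Ampere equation\<close>

lemma complex_vec_expand:
  "v = (\<Sum>i\<in>UNIV. Re (v $ i) *\<^sub>R axis i 1 + Im (v $ i) *\<^sub>R axis i \<i>)" for v :: "complex^'n"
  by (simp add: vec_eq_iff axis_def sum.distrib if_distrib[of "\<lambda>x. _ *\<^sub>R x"] cong: if_cong)
     (simp add: complex_eq_iff)

lemma frechet_derivative_second_linear:
  fixes f :: "'a::real_normed_vector \<Rightarrow> real"
  assumes S: "open S" "z \<in> S" and f: "smooth_on f S"
  shows "linear (\<lambda>y. frechet_derivative (\<lambda>p. frechet_derivative f (at p) y) (at z) x)"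
proof -
  note d = smooth_on_differentiable[OF f]
  note d2 = smooth_on_differentiable[OF smooth_on_frechet_derivative[OF f] S(2)]
  note lin = linear_frechet_derivative[OF d]
  have "frechet_derivative (\<lambda>p. frechet_derivative f (at p) (y + y')) (at z)
      = frechet_derivative (\<lambda>p. frechet_derivative f (at p) y + frechet_derivative f (at p) y') (at z)" for y y'
    by (rule frechet_derivative_cong_open[OF S]) (rule linear_add[OF lin])
  moreover have "frechet_derivative (\<lambda>p. frechet_derivative f (at p) (c *\<^sub>R y)) (at z)
      = frechet_derivative (\<lambda>p. c * frechet_derivative f (at p) y) (at z)" for c y
    by (rule frechet_derivative_cong_open[OF S]) (simp add: linear.scaleR[OF lin])
  ultimately show ?thesis
    by (simp add: linear_iff frechet_derivative_add_eq[OF d2 d2]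
        frechet_derivative_linear_compose[OF bounded_linear_mult_right d2])
qed

text \<open>Up to a factor the complex Hessian averages the real one over a vector and its rotation
  by the imaginary unit. It is thus semidefinite wherever the real Hessian is, in particular at a
  minimum.\<close>

lemma Re_hform_complex_hessian:
  fixes f :: "complex^'n \<Rightarrow> real"
  assumes S: "open S" "z \<in> S" and f: "smooth_on f S"
  defines "B \<equiv> \<lambda>x y. frechet_derivative (\<lambda>p. frechet_derivative f (at p) y) (at z) x"
  shows "Re (hform (complex_hessian f z) v) = (B v v + B (\<chi> i. \<i> * v $ i) (\<chi> i. \<i> * v $ i)) / 4"
proof -
  note fs = smooth_on_of_real[OF S(1) f]
  note d = smooth_on_differentiable[OF f]
  note d2 = smooth_on_differentiable[OF smooth_on_frechet_derivative[OF f] S(2)]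
  have Bc: "frechet_derivative (\<lambda>p. frechet_derivative (\<lambda>x. complex_of_real (f x)) (at p) y) (at z) x
      = complex_of_real (B x y)" for x y
  proof -
    have "frechet_derivative (\<lambda>p. frechet_derivative (\<lambda>x. complex_of_real (f x)) (at p) y) (at z)
        = frechet_derivative (\<lambda>p. complex_of_real (frechet_derivative f (at p) y)) (at z)"
      by (rule frechet_derivative_cong_open[OF S]) (rule frechet_derivative_of_real[OF d])
    then show ?thesis by (simp add: B_def frechet_derivative_of_real[OF d2])
  qed
  define P where "P i j = B (axis i 1) (axis j 1) + B (axis i \<i>) (axis j \<i>)" for i j
  define Q where "Q i j = B (axis i 1) (axis j \<i>) - B (axis i \<i>) (axis j 1)" for i j
  have H: "complex_hessian f z $ i $ j = (complex_of_real (P i j) + \<i> * complex_of_real (Q i j)) / 4" for i j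
    unfolding complex_hessian_def wirtinger_def[of _ "wirtinger_bar _ _"]
    by (simp add: wirtinger_frechet_derivative[OF S fs] Bc P_def Q_def field_simps)
  have "Re (hform (complex_hessian f z) v)
    = (\<Sum>i\<in>UNIV. \<Sum>j\<in>UNIV. (P i j * (Re (v $ i) * Re (v $ j) + Im (v $ i) * Im (v $ j))
         + Q i j * (Re (v $ i) * Im (v $ j) - Im (v $ i) * Re (v $ j))) / 4)"
    unfolding hform_def Re_sum H
    by (intro sum.cong refl) (simp add: field_simps)
  also have "\<dots> = (B v v + B (\<chi> i. \<i> * v $ i) (\<chi> i. \<i> * v $ i)) / 4"
  proof -
    have l2: "linear (B x)" for x
      unfolding B_def by (rule frechet_derivative_second_linear[OF S f])
    have l1: "linear (\<lambda>x. B x y)" for y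
      unfolding B_def by (rule linear_frechet_derivative[OF d2])
    have BB: "B v v = (\<Sum>i\<in>UNIV. \<Sum>j\<in>UNIV. Re (v $ i) * Re (v $ j) * B (axis i 1) (axis j 1)
        + Re (v $ i) * Im (v $ j) * B (axis i 1) (axis j \<i>)
        + Im (v $ i) * Re (v $ j) * B (axis i \<i>) (axis j 1)
        + Im (v $ i) * Im (v $ j) * B (axis i \<i>) (axis j \<i>))" for v
    proof -
      have "B v v = B (\<Sum>i\<in>UNIV. Re (v $ i) *\<^sub>R axis i 1 + Im (v $ i) *\<^sub>R axis i \<i>)
         (\<Sum>i\<in>UNIV. Re (v $ i) *\<^sub>R axis i 1 + Im (v $ i) *\<^sub>R axis i \<i>)"
        using complex_vec_expand[of v] by simp
      also have "\<dots> = (\<Sum>i\<in>UNIV. \<Sum>j\<in>UNIV. B (Re (v $ i) *\<^sub>R axis i 1 + Im (v $ i) *\<^sub>R axis i \<i>)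
           (Re (v $ j) *\<^sub>R axis j 1 + Im (v $ j) *\<^sub>R axis j \<i>))"
        by (simp only: linear_sum[OF l1] linear_sum[OF l2]) (rule sum.swap)
      finally show ?thesis
        by (simp add: linear_add[OF l1] linear_add[OF l2] linear.scaleR[OF l1] linear.scaleR[OF l2] algebra_simps)
    qed
    show ?thesis unfolding BB P_def Q_def sum.distrib[symmetric] sum_divide_distrib
      by (intro sum.cong refl) (simp add: algebra_simps add_divide_distrib[symmetric] diff_divide_distrib[symmetric])
  qed
  finally show ?thesis .
qed

text \<open>Were the second derivative negative, the first derivative along \<open>v\<close>, zero
  at the minimum, would be negative just beyond it and the function would decrease.\<close>

lemma second_derivative_at_min:
  fixes f :: "'a::real_normed_vector \<Rightarrow> real"
  assumes S: "open S" "z \<in> S" and f: "smooth_on f S" and min: "\<And>y. y \<in> S \<Longrightarrow> f z \<le> f y"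
  shows "0 \<le> frechet_derivative (\<lambda>p. frechet_derivative f (at p) v) (at z) v"
proof (rule ccontr)
  assume neg: "\<not> ?thesis"
  let ?D = "\<lambda>s. frechet_derivative f (at (z + s *\<^sub>R v)) v"
  have "((\<lambda>s. z + s *\<^sub>R v) \<longlongrightarrow> z + 0 *\<^sub>R v) (at 0)" by (intro tendsto_intros)
  then have "\<forall>\<^sub>F s in at (0::real). z + s *\<^sub>R v \<in> S"
    using S by (intro topological_tendstoD) auto
  then obtain d where d: "d > 0" "\<And>s. \<bar>s\<bar> < d \<Longrightarrow> z + s *\<^sub>R v \<in> S"
    unfolding eventually_at by (metis S(2) add.right_neutral dist_real_def diff_zero scaleR_zero_left UNIV_I)
  have D1: "((\<lambda>s. f (z + s *\<^sub>R v)) has_real_derivative ?D s) (at s)" if "\<bar>s\<bar> < d" for s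
    unfolding has_real_derivative_iff_has_vector_derivative
    by (rule line_has_vector_derivative[OF smooth_on_differentiable[OF f d(2)[OF that]]])
  have "(?D has_real_derivative frechet_derivative (\<lambda>p. frechet_derivative f (at p) v) (at (z + 0 *\<^sub>R v)) v) (at 0)"
    unfolding has_real_derivative_iff_has_vector_derivative
    by (rule line_has_vector_derivative) (use smooth_on_differentiable[OF smooth_on_frechet_derivative[OF f] S(2)] in simp)
  from DERIV_neg_dec_right[OF this] neg
  obtain e where e: "e > 0" "\<And>h. h > 0 \<Longrightarrow> h < e \<Longrightarrow> ?D (0 + h) < ?D 0"
    by auto
  have "?D 0 = 0"
    by (rule DERIV_local_min[OF D1[of 0] d(1)]) (use d min in auto)
  define h where "h = min d e / 2"
  have h: "0 < h" "h < d" "h < e" using d e by (auto simp: h_def)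
  obtain s where s: "0 < s" "s < h" "f (z + h *\<^sub>R v) - f (z + 0 *\<^sub>R v) = (h - 0) * ?D s"
    using MVT2[OF h(1), of "\<lambda>s. f (z + s *\<^sub>R v)" ?D] D1 h by auto
  have "?D s < 0" using e(2)[of s] s h \<open>?D 0 = 0\<close> by simp
  then have "h * ?D s < 0" using h by (simp add: mult_pos_neg)
  then have "f (z + h *\<^sub>R v) < f z" using s by simp
  moreover have "f z \<le> f (z + h *\<^sub>R v)" using d h by (intro min) auto
  ultimately show False by simp
qed

section \<open>Dilations\<close>

lemma dilation_has_derivative:
  fixes f :: "'a::real_normed_vector \<Rightarrow> 'b::real_normed_vector"
  assumes "f differentiable (at (t *\<^sub>R x))"
  shows "((\<lambda>x. f (t *\<^sub>R x)) has_derivative (\<lambda>v. t *\<^sub>R frechet_derivative f (at (t *\<^sub>R x)) v)) (at x)"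
proof -
  have "((\<lambda>x. t *\<^sub>R x) has_derivative (\<lambda>v. t *\<^sub>R v)) (at x)"
    by (auto intro!: derivative_eq_intros)
  from has_derivative_compose[OF this assms[unfolded frechet_derivative_works]]
  show ?thesis by (simp add: linear.scaleR[OF linear_frechet_derivative[OF assms]])
qed

lemma open_dilation: "open S \<Longrightarrow> open {x :: 'a::real_normed_vector. t *\<^sub>R x \<in> S}"
  using open_vimage[of S "\<lambda>x. t *\<^sub>R x", OF _ continuous_on_scaleR[OF continuous_on_const continuous_on_id]]
  by (simp add: vimage_def)

lemma Ck_on_dilation:
  assumes S: "open S"
  shows "Ck_on k f S \<Longrightarrow> Ck_on k (\<lambda>x. f (t *\<^sub>R x)) {x. t *\<^sub>R x \<in> S}"
proof (induction k arbitrary: f)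
  case 0
  then show ?case
    by (auto intro!: continuous_on_compose2[of S f _ "\<lambda>x. t *\<^sub>R x"] continuous_intros)
next
  case (Suc k)
  show ?case
  proof (rule Ck_on_SucI[OF open_dilation[OF S], where f'="\<lambda>x v. t *\<^sub>R frechet_derivative f (at (t *\<^sub>R x)) v"])
    show "((\<lambda>x. f (t *\<^sub>R x)) has_derivative (\<lambda>v. t *\<^sub>R frechet_derivative f (at (t *\<^sub>R x)) v)) (at x)"
      if "x \<in> {x. t *\<^sub>R x \<in> S}" for x
      by (rule dilation_has_derivative) (use Suc.prems that in auto)
    show "Ck_on k (\<lambda>x. t *\<^sub>R frechet_derivative f (at (t *\<^sub>R x)) v) {x. t *\<^sub>R x \<in> S}" for v
      by (rule Ck_on_bounded_linear[OF bounded_linear_scaleR_right open_dilation[OF S]], rule Suc.IH)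
         (use Suc.prems in auto)
  qed
qed

lemma smooth_on_dilation:
  "open S \<Longrightarrow> smooth_on f S \<Longrightarrow> smooth_on (\<lambda>x. f (t *\<^sub>R x)) {x. t *\<^sub>R x \<in> S}"
  by (simp add: smooth_on_def Ck_on_dilation)

lemma wirtinger_dilation:
  assumes "f differentiable (at (t *\<^sub>R x))"
  shows "wirtinger i (\<lambda>x. f (t *\<^sub>R x)) x = complex_of_real t * wirtinger i f (t *\<^sub>R x)"
    and "wirtinger_bar i (\<lambda>x. f (t *\<^sub>R x)) x = complex_of_real t * wirtinger_bar i f (t *\<^sub>R x)"
  unfolding wirtinger_has_derivative[OF dilation_has_derivative[OF assms]]
  by (simp_all add: wirtinger_def wirtinger_bar_def scaleR_conv_of_real algebra_simps)

lemma complex_hessian_dilation: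
  assumes S: "open S" "t *\<^sub>R x \<in> S" and f: "smooth_on f S"
  shows "complex_hessian (\<lambda>x. f (t *\<^sub>R x)) x = t\<^sup>2 *\<^sub>R complex_hessian f (t *\<^sub>R x)"
proof -
  note fs = smooth_on_of_real[OF S(1) f]
  note ws = smooth_on_wirtinger(2)[OF S(1) fs]
  have x: "x \<in> {x. t *\<^sub>R x \<in> S}" using S by simp
  have "complex_hessian (\<lambda>x. f (t *\<^sub>R x)) x $ i $ j
      = wirtinger i (\<lambda>x. complex_of_real t * wirtinger_bar j (\<lambda>x. complex_of_real (f x)) (t *\<^sub>R x)) x" for i j
    unfolding complex_hessian_def vec_lambda_beta
    by (rule wirtinger_cong_open(1)[OF open_dilation[OF S(1)] x], rule wirtinger_dilation(2))
       (use smooth_on_differentiable[OF fs] in simp)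
  also have "\<dots> i j = complex_of_real t * (complex_of_real t * complex_hessian f (t *\<^sub>R x) $ i $ j)" for i j
    unfolding complex_hessian_def vec_lambda_beta
    using dilation_has_derivative[OF smooth_on_differentiable[OF ws S(2)]] smooth_on_differentiable[OF ws S(2)]
    by (subst wirtinger_cmult(1), blast intro: differentiableI, subst wirtinger_dilation(1)) auto
  finally show ?thesis
    by (simp add: vec_eq_iff power2_eq_square) (simp add: scaleR_conv_of_real mult.assoc)
qed

lemma det_scaleR: "det (c *\<^sub>R A :: complex^'n^'n) = complex_of_real (c ^ CARD('n)) * det A"
  using det_rows_mul[of "\<lambda>_. complex_of_real c" "\<lambda>i. A $ i"]
  by (simp add: vec_eq_iff scaleR_vec_def vector_scalar_mult_def scaleR_conv_of_real)

text \<open>The dilation \<open>h (t x)\<close> is finite on the closure of the domain and solves the equation up to the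
  factor \<open>t\<close> to the power of the real dimension, so that \<open>g - h (t x)\<close> attains its minimum inside.\<close>

lemma monge_ampere_comparison:
  fixes D :: "(complex^'n::finite) set"
  assumes D: "open D" "bounded D"
    and star: "\<And>t x. 0 < t \<Longrightarrow> t < 1 \<Longrightarrow> x \<in> closure D \<Longrightarrow> t *\<^sub>R x \<in> D"
    and g: "monge_ampere_solution D g" and h: "monge_ampere_solution D h" and x: "x \<in> D"
  shows "h x \<le> g x"
proof -
  let ?n = "real CARD('n)"
  have gs: "smooth_on g D" and hs: "smooth_on h D"
    using g h by (simp_all add: monge_ampere_solution_def)
  have pd: "hermitian_pos_def (complex_hessian g z)" "hermitian_pos_def (complex_hessian h z)" if "z \<in> D" for z
    using g h that by (auto simp: monge_ampere_solution_def complete_kaehler_metric_on_def kaehler_metric_on_def)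
  have detg: "det (complex_hessian g z) = complex_of_real (exp ((?n + 1) * g z))"
    and deth: "det (complex_hessian h z) = complex_of_real (exp ((?n + 1) * h z))" if "z \<in> D" for z
    using g h that by (simp_all add: monge_ampere_solution_def)
  have cg: "continuous_on D g" and ch: "continuous_on D h"
    using smooth_on_continuous_on gs hs by blast+
  \<comment> \<open>The error term: scaling the Hessian by t^2 multiplies its determinant by t to
    the power \<open>2 * ?n\<close>, and after taking logarithms the equation is divided by
    \<open>?n + 1\<close>.\<close>
  have key: "h (t *\<^sub>R x) + 2 * ?n / (?n + 1) * ln t \<le> g x" if t: "0 < t" "t < 1" for t
  proof -
    define D' where "D' = {x. t *\<^sub>R x \<in> D}"
    have D': "open D'" unfolding D'_def by (rule open_dilation[OF D(1)])
    have sub: "closure D \<subseteq> D'" using star t by (auto simp: D'_def)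
    have sub': "D \<subseteq> D'" using sub closure_subset by blast
    have hts: "smooth_on (\<lambda>x. h (t *\<^sub>R x)) D'"
      unfolding D'_def by (rule smooth_on_dilation[OF D(1) hs])
    have htc: "continuous_on D' (\<lambda>x. h (t *\<^sub>R x))" by (rule smooth_on_continuous_on[OF hts])
    have hts': "smooth_on (\<lambda>x. h (t *\<^sub>R x)) D"
      by (rule smooth_on_subset[OF hts sub'])
    define m where "m y = g y - h (t *\<^sub>R y)" for y
    have ms: "smooth_on m D" unfolding m_def by (rule smooth_on_diff[OF D(1) gs hts'])
    \<comment> \<open>On the frontier \<open>g\<close> is infinite while the dilated function stays
      finite, so this sublevel set is closed in the whole space and not only in
      \<open>D\<close>.\<close>
    define C where "C = {y \<in> D. m y \<le> m x}"
    have "closed C"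
      unfolding closed_sequential_limits
    proof (intro allI impI, elim conjE)
      fix ys l assume ys: "\<forall>n. ys n \<in> C" "ys \<longlonglongrightarrow> l"
      have ysD: "ys n \<in> D" "m (ys n) \<le> m x" for n using ys by (auto simp: C_def)
      have l: "l \<in> closure D" using ysD ys(2) closure_sequential by blast
      have hl: "(\<lambda>n. h (t *\<^sub>R ys n)) \<longlonglongrightarrow> h (t *\<^sub>R l)"
        by (rule continuous_on_tendsto_compose[OF htc ys(2)]) (use l sub sub' ysD in \<open>auto intro!: always_eventually\<close>)
      show "l \<in> C"
      proof (cases "l \<in> D")
        case True
        have "(\<lambda>n. m (ys n)) \<longlonglongrightarrow> m l"
          by (rule continuous_on_tendsto_compose[OF smooth_on_continuous_on[OF ms] ys(2) True]) (use ysD in auto)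
        then have "m l \<le> m x" by (rule LIMSEQ_le_const2) (use ysD in blast)
        then show ?thesis using True by (simp add: C_def)
      next
        case False
        then have "l \<in> frontier D" using l D(1) by (simp add: frontier_def interior_open)
        then have "filterlim g at_top (at l within D)"
          using g by (simp add: monge_ampere_solution_def)
        moreover have "filterlim ys (at l within D) sequentially"
          unfolding filterlim_at using ys(2) ysD False by (auto intro!: always_eventually)
        ultimately have "filterlim (\<lambda>n. g (ys n)) at_top sequentially"
          by (rule filterlim_compose)
        then have ev1: "\<forall>\<^sub>F n in sequentially. m x + h (t *\<^sub>R l) + 1 < g (ys n)"
          by (simp add: filterlim_at_top_dense)
        have ev2: "\<forall>\<^sub>F n in sequentially. h (t *\<^sub>R ys n) < h (t *\<^sub>R l) + 1"
          by (rule order_tendstoD[OF hl]) simp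
        have "\<forall>\<^sub>F n in sequentially. False"
          using ev1 ev2
        proof eventually_elim
          case (elim n)
          then show False using ysD(2)[of n] by (simp add: m_def)
        qed
        then show ?thesis by simp
      qed
    qed
    moreover have "bounded C" by (rule bounded_subset[OF D(2)]) (auto simp: C_def)
    ultimately have "compact C" by (simp add: compact_eq_bounded_closed)
    moreover have "x \<in> C" using x by (simp add: C_def)
    moreover have "continuous_on C m"
      by (rule continuous_on_subset[OF smooth_on_continuous_on[OF ms]]) (auto simp: C_def)
    ultimately obtain z where z: "z \<in> C" "\<And>y. y \<in> C \<Longrightarrow> m z \<le> m y"
      using continuous_attains_inf[of C m] by blast
    have zD: "z \<in> D" using z by (simp add: C_def)
    have min: "m z \<le> m y" if "y \<in> D" for y
      using z that by (cases "y \<in> C") (fastforce simp: C_def)+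
    have tz: "t *\<^sub>R z \<in> D" using sub' zD by (auto simp: D'_def)
    have eq: "complex_hessian g z = complex_hessian m z + t\<^sup>2 *\<^sub>R complex_hessian h (t *\<^sub>R z)"
      using complex_hessian_add[OF D(1) zD ms hts'] complex_hessian_dilation[OF D(1) tz hs]
      by (simp add: m_def)
    \<comment> \<open>At the minimum the Hessian of \<open>m\<close> is semidefinite, so the Hessian
      of \<open>g\<close> dominates that of the dilated function and the determinants can be
      compared.\<close>
    have "psd (complex_hessian g z - t\<^sup>2 *\<^sub>R complex_hessian h (t *\<^sub>R z))"
      unfolding psd_def
    proof (intro conjI allI)
      show "herm (complex_hessian g z - t\<^sup>2 *\<^sub>R complex_hessian h (t *\<^sub>R z))"
        using pd(1)[OF zD] pd(2)[OF tz] by (intro herm_diff herm_scaleR) (simp_all add: hermitian_pos_def_iff)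
      show "0 \<le> Re (hform (complex_hessian g z - t\<^sup>2 *\<^sub>R complex_hessian h (t *\<^sub>R z)) v)" for v
        unfolding eq using second_derivative_at_min[OF D(1) zD ms min]
        by (simp add: Re_hform_complex_hessian[OF D(1) zD ms])
    qed
    then have "Re (det (t\<^sup>2 *\<^sub>R complex_hessian h (t *\<^sub>R z))) \<le> Re (det (complex_hessian g z))"
      using pd(2)[OF tz] t by (intro Re_det_mono hermitian_pos_def_scaleR) auto
    then have "(t\<^sup>2) ^ CARD('n) * exp ((?n + 1) * h (t *\<^sub>R z)) \<le> exp ((?n + 1) * g z)"
      unfolding det_scaleR detg[OF zD] deth[OF tz] of_real_mult[symmetric] Re_complex_of_real .
    moreover have "(t\<^sup>2) ^ CARD('n) = exp (2 * ?n * ln t)"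
    proof -
      have "exp (2 * ?n * ln t) = exp (real (2 * CARD('n)) * ln t)" by simp
      also have "\<dots> = t ^ (2 * CARD('n))" unfolding exp_of_nat_mult using t by simp
      finally show ?thesis by (simp add: power_mult)
    qed
    ultimately have "2 * ?n * ln t + (?n + 1) * h (t *\<^sub>R z) \<le> (?n + 1) * g z"
      by (simp flip: exp_add)
    then have "2 * ?n / (?n + 1) * ln t \<le> m z"
      by (simp add: m_def field_simps)
    also have "\<dots> \<le> m x" by (rule min[OF x])
    finally show ?thesis by (simp add: m_def)
  qed
  \<comment> \<open>The error vanishes as \<open>t\<close> tends to 1, and the dilated value tends
    to \<open>h x\<close> by continuity.\<close>
  have "((\<lambda>t. h (t *\<^sub>R x) + 2 * ?n / (?n + 1) * ln t) \<longlongrightarrow> h (1 *\<^sub>R x) + 2 * ?n / (?n + 1) * ln 1) (at_left 1)"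
  proof (intro tendsto_add tendsto_mult tendsto_const tendsto_ln)
    have "continuous (at x) h" using ch x D(1) by (simp add: continuous_on_eq_continuous_at)
    moreover have "((\<lambda>t. t *\<^sub>R x) \<longlongrightarrow> 1 *\<^sub>R x) (at_left 1)" by (intro tendsto_intros)
    ultimately show "((\<lambda>t. h (t *\<^sub>R x)) \<longlongrightarrow> h (1 *\<^sub>R x)) (at_left 1)"
      by (intro isCont_tendsto_compose[where g = h]) simp_all
  qed (auto intro: tendsto_intros)
  moreover have "\<forall>\<^sub>F t in at_left 1. h (t *\<^sub>R x) + 2 * ?n / (?n + 1) * ln t \<le> g x"
    unfolding eventually_at_left_field by (rule exI[of _ 0]) (use key in auto)
  ultimately have "h (1 *\<^sub>R x) + 2 * ?n / (?n + 1) * ln 1 \<le> g x"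
    by (rule tendsto_upperbound) simp
  then show ?thesis by simp
qed

section \<open>Lengths of paths and completeness\<close>

lemma hform_scaleR_vector: "hform A (c *\<^sub>R v) = c\<^sup>2 *\<^sub>R hform A v"
  by (simp add: hform_def scaleR_right.sum power2_eq_square)

lemma norm_hform_le: "norm (hform A v) \<le> (\<Sum>i\<in>UNIV. \<Sum>j\<in>UNIV. norm (A $ i $ j)) * (norm v)\<^sup>2"
proof -
  have "norm (A $ i $ j * v $ i * cnj (v $ j)) \<le> norm (A $ i $ j) * (norm v)\<^sup>2" for i j
    using mult_mono[OF Finite_Cartesian_Product.norm_nth_le[where x = v and i = i] Finite_Cartesian_Product.norm_nth_le[where x = v and i = j]]
    by (simp add: norm_mult mult.assoc power2_eq_square mult_left_mono)
  then show ?thesis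
    unfolding hform_def sum_distrib_right by (intro sum_norm_le) 
qed

lemma speed_hform: "speed H \<gamma> t = sqrt (Re (hform (H (\<gamma> t)) (vector_derivative \<gamma> (at t))))"
  by (simp add: speed_def hform_def Let_def)

lemma speed_scaleR:
  assumes "\<delta> t = \<gamma> s" "vector_derivative \<delta> (at t) = c *\<^sub>R vector_derivative \<gamma> (at s)"
  shows "speed H \<delta> t = \<bar>c\<bar> * speed H \<gamma> s"
  by (simp add: speed_hform assms hform_scaleR_vector real_sqrt_mult)

lemma valid_path_differentiable:
  assumes "valid_path \<gamma>"
  obtains S where "finite S" "\<And>t. t \<in> {0..1} - S \<Longrightarrow> (\<gamma> has_vector_derivative vector_derivative \<gamma> (at t)) (at t)"
  using assms unfolding valid_path_def piecewise_C1_differentiable_on_def C1_differentiable_on_eq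
  by (metis vector_derivative_works)

text \<open>The velocity doubles on each half and the halved intervals compensate for it; the
  junction and the exceptional points of both paths form a finite set invisible to the
  integral.\<close>

lemma has_integral_speed_join:
  assumes g1: "valid_path g1" "(speed H g1 has_integral i1) {0..1}"
    and g2: "valid_path g2" "(speed H g2 has_integral i2) {0..1}"
  shows "(speed H (g1 +++ g2) has_integral (i1 + i2)) {0..1}"
proof -
  obtain s1 where s1: "finite s1" "\<And>t. t \<in> {0..1} - s1 \<Longrightarrow> (g1 has_vector_derivative vector_derivative g1 (at t)) (at t)"
    using valid_path_differentiable[OF g1(1)] by blast
  obtain s2 where s2: "finite s2" "\<And>t. t \<in> {0..1} - s2 \<Longrightarrow> (g2 has_vector_derivative vector_derivative g2 (at t)) (at t)"
    using valid_path_differentiable[OF g2(1)] by blast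
  have i1: "((\<lambda>x. 2 * speed H g1 (2 * x)) has_integral i1) {0..1/2}"
   and i2: "((\<lambda>x. 2 * speed H g2 (2 * x - 1)) has_integral i2) {1/2..1}"
    using has_integral_affinity01[OF g1(2), where m = 2 and c = 0, THEN has_integral_cmul[where c = 2]]
          has_integral_affinity01[OF g2(2), where m = 2 and c = "-1", THEN has_integral_cmul[where c = 2]]
    by (simp_all only: image_affinity_atLeastAtMost_div_diff, simp_all add: scaleR_conv_of_real mult_ac)
  have v1: "vector_derivative (g1 +++ g2) (at z) = 2 *\<^sub>R vector_derivative g1 (at (2 * z))"
    if "0 \<le> z" "z < 1/2" "2 * z \<notin> s1" for z
  proof (rule vector_derivative_at)
    have "((*) 2 has_vector_derivative 2) (at z)"
      by (simp add: has_vector_derivative_def has_derivative_def bounded_linear_mult_left)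
    moreover have "(g1 has_vector_derivative vector_derivative g1 (at (2 * z))) (at (2 * z))"
      using that by (intro s1) auto
    ultimately have "((\<lambda>x. g1 (2 * x)) has_vector_derivative 2 *\<^sub>R vector_derivative g1 (at (2 * z))) (at z)"
      by (rule vector_diff_chain_at [unfolded o_def])
    then show "(g1 +++ g2 has_vector_derivative 2 *\<^sub>R vector_derivative g1 (at (2 * z))) (at z)"
      by (rule has_vector_derivative_transform_within_open[of _ _ _ "{..<1/2}"])
         (use that in \<open>auto simp: joinpaths_def\<close>)
  qed
  have v2: "vector_derivative (g1 +++ g2) (at z) = 2 *\<^sub>R vector_derivative g2 (at (2 * z - 1))"
    if "1/2 < z" "z \<le> 1" "2 * z - 1 \<notin> s2" for z
  proof (rule vector_derivative_at)
    have "((\<lambda>x. 2 * x - 1) has_vector_derivative 2) (at z)"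
      by (simp add: has_vector_derivative_def has_derivative_def bounded_linear_mult_left)
    moreover have "(g2 has_vector_derivative vector_derivative g2 (at (2 * z - 1))) (at (2 * z - 1))"
      using that by (intro s2) auto
    ultimately have "((\<lambda>x. g2 (2 * x - 1)) has_vector_derivative 2 *\<^sub>R vector_derivative g2 (at (2 * z - 1))) (at z)"
      by (rule vector_diff_chain_at [unfolded o_def])
    then show "(g1 +++ g2 has_vector_derivative 2 *\<^sub>R vector_derivative g2 (at (2 * z - 1))) (at z)"
      by (rule has_vector_derivative_transform_within_open[of _ _ _ "{1/2<..}"])
         (use that in \<open>auto simp: joinpaths_def\<close>)
  qed
  have "(speed H (g1 +++ g2) has_integral i1) {0..1/2}"
  proof (rule has_integral_spike_finite [OF _ _ i1])
    show "finite (insert (1/2) ((*) 2 -` s1))"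
      using s1 by (force intro: finite_vimageI [where h = "(*)2"] inj_onI)
    show "speed H (g1 +++ g2) x = 2 * speed H g1 (2 * x)" if "x \<in> {0..1/2} - insert (1/2) ((*) 2 -` s1)" for x
      using that speed_scaleR[OF _ v1[of x], of H] by (auto simp: joinpaths_def)
  qed
  moreover have "(speed H (g1 +++ g2) has_integral i2) {1/2..1}"
  proof (rule has_integral_spike_finite [OF _ _ i2])
    show "finite (insert (1/2) ((\<lambda>x. 2 * x - 1) -` s2))"
      using s2 by (force intro: finite_vimageI [where h = "\<lambda>x. 2*x-1"] inj_onI)
    show "speed H (g1 +++ g2) x = 2 * speed H g2 (2 * x - 1)" if "x \<in> {1/2..1} - insert (1/2) ((\<lambda>x. 2 * x - 1) -` s2)" for x
      using that speed_scaleR[OF _ v2[of x], of H] by (auto simp: joinpaths_def)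
  qed
  ultimately show ?thesis by (simp add: has_integral_combine [where c = "1/2"])
qed

lemma has_integral_speed_reversepath:
  assumes g: "valid_path g" "(speed H g has_integral i) {0..1}"
  shows "(speed H (reversepath g) has_integral i) {0..1}"
proof -
  obtain S where S: "finite S" "\<And>t. t \<in> {0..1} - S \<Longrightarrow> (g has_vector_derivative vector_derivative g (at t)) (at t)"
    using valid_path_differentiable[OF g(1)] by blast
  have v: "vector_derivative (reversepath g) (at z) = (-1) *\<^sub>R vector_derivative g (at (1 - z))"
    if "0 \<le> z" "z \<le> 1" "1 - z \<notin> S" for z
  proof (rule vector_derivative_at)
    have "((\<lambda>x. 1 - x) has_vector_derivative -1) (at z)" by (auto intro!: derivative_eq_intros)
    moreover have "(g has_vector_derivative vector_derivative g (at (1 - z))) (at (1 - z))"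
      using that by (intro S) auto
    ultimately show "(reversepath g has_vector_derivative (-1) *\<^sub>R vector_derivative g (at (1 - z))) (at z)"
      unfolding reversepath_def by (rule vector_diff_chain_at [unfolded o_def])
  qed
  have i: "((\<lambda>x. speed H g (1 - x)) has_integral i) {0..1}"
    using has_integral_affinity01 [where m= "-1" and c=1, OF g(2)] by simp
  show ?thesis
  proof (rule has_integral_spike_finite [OF _ _ i])
    show "finite ((\<lambda>x. 1 - x) ` S)" using S by simp
    show "speed H (reversepath g) x = speed H g (1 - x)" if "x \<in> {0..1} - (\<lambda>x. 1 - x) ` S" for x
    proof -
      have "1 - x \<notin> S" using that by (metis DiffD2 diff_diff_eq2 add_diff_cancel_left' image_eqI)
      then show ?thesis using that speed_scaleR[OF _ v[of x], of H] by (auto simp: reversepath_def)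
    qed
  qed
qed

definition admissible_path ::
    "(complex ^ 'n::finite) set \<Rightarrow> (complex ^ 'n \<Rightarrow> complex ^ 'n ^ 'n) \<Rightarrow> (real \<Rightarrow> complex ^ 'n) \<Rightarrow> complex ^ 'n \<Rightarrow> complex ^ 'n \<Rightarrow> bool" where
  "admissible_path D H \<gamma> x y \<longleftrightarrow> valid_path \<gamma> \<and> path_image \<gamma> \<subseteq> D \<and> pathstart \<gamma> = x \<and> pathfinish \<gamma> = y \<and>
     speed H \<gamma> integrable_on {0..1}"

lemma metric_dist_admissible:
  "x \<in> D \<Longrightarrow> y \<in> D \<Longrightarrow> metric_dist D H x y = Inf {integral {0..1} (speed H \<gamma>) | \<gamma>. admissible_path D H \<gamma> x y}"
  by (simp add: metric_dist_def admissible_path_def)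

lemma admissible_path_join:
  assumes "admissible_path D H g1 x y" "admissible_path D H g2 y z"
  shows "admissible_path D H (g1 +++ g2) x z"
    and "integral {0..1} (speed H (g1 +++ g2)) = integral {0..1} (speed H g1) + integral {0..1} (speed H g2)"
proof -
  have "(speed H (g1 +++ g2) has_integral (integral {0..1} (speed H g1) + integral {0..1} (speed H g2))) {0..1}"
    using assms by (intro has_integral_speed_join) (auto simp: admissible_path_def)
  then show "integral {0..1} (speed H (g1 +++ g2)) = integral {0..1} (speed H g1) + integral {0..1} (speed H g2)"
    and "admissible_path D H (g1 +++ g2) x z"
    using assms by (auto simp: admissible_path_def integral_unique valid_path_join
        dest: has_integral_integrable intro: subset_path_image_join[THEN subsetD])
qed

lemma admissible_path_reverse:
  assumes "admissible_path D H g x y"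
  shows "admissible_path D H (reversepath g) y x"
    and "integral {0..1} (speed H (reversepath g)) = integral {0..1} (speed H g)"
proof -
  have "(speed H (reversepath g) has_integral integral {0..1} (speed H g)) {0..1}"
    using assms by (intro has_integral_speed_reversepath) (auto simp: admissible_path_def)
  then show "admissible_path D H (reversepath g) y x"
    and "integral {0..1} (speed H (reversepath g)) = integral {0..1} (speed H g)"
    using assms by (auto simp: admissible_path_def integral_unique dest: has_integral_integrable)
qed

lemma continuous_on_hform:
  assumes "\<And>i j. continuous_on S (\<lambda>x. A x $ i $ j)"
  shows "continuous_on S (\<lambda>x. Re (hform (A x) v))"
  unfolding hform_def by (intro continuous_intros assms)

lemma admissible_path_linepath:
  assumes H: "\<And>i j. continuous_on D (\<lambda>x. H x $ i $ j)" and seg: "closed_segment x y \<subseteq> D"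
  shows "admissible_path D H (linepath x y) x y"
proof -
  have "continuous_on {0..1} (\<lambda>t. Re (hform (H (linepath x y t)) (y - x)))"
    by (rule continuous_on_compose2[OF continuous_on_hform[OF H], of _ "linepath x y"])
       (use seg in \<open>auto simp: path_image_linepath[symmetric] path_image_def intro: continuous_on_linepath\<close>)
  then have "speed H (linepath x y) integrable_on {0..1}"
    by (intro integrable_continuous_real) (simp add: speed_hform[abs_def] continuous_on_real_sqrt)
  then show ?thesis using seg by (simp add: admissible_path_def)
qed

text \<open>The fundamental theorem of calculus along the path. The target space is general because
  the estimate serves both the identity, for Euclidean control, and the exhaustion function.\<close>

lemma admissible_path_lipschitz:
  fixes F :: "complex^'n \<Rightarrow> 'b::euclidean_space"
  assumes D: "open D" and F: "\<And>x. x \<in> D \<Longrightarrow> (F has_derivative F' x) (at x)"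
    and bd: "\<And>x v. x \<in> D \<Longrightarrow> norm (F' x v) \<le> C * sqrt (Re (hform (H x) v))"
    and g: "admissible_path D H \<gamma> x y"
  shows "norm (F y - F x) \<le> C * integral {0..1} (speed H \<gamma>)"
proof -
  have vp: "valid_path \<gamma>" and im: "path_image \<gamma> \<subseteq> D" and ends: "\<gamma> 0 = x" "\<gamma> 1 = y"
    and int: "speed H \<gamma> integrable_on {0..1}"
    using g by (auto simp: admissible_path_def pathstart_def pathfinish_def)
  have inD: "\<gamma> t \<in> D" if "t \<in> {0..1}" for t using im that by (auto simp: path_image_def)
  obtain S where S: "finite S" "\<And>t. t \<in> {0..1} - S \<Longrightarrow> (\<gamma> has_vector_derivative vector_derivative \<gamma> (at t)) (at t)"
    using valid_path_differentiable[OF vp] by blast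
  let ?f = "\<lambda>t. F' (\<gamma> t) (vector_derivative \<gamma> (at t))"
  have "((\<lambda>t. F (\<gamma> t)) has_vector_derivative ?f t) (at t)" if "t \<in> {0<..<1} - S" for t
  proof -
    have "(\<gamma> has_derivative (\<lambda>h. h *\<^sub>R vector_derivative \<gamma> (at t))) (at t)"
      using S(2)[of t] that by (simp add: has_vector_derivative_def)
    moreover have Fd: "(F has_derivative F' (\<gamma> t)) (at (\<gamma> t))" using that by (intro F inD) auto
    ultimately have "((\<lambda>t. F (\<gamma> t)) has_derivative (\<lambda>h. F' (\<gamma> t) (h *\<^sub>R vector_derivative \<gamma> (at t)))) (at t)"
      by (rule has_derivative_compose)
    then show ?thesis
      by (simp add: has_vector_derivative_def linear.scaleR[OF has_derivative_linear[OF Fd]])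
  qed
  moreover have "continuous_on {0..1} (\<lambda>t. F (\<gamma> t))"
  proof (rule continuous_on_compose2[where t = D])
    show "continuous_on D F"
      using F by (intro continuous_at_imp_continuous_on ballI) (blast intro: has_derivative_continuous)
    show "continuous_on {0..1} \<gamma>" using valid_path_imp_path[OF vp] by (simp add: path_def)
  qed (use inD in auto)
  ultimately have I: "(?f has_integral (F (\<gamma> 1) - F (\<gamma> 0))) {0..1}"
    by (intro fundamental_theorem_of_calculus_interior_strong[OF S(1)]) auto
  have "norm (integral {0..1} ?f) \<le> integral {0..1} (\<lambda>t. C * speed H \<gamma> t)"
  proof (rule integral_norm_bound_integral)
    show "?f integrable_on {0..1}" using I by blast
    show "(\<lambda>t. C * speed H \<gamma> t) integrable_on {0..1}" by (intro integrable_on_mult_right int)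
    show "norm (?f t) \<le> C * speed H \<gamma> t" if "t \<in> {0..1}" for t
      unfolding speed_hform by (rule bd[OF inD[OF that]])
  qed
  then show ?thesis using integral_unique[OF I] by (simp add: ends)
qed

text \<open>Star-shapedness provides joining paths, so that the infimum is over a nonempty set.
  \<open>low\<close> separates points and yields a Euclidean limit, \<open>grad\<close> with
  \<open>bdry\<close> keeps it inside, and continuity of \<open>H\<close> turns Euclidean
  convergence into convergence in the metric.\<close>

lemma complete_metric_dist:
  fixes D :: "(complex^'n::finite) set" and H :: "complex^'n \<Rightarrow> complex^'n^'n" and g :: "complex^'n \<Rightarrow> real"
  assumes D: "open D" and star: "\<And>x. x \<in> D \<Longrightarrow> closed_segment 0 x \<subseteq> D"
    and Hc: "\<And>i j. continuous_on D (\<lambda>x. H x $ i $ j)"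
    and pd: "\<And>x. x \<in> D \<Longrightarrow> hermitian_pos_def (H x)"
    and low: "\<And>x v. x \<in> D \<Longrightarrow> norm v \<le> A * sqrt (Re (hform (H x) v))"
    and g: "\<And>x. x \<in> D \<Longrightarrow> (g has_derivative g' x) (at x)"
    and grad: "\<And>x v. x \<in> D \<Longrightarrow> \<bar>g' x v\<bar> \<le> C * sqrt (Re (hform (H x) v))"
    and bdry: "\<And>b. b \<in> frontier D \<Longrightarrow> filterlim g at_top (at b within D)"
  shows "Metric_space D (metric_dist D H) \<and> Metric_space.mcomplete D (metric_dist D H)"
proof -
  define L where "L x y = {integral {0..1} (speed H \<gamma>) | \<gamma>. admissible_path D H \<gamma> x y}" for x y
  have dist: "metric_dist D H x y = Inf (L x y)" if "x \<in> D" "y \<in> D" for x y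
    using metric_dist_admissible[OF that] by (simp add: L_def)
  \<comment> \<open>Two points are joined through the origin.\<close>
  have path: "\<exists>\<gamma>. admissible_path D H \<gamma> x y" if "x \<in> D" "y \<in> D" for x y
    using admissible_path_join(1)[OF admissible_path_reverse(1)[OF admissible_path_linepath[OF Hc star[OF that(1)]]]
        admissible_path_linepath[OF Hc star[OF that(2)]]] by blast
  have ne: "L x y \<noteq> {}" if "x \<in> D" "y \<in> D" for x y
    using path[OF that] by (auto simp: L_def)
  have sq: "0 \<le> Re (hform (H x) v)" if "x \<in> D" for x v
    using hermitian_pos_def_imp_psd[OF pd[OF that]] by (simp add: psd_def)
  have len0: "0 \<le> integral {0..1} (speed H \<gamma>)" if "admissible_path D H \<gamma> x y" for \<gamma> x y
  proof (rule integral_nonneg)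
    show "speed H \<gamma> integrable_on {0..1}" using that by (simp add: admissible_path_def)
    fix t :: real assume t: "t \<in> {0..1}"
    then have "\<gamma> t \<in> D" using that by (auto simp: admissible_path_def path_image_def)
    then show "0 \<le> speed H \<gamma> t"
      using sq by (simp add: speed_hform)
  qed
  have bdd: "bdd_below (L x y)" for x y
    by (rule bdd_belowI[of _ 0]) (auto simp: L_def len0)
  have d_le: "metric_dist D H x y \<le> integral {0..1} (speed H \<gamma>)" if "admissible_path D H \<gamma> x y" for \<gamma> x y
  proof -
    have "x \<in> D" "y \<in> D" using that by (auto simp: admissible_path_def)
    then show ?thesis using that unfolding dist[OF \<open>x \<in> D\<close> \<open>y \<in> D\<close>]
      by (intro cInf_lower bdd) (auto simp: L_def)
  qed
  have nonneg: "0 \<le> metric_dist D H x y" for x y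
  proof (cases "x \<in> D \<and> y \<in> D")
    case True
    then have "metric_dist D H x y = Inf (L x y)" "L x y \<noteq> {}" using dist ne by auto
    then show ?thesis using len0 cInf_greatest[of "L x y" 0] by (auto simp: L_def)
  qed (auto simp: metric_dist_def)
  have lip: "norm (F y - F x) \<le> B * metric_dist D H x y"
    if F: "\<And>x. x \<in> D \<Longrightarrow> (F has_derivative F' x) (at x)"
      and bd: "\<And>x v. x \<in> D \<Longrightarrow> norm (F' x v) \<le> B * sqrt (Re (hform (H x) v))"
      and xy: "x \<in> D" "y \<in> D" and B: "B > 0"
    for F :: "complex^'n \<Rightarrow> 'z::euclidean_space" and F' B x y
  proof -
    have "norm (F y - F x) / B \<le> Inf (L x y)"
    proof (rule cInf_greatest[OF ne[OF xy]])
      fix l assume "l \<in> L x y"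
      then show "norm (F y - F x) / B \<le> l"
        using admissible_path_lipschitz[OF D F bd] B by (auto simp: L_def field_simps)
    qed
    then show ?thesis using B by (simp add: dist[OF xy] field_simps)
  qed
  \<comment> \<open>Enlarged to be positive, since the Lipschitz estimate divides by the
    constant.\<close>
  define A' where "A' = max A 1"
  define C' where "C' = max C 1"
  have lower: "norm (y - x) \<le> A' * metric_dist D H x y" if "x \<in> D" "y \<in> D" for x y
  proof (rule lip[of "\<lambda>x. x" "\<lambda>x v. v"])
    show "norm v \<le> A' * sqrt (Re (hform (H x) v))" if "x \<in> D" for x v
      using low[OF that, of v] mult_right_mono[of A A' "sqrt (Re (hform (H x) v))"] sq[OF that]
      by (fastforce simp: A'_def)
  qed (use that in \<open>auto simp: A'_def\<close>)
  have glip: "\<bar>g y - g x\<bar> \<le> C' * metric_dist D H x y" if "x \<in> D" "y \<in> D" for x y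
  proof -
    have "norm (g y - g x) \<le> C' * metric_dist D H x y"
    proof (rule lip[OF g])
      show "norm (g' x v) \<le> C' * sqrt (Re (hform (H x) v))" if "x \<in> D" for x v
        using grad[OF that, of v] mult_right_mono[of C C' "sqrt (Re (hform (H x) v))"] sq[OF that]
        by (fastforce simp: C'_def)
    qed (use that in \<open>auto simp: C'_def\<close>)
    then show ?thesis by simp
  qed
  have refl: "metric_dist D H x x = 0" if "x \<in> D" for x
  proof -
    have "admissible_path D H (linepath x x) x x" using that by (intro admissible_path_linepath Hc) auto
    moreover have "integral {0..1} (speed H (linepath x x)) = 0" by (simp add: speed_hform[abs_def])
    ultimately have "metric_dist D H x x \<le> 0" using d_le by metis
    then show ?thesis using nonneg[of x x] by simp
  qed
  interpret M: Metric_space D "metric_dist D H"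
  proof
    show "metric_dist D H x y = metric_dist D H y x" for x y
    proof (cases "x \<in> D \<and> y \<in> D")
      case True
      have "L x y \<subseteq> L y x" for x y
      proof
        fix l assume "l \<in> L x y"
        then obtain \<gamma> where "admissible_path D H \<gamma> x y" "l = integral {0..1} (speed H \<gamma>)" by (auto simp: L_def)
        then show "l \<in> L y x" using admissible_path_reverse[of D H \<gamma> x y] unfolding L_def by (metis (mono_tags, lifting) mem_Collect_eq)
      qed
      then have "L x y = L y x" by blast
      then show ?thesis using True dist by simp
    qed (auto simp: metric_dist_def)
    show "metric_dist D H x y = 0 \<longleftrightarrow> x = y" if "x \<in> D" "y \<in> D" for x y
      using lower[OF that] refl that by auto
    show "metric_dist D H x z \<le> metric_dist D H x y + metric_dist D H y z" if xyz: "x \<in> D" "y \<in> D" "z \<in> D" for x y z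
    proof -
      have 1: "metric_dist D H x z \<le> a + b" if ab: "a \<in> L x y" "b \<in> L y z" for a b
      proof -
        obtain g1 g2 where g: "admissible_path D H g1 x y" "a = integral {0..1} (speed H g1)"
          "admissible_path D H g2 y z" "b = integral {0..1} (speed H g2)" using ab by (auto simp: L_def)
        show ?thesis
          using d_le[OF admissible_path_join(1)[OF g(1,3)]] admissible_path_join(2)[OF g(1,3)] g(2,4) by simp
      qed
      have "metric_dist D H x z - b \<le> Inf (L x y)" if "b \<in> L y z" for b
        using 1 that by (intro cInf_greatest[OF ne]) (auto simp: xyz algebra_simps)
      then have "metric_dist D H x z - Inf (L x y) \<le> Inf (L y z)"
        by (intro cInf_greatest[OF ne]) (auto simp: xyz algebra_simps)
      then show ?thesis by (simp add: dist xyz)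
    qed
  qed (rule nonneg)
  have "M.mcomplete"
    unfolding M.mcomplete_def
  proof (intro allI impI)
    fix \<sigma> assume "M.MCauchy \<sigma>"
    then have sD: "\<sigma> n \<in> D" and cau: "\<epsilon> > 0 \<Longrightarrow> \<exists>N. \<forall>n n'. N \<le> n \<longrightarrow> N \<le> n' \<longrightarrow> metric_dist D H (\<sigma> n) (\<sigma> n') < \<epsilon>" for n \<epsilon>
      by (auto simp: M.MCauchy_def)
    have A': "A' > 0" and C': "C' > 0" by (auto simp: A'_def C'_def)
    have "Cauchy \<sigma>"
      unfolding Cauchy_def
    proof (intro allI impI)
      fix e :: real assume "e > 0"
      then have "e / A' > 0" using A' by simp
      from cau[OF this] obtain N where N: "\<forall>n n'. N \<le> n \<longrightarrow> N \<le> n' \<longrightarrow> metric_dist D H (\<sigma> n) (\<sigma> n') < e / A'" by blast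
      have "dist (\<sigma> m) (\<sigma> n) < e" if "m \<ge> N" "n \<ge> N" for m n
      proof -
        have "dist (\<sigma> m) (\<sigma> n) \<le> A' * metric_dist D H (\<sigma> m) (\<sigma> n)"
          using lower[OF sD[of m] sD[of n]] by (simp only: dist_norm norm_minus_commute[of "\<sigma> m"])
        also have "\<dots> < e" using N that A' by (simp add: field_simps)
        finally show ?thesis .
      qed
      then show "\<exists>M. \<forall>m\<ge>M. \<forall>n\<ge>M. dist (\<sigma> m) (\<sigma> n) < e" by blast
    qed
    then obtain l where l: "\<sigma> \<longlonglongrightarrow> l" using Cauchy_convergent_iff convergent_def by blast
    have lcl: "l \<in> closure D" using sD l closure_sequential by blast
    have lD: "l \<in> D"
    proof (rule ccontr)
      assume nl: "l \<notin> D"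
      then have "l \<in> frontier D" using lcl D by (simp add: frontier_def interior_open)
      then have "filterlim g at_top (at l within D)" by (rule bdry)
      moreover have "filterlim \<sigma> (at l within D) sequentially"
        unfolding filterlim_at using l sD nl by (auto intro!: always_eventually)
      ultimately have inf: "filterlim (\<lambda>n. g (\<sigma> n)) at_top sequentially" by (rule filterlim_compose)
      from cau[of 1] obtain N where N: "\<forall>n n'. N \<le> n \<longrightarrow> N \<le> n' \<longrightarrow> metric_dist D H (\<sigma> n) (\<sigma> n') < 1" by auto
      \<comment> \<open>Tail distances below 1 bound \<open>g\<close> along the sequence, which
        excludes convergence to a boundary point.\<close>
      have "g (\<sigma> n) \<le> g (\<sigma> N) + C'" if "n \<ge> N" for n
      proof -
        have "\<bar>g (\<sigma> n) - g (\<sigma> N)\<bar> \<le> C' * metric_dist D H (\<sigma> N) (\<sigma> n)" by (rule glip[OF sD sD])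
        also have "\<dots> \<le> C' * 1" using N that C' by (intro mult_left_mono) (auto intro: less_imp_le)
        finally show ?thesis by simp
      qed
      moreover have "\<forall>\<^sub>F n in sequentially. g (\<sigma> N) + C' < g (\<sigma> n)"
        using inf by (simp add: filterlim_at_top_dense)
      ultimately show False
        unfolding eventually_sequentially by (metis linorder_not_less nle_le)
    qed
    \<comment> \<open>Near the limit the metric is at most a multiple of the Euclidean one, and the
      ball contains the straight segments whose lengths bound the distance.\<close>
    obtain r where r: "r > 0" "cball l r \<subseteq> D" using D lD by (meson open_contains_cball)
    have "continuous_on (cball l r) (\<lambda>x. \<Sum>i\<in>UNIV. \<Sum>j\<in>UNIV. norm (H x $ i $ j))"
      by (intro continuous_intros continuous_on_subset[OF Hc r(2)])
    then have "bounded ((\<lambda>x. \<Sum>i\<in>UNIV. \<Sum>j\<in>UNIV. norm (H x $ i $ j)) ` cball l r)"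
      by (intro compact_imp_bounded compact_continuous_image) auto
    then obtain B where B: "\<And>x. x \<in> cball l r \<Longrightarrow> (\<Sum>i\<in>UNIV. \<Sum>j\<in>UNIV. norm (H x $ i $ j)) \<le> B" "B > 0"
      unfolding bounded_pos by (metis abs_le_D1 imageI real_norm_def)
    have upper: "metric_dist D H x l \<le> sqrt B * norm (l - x)" if x: "x \<in> cball l r" for x
    proof -
      have seg: "closed_segment x l \<subseteq> cball l r" using x r by (intro closed_segment_subset) auto
      have adm: "admissible_path D H (linepath x l) x l"
        using seg r by (intro admissible_path_linepath Hc) auto
      have "integral {0..1} (speed H (linepath x l)) \<le> integral {0..1::real} (\<lambda>_. sqrt B * norm (l - x))"
      proof (rule integral_le)
        show "speed H (linepath x l) integrable_on {0..1}" using adm by (simp add: admissible_path_def)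
        show "speed H (linepath x l) t \<le> sqrt B * norm (l - x)" if "t \<in> {0..1}" for t
        proof -
          have "linepath x l t \<in> cball l r" using seg linepath_in_path[OF that, of x l] by blast
          have "Re (hform (H (linepath x l t)) (l - x)) \<le> norm (hform (H (linepath x l t)) (l - x))" by (rule complex_Re_le_cmod)
          also have "\<dots> \<le> (\<Sum>i\<in>UNIV. \<Sum>j\<in>UNIV. norm (H (linepath x l t) $ i $ j)) * (norm (l - x))\<^sup>2" by (rule norm_hform_le)
          also have "\<dots> \<le> B * (norm (l - x))\<^sup>2"
            using B(1) \<open>linepath x l t \<in> cball l r\<close> by (intro mult_right_mono) auto
          finally have "sqrt (Re (hform (H (linepath x l t)) (l - x))) \<le> sqrt (B * (norm (l - x))\<^sup>2)" by (rule real_sqrt_le_mono)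
          then show ?thesis by (simp add: speed_hform real_sqrt_mult)
        qed
      qed auto
      then show ?thesis using d_le[OF adm] by simp
    qed
    have "\<exists>N. \<forall>n\<ge>N. \<sigma> n \<in> D \<and> metric_dist D H (\<sigma> n) l < \<epsilon>" if "\<epsilon> > 0" for \<epsilon>
    proof -
      have "min r (\<epsilon> / sqrt B) > 0" using r that B by simp
      then obtain N where N: "\<forall>n\<ge>N. dist (\<sigma> n) l < min r (\<epsilon> / sqrt B)" using l unfolding lim_sequentially by blast
      have "metric_dist D H (\<sigma> n) l < \<epsilon>" if "n \<ge> N" for n
      proof -
        have d: "dist (\<sigma> n) l < r" "dist (\<sigma> n) l < \<epsilon> / sqrt B" using N that by auto
        have "metric_dist D H (\<sigma> n) l \<le> sqrt B * norm (l - \<sigma> n)" using d by (intro upper) (simp add: dist_commute)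
        also have "\<dots> < \<epsilon>" using d(2) B by (simp add: field_simps dist_norm norm_minus_commute)
        finally show ?thesis .
      qed
      then show ?thesis using sD by blast
    qed
    then have "limitin M.mtopology \<sigma> l sequentially"
      using lD by (simp add: M.limit_metric_sequentially)
    then show "\<exists>x. limitin M.mtopology \<sigma> x sequentially" by blast
  qed
  then show ?thesis using M.Metric_space_axioms by blast
qed

section \<open>The action of matrices on symmetric matrices\<close>

lemma Z_part_component: "Z_part x $ k $ l = x $ Inl (Upair k l) * (if k = l then 1 else 1 / complex_of_real (sqrt 2))"
  by (simp add: Z_part_def)

lemma bounded_linear_Z_part: "bounded_linear Z_part"
  unfolding linear_conv_bounded_linear[symmetric] linear_iff
  by (auto simp: vec_eq_iff Z_part_component algebra_simps)

lemmas Z_part_linear = bounded_linear.linear[OF bounded_linear_Z_part]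

lemma transpose_Z_part: "transpose (Z_part x) = Z_part x"
proof -
  have U: "Upair l k = Upair k l" for k l :: 'a by simp
  have "transpose (Z_part x) $ k $ l = Z_part x $ k $ l" for k l
    unfolding transpose_def Z_part_component vec_lambda_beta U[of l k] by auto
  then show ?thesis by (simp add: vec_eq_iff)
qed

lemma bounded_linear_cnj_matrix: "bounded_linear (map_matrix cnj :: complex^'n^'m \<Rightarrow> complex^'n^'m)"
  unfolding linear_conv_bounded_linear[symmetric] linear_iff
  by (auto simp: vec_eq_iff)

lemma cadj_Z_part: "cadj (Z_part x) = map_matrix cnj (Z_part x)"
  by (simp add: cadj_def transpose_Z_part)

text \<open>Complex scalars act on matrices through \<open>mat c\<close>, since
  \<open>*\<^sub>R\<close> takes real factors only.\<close>

lemma mat_mult_component: "(mat c ** A) $ k $ l = c * (A :: complex^'n^'m) $ k $ l"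
  by (simp add: matrix_matrix_mult_def mat_def if_distrib[of "\<lambda>x. x * _"] cong: if_cong)

lemma mat_mult_commute: "A ** (mat c ** B) = mat c ** (A ** B :: complex^'k^'m)"
proof -
  have "(A ** (mat c ** B)) $ i $ j = c * (A ** B) $ i $ j" for i j
    unfolding matrix_matrix_mult_def[of A] vec_lambda_beta mat_mult_component
    by (simp add: sum_distrib_left mult_ac)
  then show ?thesis by (simp add: vec_eq_iff mat_mult_component)
qed

lemma trace_mat_mult: "trace (mat c ** A) = c * trace (A :: complex^'n^'n)"
  by (simp add: trace_def mat_mult_component sum_distrib_left)

lemma Z_part_scale: "Z_part (c *s x) = mat c ** Z_part x"
  by (simp add: vec_eq_iff mat_mult_component Z_part_component)

lemma cnj_mat_mult: "map_matrix cnj (mat c ** A) = mat (cnj c) ** map_matrix cnj A"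
  by (simp add: vec_eq_iff mat_mult_component)

text \<open>The matrices of the coordinate vectors: symmetric with real entries, and zero for the
  w-coordinates.\<close>

abbreviation E_basis :: "('p::finite uprod + 'r::finite) \<Rightarrow> complex^'p^'p" where
  "E_basis i \<equiv> Z_part (axis i 1)"

lemma cnj_E_basis: "map_matrix cnj (E_basis i) = E_basis i"
  by (simp add: vec_eq_iff Z_part_component axis_def)

lemma axis_ii: "axis i \<i> = \<i> *s axis i 1"
  by (simp add: vec_eq_iff axis_def)

lemma Z_part_expand: "Z_part v = (\<Sum>i\<in>UNIV. mat (v $ i) ** E_basis i)"
proof -
  have "(\<Sum>i\<in>UNIV. v $ i * (axis i 1 $ j * c)) = v $ j * c" for j c
  proof -
    have "(\<Sum>i\<in>UNIV. v $ i * (axis i 1 $ j * c)) = (\<Sum>i\<in>UNIV. if i = j then v $ j * c else 0)"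
      by (intro sum.cong refl) (auto simp: axis_def)
    then show ?thesis by simp
  qed
  then show ?thesis by (simp add: vec_eq_iff mat_mult_component Z_part_component)
qed

lemma cnj_Z_part_expand: "map_matrix cnj (Z_part v) = (\<Sum>i\<in>UNIV. mat (cnj (v $ i)) ** E_basis i)"
  by (subst Z_part_expand) (simp add: linear_sum[OF bounded_linear.linear[OF bounded_linear_cnj_matrix]] cnj_mat_mult cnj_E_basis)

lemmas matrix_mult_sum_left = bounded_bilinear.sum_left [OF bounded_bilinear_matrix_mult]
lemmas matrix_mult_sum_right = bounded_bilinear.sum_right [OF bounded_bilinear_matrix_mult]
lemmas trace_sum = linear_sum [OF bounded_linear.linear [OF bounded_linear_trace]]

text \<open>The basis matrices are real, so conjugation falls on the coefficients alone and the
  double sum is the expansion of a sesquilinear trace.\<close>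

lemma hform_trace_form:
  fixes v :: "complex^('p::finite uprod + 'r::finite)"
  shows "hform (\<chi> i j. trace (M ** E_basis i ** N ** E_basis j)) v
    = trace (M ** Z_part v ** N ** map_matrix cnj (Z_part v))"
proof -
  have "trace (M ** Z_part v ** N ** map_matrix cnj (Z_part v))
    = (\<Sum>j\<in>UNIV. \<Sum>i\<in>UNIV. trace (M ** (mat (v $ i) ** E_basis i) ** N ** (mat (cnj (v $ j)) ** E_basis j)))"
    unfolding cnj_Z_part_expand
    by (subst Z_part_expand) (simp add: matrix_mult_sum_left matrix_mult_sum_right trace_sum)
  also have "\<dots> = (\<Sum>i\<in>UNIV. \<Sum>j\<in>UNIV. trace (M ** (mat (v $ i) ** E_basis i) ** N ** (mat (cnj (v $ j)) ** E_basis j)))"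
    by (rule sum.swap)
  also have "\<dots> = hform (\<chi> i j. trace (M ** E_basis i ** N ** E_basis j)) v"
  proof -
    have "trace (M ** (mat c ** A) ** N ** (mat d ** B)) = c * (d * trace (M ** A ** N ** B))"
      for c d and A B :: "complex^'p^'p"
    proof -
      have "M ** (mat c ** A) ** N ** (mat d ** B) = mat d ** (M ** (mat c ** A) ** N ** B)"
        by (rule mat_mult_commute)
      also have "M ** (mat c ** A) ** N ** B = mat c ** (M ** A ** N ** B)"
        unfolding mat_mult_commute[of M c A] by (simp only: matrix_mul_assoc)
      finally show ?thesis by (simp only: trace_mat_mult mult_ac)
    qed
    then show ?thesis by (simp add: hform_def mult_ac)
  qed
  finally show ?thesis by simp
qed

section \<open>Orthonormality and completeness of the symmetric basis\<close>

lemma sum_if_outside: "(\<Sum>l\<in>A. if Q then f l else 0) = (if Q then \<Sum>l\<in>A. f l else 0)"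
  by simp

text \<open>Two entries 1/sqrt 2 have product 1/2; for a = b the two summands together give the
  square of the entry 1, so one formula covers both cases.\<close>

lemma E_basis_product:
  "E_basis (Inl (Upair a b) :: 'p::finite uprod + 'r::finite) $ k $ l * E_basis (Inl (Upair k l) :: 'p uprod + 'r) $ a $ b
    = (if k = a \<and> l = b then 1/2 else 0) + (if k = b \<and> l = a then 1/2 else 0)"
proof -
  have half: "complex_of_real (sqrt 2) * complex_of_real (sqrt 2) = 2"
    by (simp flip: of_real_mult)
  have ax: "axis (Inl u) 1 $ Inl v = (if u = v then 1 else 0 :: complex)" for u v :: "'p uprod"
    by (simp add: axis_def)
  show ?thesis
  proof (cases "Upair k l = Upair a b")
    case True
    then have "k = a \<and> l = b \<or> k = b \<and> l = a" by auto
    then show ?thesis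
      by (elim disjE conjE; cases "a = b") (simp_all add: Z_part_component ax half)
  next
    case False
    then have "\<not> (k = a \<and> l = b)" "\<not> (k = b \<and> l = a)" by auto
    then show ?thesis using False by (simp only: Z_part_component ax) simp
  qed
qed

text \<open>The completeness relation: the sum of the tensor squares of the basis is the kernel of
  the symmetrization A -> (A + A^T)/2. The weight 1/sqrt 2 in the coordinates is what makes it
  hold.\<close>

lemma sum_E_basis_product:
  "(\<Sum>u\<in>UNIV. E_basis (Inl u :: 'p::finite uprod + 'r::finite) $ k $ l * E_basis (Inl u :: 'p uprod + 'r) $ a $ b)
    = (if k = a \<and> l = b then 1/2 else 0) + (if k = b \<and> l = a then 1/2 else 0)"
proof -
  have "(\<Sum>u\<in>UNIV. E_basis (Inl u :: 'p uprod + 'r) $ k $ l * E_basis (Inl u :: 'p uprod + 'r) $ a $ b)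
     = (\<Sum>u\<in>UNIV. if u = Upair k l then E_basis (Inl (Upair a b) :: 'p uprod + 'r) $ k $ l * E_basis (Inl (Upair k l) :: 'p uprod + 'r) $ a $ b else 0)"
    by (intro sum.cong refl) (auto simp: Z_part_component axis_def)
  then show ?thesis by (simp add: E_basis_product)
qed

text \<open>Parseval's identity for the trace pairing; only the symmetric part of \<open>Y\<close>
  is seen by a symmetric \<open>X\<close>.\<close>

lemma sum_trace_E_basis:
  fixes X :: "complex^'p::finite^'p"
  assumes X: "transpose X = X"
  shows "(\<Sum>u\<in>UNIV. trace (X ** E_basis (Inl u :: 'p uprod + 'r::finite)) * trace (E_basis (Inl u :: 'p uprod + 'r) ** Y)) = trace (X ** Y)"
proof -
  have Xs: "X $ a $ b = X $ b $ a" for a b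
    using arg_cong[OF X, of "\<lambda>A. A $ b $ a"] by (simp add: transpose_def)
  let ?E = "\<lambda>u. E_basis (Inl u :: 'p uprod + 'r)"
  have "(\<Sum>u\<in>UNIV. trace (X ** ?E u) * trace (?E u ** Y))
    = (\<Sum>u\<in>UNIV. \<Sum>k\<in>UNIV. \<Sum>a\<in>UNIV. \<Sum>l\<in>UNIV. \<Sum>b\<in>UNIV. X $ k $ l * Y $ b $ a * (?E u $ l $ k * ?E u $ a $ b))"
    by (simp add: trace_def matrix_matrix_mult_def sum_product mult_ac)
  also have "\<dots> = (\<Sum>k\<in>UNIV. \<Sum>a\<in>UNIV. \<Sum>l\<in>UNIV. \<Sum>b\<in>UNIV. X $ k $ l * Y $ b $ a * (\<Sum>u\<in>UNIV. ?E u $ l $ k * ?E u $ a $ b))"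
    unfolding sum_distrib_left
    by (subst sum.swap, intro sum.cong refl, subst sum.swap, intro sum.cong refl,
        subst sum.swap, intro sum.cong refl, subst sum.swap, rule refl)
  also have "\<dots> = (\<Sum>k\<in>UNIV. \<Sum>a\<in>UNIV. \<Sum>l\<in>UNIV. \<Sum>b\<in>UNIV.
      (if l = a then if b = k then X $ k $ a * Y $ k $ a / 2 else 0 else 0) + (if b = l then if a = k then X $ k $ l * Y $ l $ k / 2 else 0 else 0))"
    unfolding sum_E_basis_product by (intro sum.cong refl) auto
  also have "\<dots> = (\<Sum>k\<in>UNIV. \<Sum>a\<in>UNIV. X $ k $ a * Y $ k $ a / 2) + (\<Sum>k\<in>UNIV. \<Sum>l\<in>UNIV. X $ k $ l * Y $ l $ k / 2)"
    by (simp add: sum.distrib sum_if_outside)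
  also have "(\<Sum>k\<in>UNIV. \<Sum>a\<in>UNIV. X $ k $ a * Y $ k $ a / 2) = (\<Sum>k\<in>UNIV. \<Sum>l\<in>UNIV. X $ k $ l * Y $ l $ k / 2)"
    by (subst sum.swap) (simp add: Xs mult_ac)
  also have "(\<Sum>k\<in>UNIV. \<Sum>l\<in>UNIV. X $ k $ l * Y $ l $ k / 2) + (\<Sum>k\<in>UNIV. \<Sum>l\<in>UNIV. X $ k $ l * Y $ l $ k / 2) = trace (X ** Y)"
    by (simp add: trace_def matrix_matrix_mult_def sum.distrib[symmetric])
  finally show ?thesis .
qed

lemma trace_E_basis_orthonormal:
  "trace (E_basis (Inl u :: 'p::finite uprod + 'r::finite) ** E_basis (Inl v :: 'p uprod + 'r)) = (if u = v then 1 else 0)"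
proof (cases u)
  case (Upair a b)
  let ?E = "\<lambda>u. E_basis (Inl u :: 'p uprod + 'r)"
  have "trace (?E u ** ?E v) = (\<Sum>k\<in>UNIV. \<Sum>l\<in>UNIV. ?E u $ k $ l * ?E v $ l $ k)"
    by (simp add: trace_def matrix_matrix_mult_def)
  also have "\<dots> = (\<Sum>k\<in>UNIV. \<Sum>l\<in>UNIV. if u = v then (if k = a then if l = b then 1/2 else 0 else 0) + (if k = b then if l = a then 1/2 else 0 else 0) else 0)"
  proof (intro sum.cong refl)
    fix k l
    have "?E u $ k $ l * ?E v $ l $ k = (if u = v then ?E (Upair a b) $ k $ l * ?E (Upair k l) $ a $ b else 0)"
      using Upair by (auto simp: Z_part_component axis_def)
    then show "?E u $ k $ l * ?E v $ l $ k = (if u = v then (if k = a then if l = b then 1/2 else 0 else 0) + (if k = b then if l = a then 1/2 else 0 else 0) else 0)"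
      unfolding E_basis_product by auto
  qed
  also have "\<dots> = (if u = v then 1 else 0)"
    by (simp add: sum.distrib sum_if_outside)
  finally show ?thesis .
qed

text \<open>The completeness relation contributes 1/2 from one summand and p/2 from the other. Twice
  this constant is the exponent p+1 of the determinant.\<close>

lemma sum_E_basis_square:
  "(\<Sum>u\<in>UNIV. E_basis (Inl u :: 'p::finite uprod + 'r::finite) ** E_basis (Inl u :: 'p uprod + 'r))
    = mat ((of_nat CARD('p) + 1) / 2)"
proof -
  let ?E = "\<lambda>u. E_basis (Inl u :: 'p uprod + 'r)"
  have "(\<Sum>u\<in>UNIV. ?E u ** ?E u) $ k $ l = mat ((of_nat CARD('p) + 1) / 2) $ k $ l" for k l
  proof -
    have "(\<Sum>u\<in>UNIV. ?E u ** ?E u) $ k $ l = (\<Sum>m\<in>UNIV. \<Sum>u\<in>UNIV. ?E u $ k $ m * ?E u $ m $ l)"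
      unfolding sum_component matrix_matrix_mult_def vec_lambda_beta by (rule sum.swap)
    also have "\<dots> = (\<Sum>m\<in>UNIV. (if k = m then if m = l then 1/2 else 0 else 0) + (if k = l then 1/2 else 0))"
      unfolding sum_E_basis_product by (intro sum.cong refl) auto
    also have "\<dots> = mat ((of_nat CARD('p) + 1) / 2) $ k $ l"
      by (simp add: sum.distrib mat_def add_divide_distrib)
    finally show ?thesis .
  qed
  then show ?thesis by (simp add: vec_eq_iff)
qed

text \<open>The matrix of \<open>V \<mapsto> M V N\<^sup>T\<close>, compressed to symmetric matrices; the argument
  \<open>r\<close> only fixes the coordinate type over which \<open>E_basis\<close> is indexed.\<close>

definition sym_op :: "'r::finite itself \<Rightarrow> complex^'p::finite^'p \<Rightarrow> complex^'p^'p \<Rightarrow> complex^('p uprod)^('p uprod)" where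
  "sym_op r M N = (\<chi> u v. trace (M ** E_basis (Inl u :: 'p uprod + 'r) ** transpose N ** E_basis (Inl v :: 'p uprod + 'r)))"

lemma transpose_add: "transpose (A + B) = transpose A + transpose (B :: complex^'n^'m)"
  and transpose_scaleR: "transpose (c *\<^sub>R A) = c *\<^sub>R transpose A"
  and transpose_diff: "transpose (A - B) = transpose A - transpose B"
  by (simp_all add: vec_eq_iff transpose_def)

lemma bounded_bilinear_sym_op: "bounded_bilinear (sym_op r)"
  unfolding bilinear_conv_bounded_bilinear[symmetric] bilinear_def linear_iff
  by (auto simp: sym_op_def vec_eq_iff transpose_add transpose_scaleR matrix_mult_add_left matrix_mult_add_right
      matrix_mult_scaleR_left matrix_mult_scaleR_right trace_add trace_scaleR)

text \<open>Row \<open>u\<close> of \<open>S\<close> holds the coordinates of the symmetric matrix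
  \<open>X u\<close>, and by Parseval multiplication by \<open>sym_op r N N\<close> carries them to
  those of N (X u) N^T. The family \<open>X\<close> is arbitrary because the derivative of
  \<open>sym_op\<close> along a path is symmetric only as a sum of two terms.\<close>

lemma sym_op_mult:
  fixes r :: "'r::finite itself"
  assumes X: "\<And>u. transpose (X u) = X u" and S: "\<And>u v. S $ u $ v = trace (X u ** E_basis (Inl v :: 'p::finite uprod + 'r))"
  shows "(S ** sym_op r N N) $ u $ w = trace (N ** X u ** transpose N ** E_basis (Inl w :: 'p uprod + 'r))"
proof -
  have "(S ** sym_op r N N) $ u $ w = (\<Sum>v\<in>UNIV. trace (X u ** E_basis (Inl v :: 'p uprod + 'r))
      * trace (E_basis (Inl v :: 'p uprod + 'r) ** (transpose N ** E_basis (Inl w :: 'p uprod + 'r) ** N)))"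
    unfolding matrix_matrix_mult_def[of S] vec_lambda_beta S sym_op_def
    by (simp add: matrix_mul_assoc[symmetric] trace_mul_sym[of N])
  also have "\<dots> = trace (X u ** (transpose N ** E_basis (Inl w :: 'p uprod + 'r) ** N))"
    by (rule sum_trace_E_basis[OF X])
  also have "\<dots> = trace (N ** X u ** transpose N ** E_basis (Inl w :: 'p uprod + 'r))"
    by (simp add: matrix_mul_assoc[symmetric] trace_mul_sym[of N])
  finally show ?thesis .
qed

lemma sym_op_mat_1: "sym_op r (mat 1) (mat 1) = mat 1"
  by (simp add: sym_op_def vec_eq_iff transpose_mat trace_E_basis_orthonormal) (simp add: mat_def)

lemma sym_op_inverse:
  fixes r :: "'r::finite itself" and M N :: "complex^'p::finite^'p"
  assumes NM: "N ** M = mat 1"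
  shows "sym_op r M M ** sym_op r N N = mat 1"
proof -
  have MNt: "transpose M ** transpose N = mat 1"
    by (simp add: NM flip: matrix_transpose_mul)
  have "(sym_op r M M ** sym_op r N N) $ u $ w
      = trace (N ** (M ** E_basis (Inl u :: 'p uprod + 'r) ** transpose M) ** transpose N ** E_basis (Inl w :: 'p uprod + 'r))" for u w
    by (rule sym_op_mult) (simp_all add: matrix_transpose_mul transpose_Z_part matrix_mul_assoc sym_op_def)
  also have "\<dots> u w = trace ((N ** M) ** E_basis (Inl u :: 'p uprod + 'r) ** (transpose M ** transpose N) ** E_basis (Inl w :: 'p uprod + 'r))" for u w
    by (simp add: matrix_mul_assoc)
  finally show ?thesis
    unfolding NM MNt by (simp add: vec_eq_iff trace_E_basis_orthonormal) (simp add: mat_def)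
qed

text \<open>The trace required by Jacobi's formula. With the inverse inserted, each of the two terms
  collapses to the sum of the squares of the basis matrices against \<open>N ** P\<close> or its
  transpose.\<close>

lemma trace_sym_op:
  fixes r :: "'r::finite itself" and M P N :: "complex^'p::finite^'p"
  assumes NM: "N ** M = mat 1"
  shows "trace ((sym_op r M P + sym_op r P M) ** sym_op r N N) = (of_nat CARD('p) + 1) * trace (P ** N)"
proof -
  let ?E = "\<lambda>u. E_basis (Inl u :: 'p uprod + 'r)"
  have MN: "transpose M ** transpose N = mat 1"
    by (simp add: NM flip: matrix_transpose_mul)
  have "((sym_op r M P + sym_op r P M) ** sym_op r N N) $ u $ u
      = trace (N ** (M ** ?E u ** transpose P + P ** ?E u ** transpose M) ** transpose N ** ?E u)" for u
    by (rule sym_op_mult)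
       (simp_all add: transpose_add matrix_transpose_mul transpose_Z_part matrix_mul_assoc sym_op_def
         matrix_mult_add_left trace_add add.commute)
  also have "\<dots> u = trace ((N ** M) ** ?E u ** transpose P ** transpose N ** ?E u)
      + trace (N ** P ** ?E u ** (transpose M ** transpose N) ** ?E u)" for u
    by (simp add: matrix_mult_add_left matrix_mult_add_right trace_add matrix_mul_assoc)
  also have "\<dots> u = trace (transpose (N ** P) ** (?E u ** ?E u)) + trace (N ** P ** (?E u ** ?E u))" for u
    unfolding NM MN using trace_mul_sym[of "?E u"]
    by (simp add: matrix_mul_assoc[symmetric] matrix_transpose_mul)
  finally have "trace ((sym_op r M P + sym_op r P M) ** sym_op r N N)
      = (\<Sum>u\<in>UNIV. trace (transpose (N ** P) ** (?E u ** ?E u)) + trace (N ** P ** (?E u ** ?E u)))"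
    unfolding trace_def[of "(sym_op r M P + sym_op r P M) ** sym_op r N N"] by simp
  also have "\<dots> = trace (transpose (N ** P) ** mat ((of_nat CARD('p) + 1) / 2)) + trace (N ** P ** mat ((of_nat CARD('p) + 1) / 2))"
    unfolding sum_E_basis_square[symmetric, where 'r = 'r] matrix_mult_sum_right trace_sum sum.distrib ..
  also have "\<dots> = (of_nat CARD('p) + 1) * trace (P ** N)"
  proof -
    have "trace (A ** mat c) = c * trace A" for A :: "complex^'p^'p" and c
      using trace_mat_mult[of c A] trace_mul_sym[of A "mat c"] by simp
    moreover have "trace (transpose (N ** P)) = trace (N ** P)" by (simp add: trace_def transpose_def)
    ultimately show ?thesis by (simp add: trace_mul_sym[of N] field_simps)
  qed
  finally show ?thesis .
qed

text \<open>For diagonal \<open>M\<close> the eigenvalues are the products m_k m_l with k \<le> l,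
  in which every m_k occurs p+1 times; the path argument yields this without
  diagonalization.\<close>

lemma det_sym_op:
  fixes r :: "'r::finite itself" and M :: "complex^'p::finite^'p"
  assumes M: "hermitian_pos_def M"
  shows "det (sym_op r M M) = det M ^ (CARD('p) + 1)"
proof -
  define N where "N t = (1 - t) *\<^sub>R mat 1 + t *\<^sub>R M" for t :: real
  define P where "P = M - mat 1"
  define c where "c t = (of_nat CARD('p) + 1) * trace (P ** matrix_inv (N t))" for t
  have Npd: "hermitian_pos_def (N t)" if "t \<in> {0..1}" for t
    unfolding N_def by (rule hermitian_pos_def_segment[OF M that])
  have inv: "matrix_inv (N t) ** N t = mat 1" if "t \<in> {0..1}" for t
    using matrix_inv_mult hermitian_pos_def_det_nonzero Npd that by blast
  have Nd: "(N has_vector_derivative P) (at t within {0..1})" for t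
    unfolding N_def P_def by (rule has_vector_derivative_segment)
  have "det (sym_op r (N 1) (N 1)) = det (N 1) ^ (CARD('p) + 1)"
  proof (rule linear_ode_eq[where c = c and f = "\<lambda>t. det (sym_op r (N t) (N t))" and g = "\<lambda>t. det (N t) ^ (CARD('p) + 1)"])
    fix t :: real assume t: "t \<in> {0..1}"
    have i: "sym_op r (matrix_inv (N t)) (matrix_inv (N t)) ** sym_op r (N t) (N t) = mat 1"
      using inv[OF t] by (intro sym_op_inverse) (simp add: matrix_left_right_inverse)
    have "((\<lambda>t. sym_op r (N t) (N t)) has_vector_derivative sym_op r (N t) P + sym_op r P (N t)) (at t within {0..1})"
      by (rule bounded_bilinear.has_vector_derivative[OF bounded_bilinear_sym_op Nd Nd])
    from det_path_derivative[OF this i]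
    show "((\<lambda>t. det (sym_op r (N t) (N t))) has_vector_derivative det (sym_op r (N t) (N t)) * c t) (at t within {0..1})"
      unfolding c_def trace_sym_op[OF inv[OF t]] .
    have "((\<lambda>t. det (N t)) has_derivative (\<lambda>h. h *\<^sub>R (det (N t) * trace (P ** matrix_inv (N t))))) (at t within {0..1})"
      using det_path_derivative[OF Nd inv[OF t]] by (simp add: has_vector_derivative_def)
    from has_derivative_power[OF this, of "CARD('p) + 1"]
    show "((\<lambda>t. det (N t) ^ (CARD('p) + 1)) has_vector_derivative det (N t) ^ (CARD('p) + 1) * c t) (at t within {0..1})"
      unfolding has_vector_derivative_def
      by (rule has_derivative_eq_rhs) (simp add: c_def fun_eq_iff scaleR_conv_of_real algebra_simps)
    show "det (N t) ^ (CARD('p) + 1) \<noteq> 0"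
      using hermitian_pos_def_det_nonzero[OF Npd[OF t]] by simp
  qed (simp add: N_def sym_op_mat_1)
  then show ?thesis by (simp add: N_def)
qed

section \<open>The potential of the symmetric domain\<close>

text \<open>The points where positivity fails form the projection of a closed set along the compact
  unit sphere, hence a closed set.\<close>

lemma open_hermitian_pos_def:
  fixes G :: "'a::euclidean_space \<Rightarrow> complex^'n^'n"
  assumes G: "\<And>i j. continuous_on UNIV (\<lambda>x. G x $ i $ j)" and h: "\<And>x. herm (G x)"
  shows "open {x. hermitian_pos_def (G x)}"
proof -
  define T where "T = {p :: (complex^'n) \<times> 'a. Re (hform (G (snd p)) (fst p)) \<le> 0}"
  have c: "continuous_on UNIV (\<lambda>p :: (complex^'n) \<times> 'a. Re (hform (G (snd p)) (fst p)))"
    unfolding hform_def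
    by (intro continuous_intros continuous_on_compose2[OF G continuous_on_snd]) auto
  have "closed T" unfolding T_def by (intro closed_Collect_le c continuous_intros)
  then have "closed (sphere 0 1 \<times> UNIV \<inter> T)" by (intro closed_Int closed_Times) auto
  then have "closed {x. \<exists>v. v \<in> sphere 0 1 \<and> (v, x) \<in> sphere 0 1 \<times> UNIV \<inter> T}"
    by (rule closed_compact_projection[OF compact_sphere])
  moreover have "- {x. hermitian_pos_def (G x)} = {x. \<exists>v. v \<in> sphere 0 1 \<and> (v, x) \<in> sphere 0 1 \<times> UNIV \<inter> T}"
  proof (intro equalityI subsetI)
    fix x assume "x \<in> - {x. hermitian_pos_def (G x)}"
    then obtain v where v: "v \<noteq> 0" "Re (hform (G x) v) \<le> 0"
      using h by (auto simp: hermitian_pos_def_iff not_less)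
    have "Re (hform (G x) (inverse (norm v) *\<^sub>R v)) \<le> 0"
      unfolding hform_scaleR_vector using v by (simp add: mult_nonneg_nonpos)
    then have "inverse (norm v) *\<^sub>R v \<in> sphere 0 1 \<and> (inverse (norm v) *\<^sub>R v, x) \<in> sphere 0 1 \<times> UNIV \<inter> T"
      using v by (simp add: T_def)
    then show "x \<in> {x. \<exists>v. v \<in> sphere 0 1 \<and> (v, x) \<in> sphere 0 1 \<times> UNIV \<inter> T}" by blast
  next
    fix x assume "x \<in> {x. \<exists>v. v \<in> sphere 0 1 \<and> (v, x) \<in> sphere 0 1 \<times> UNIV \<inter> T}"
    then obtain v where "norm v = 1" "Re (hform (G x) v) \<le> 0" by (auto simp: T_def)
    then show "x \<in> - {x. hermitian_pos_def (G x)}"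
      by (auto simp: hermitian_pos_def_iff not_less intro!: exI[of _ v])
  qed
  ultimately show ?thesis by (simp add: open_closed)
qed

abbreviation cZ_part :: "complex^('p::finite uprod + 'r::finite) \<Rightarrow> complex^'p^'p" where
  "cZ_part x \<equiv> map_matrix cnj (Z_part x)"

definition gram :: "complex^('p::finite uprod + 'r::finite) \<Rightarrow> complex^'p^'p" where
  "gram x = mat 1 - Z_part x ** cZ_part x"

text \<open>The cylinder over the symmetric domain, with w unrestricted; the symmetry of Z is built
  into the coordinates.\<close>

definition domain_II :: "(complex^('p::finite uprod + 'r::finite)) set" where
  "domain_II = {x. hermitian_pos_def (gram x)}"

lemma transpose_cZ_part: "transpose (cZ_part x) = cZ_part x"
  using transpose_Z_part[of x] by (simp add: vec_eq_iff transpose_def)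

lemma map_cnj_diff: "map_matrix cnj (A - B) = map_matrix cnj A - map_matrix cnj B"
  by (simp add: vec_eq_iff)

lemma map_cnj_cnj: "map_matrix cnj (map_matrix cnj A) = A"
  by (simp add: vec_eq_iff)

lemma transpose_gram: "transpose (gram x) = mat 1 - cZ_part x ** Z_part x"
  by (simp add: gram_def transpose_diff transpose_mat matrix_transpose_mul transpose_Z_part transpose_cZ_part)

lemma herm_gram: "herm (gram x)"
  unfolding herm_iff transpose_gram
  by (simp add: gram_def map_cnj_diff map_matrix_cnj_mat_1 map_matrix_cnj_mult map_cnj_cnj)

lemma smooth_on_Z_part:
  "open S \<Longrightarrow> smooth_on (\<lambda>x. Z_part x $ k $ l) S"
  "open S \<Longrightarrow> smooth_on (\<lambda>x. cZ_part x $ k $ l) S"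
  by (intro smooth_on_linear bounded_linear_compose[OF bounded_linear_vec_nth]
       bounded_linear_compose[OF bounded_linear_vec_nth] bounded_linear_Z_part
       bounded_linear_compose[OF bounded_linear_cnj_matrix]; assumption)+

lemma smooth_on_gram: "open S \<Longrightarrow> smooth_on (\<lambda>x. gram x $ k $ l) S"
  unfolding gram_def vector_minus_component matrix_matrix_mult_def vec_lambda_beta
  by (intro smooth_on_diff smooth_on_const smooth_on_sum smooth_on_mult smooth_on_Z_part)

lemma continuous_on_gram: "continuous_on S (\<lambda>x. gram x $ k $ l)"
  using smooth_on_continuous_on[OF smooth_on_gram[OF open_UNIV]] continuous_on_subset by blast

lemma open_domain_II: "open domain_II"
  unfolding domain_II_def by (intro open_hermitian_pos_def continuous_on_gram herm_gram)

lemma det_II_gram: "det_II (Z_part x) = Re (det (gram x))"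
  by (simp add: det_II_def gram_def)

lemma smooth_on_det_II: "open S \<Longrightarrow> smooth_on (\<lambda>x. det_II (Z_part x)) S"
  unfolding det_II_gram det_def
  by (intro smooth_on_linear_compose[OF bounded_linear_Re] smooth_on_sum smooth_on_mult smooth_on_const
      smooth_on_prod smooth_on_gram)

lemma det_II_pos: "x \<in> domain_II \<Longrightarrow> 0 < det_II (Z_part x)"
  unfolding det_II_gram domain_II_def using hermitian_pos_def_det_pos by blast

lemma gram_inverse:
  assumes "x \<in> domain_II"
  shows "gram x ** matrix_inv (gram x) = mat 1" "matrix_inv (gram x) ** gram x = mat 1"
    "hermitian_pos_def (matrix_inv (gram x))"
proof -
  have p: "hermitian_pos_def (gram x)" using assms by (simp add: domain_II_def)
  note d = hermitian_pos_def_det_nonzero[OF p]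
  show i: "gram x ** matrix_inv (gram x) = mat 1" "matrix_inv (gram x) ** gram x = mat 1"
    using matrix_inv_mult[OF d] by auto
  show "hermitian_pos_def (matrix_inv (gram x))" by (rule hermitian_pos_def_inverse[OF p i(1)])
qed

lemma transpose_gram_inverse:
  assumes "x \<in> domain_II"
  defines "M \<equiv> matrix_inv (gram x)"
  shows "transpose M ** transpose (gram x) = mat 1" "transpose (gram x) ** transpose M = mat 1"
    "transpose M = map_matrix cnj M"
  using gram_inverse[OF assms(1)] unfolding M_def
  by (simp_all add: hermitian_pos_def_iff herm_iff flip: matrix_transpose_mul)

text \<open>The identity (I - C Z)^-1 = I + C (I - Z C)^-1 Z, with C the conjugate of Z. It
  simplifies the derivative of M Z and shows that the transpose of \<open>M\<close> dominates the
  identity.\<close>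

lemma transpose_gram_inverse_eq:
  assumes x: "x \<in> domain_II"
  defines "M \<equiv> matrix_inv (gram x)"
  shows "transpose M = mat 1 + cZ_part x ** M ** Z_part x"
proof -
  let ?Z = "Z_part x" and ?C = "cZ_part x"
  have "(mat 1 - ?C ** ?Z) ** (mat 1 + ?C ** M ** ?Z)
      = mat 1 + ?C ** M ** ?Z - (?C ** ?Z + ?C ** (?Z ** ?C ** M) ** ?Z)"
    by (simp add: matrix_mult_diff_left matrix_mult_add_right matrix_mul_assoc)
  also have "?Z ** ?C ** M = M - mat 1"
    using gram_inverse(1)[OF x] unfolding M_def by (simp add: gram_def matrix_mult_diff_left algebra_simps)
  finally have "transpose (gram x) ** (mat 1 + ?C ** M ** ?Z) = mat 1"
    unfolding transpose_gram by (simp add: matrix_mult_diff_left matrix_mult_diff_right)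
  then have "transpose M ** (transpose (gram x) ** (mat 1 + ?C ** M ** ?Z)) = transpose M" by simp
  then show ?thesis using transpose_gram_inverse(1)[OF x] unfolding M_def[symmetric] by (simp add: matrix_mul_assoc)
qed

lemma has_derivative_gram:
  "(gram has_derivative (\<lambda>v. - (Z_part x ** cZ_part v + Z_part v ** cZ_part x))) (at x)"
proof -
  have "((\<lambda>x. mat 1 - Z_part x ** cZ_part x) has_derivative
      (\<lambda>v. 0 - (Z_part x ** cZ_part v + Z_part v ** cZ_part x))) (at x)"
    by (intro has_derivative_diff has_derivative_const has_derivative_matrix_mult
        bounded_linear_imp_has_derivative bounded_linear_Z_part
        bounded_linear_compose[OF bounded_linear_cnj_matrix bounded_linear_Z_part])
  then show ?thesis by (simp add: gram_def[abs_def])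
qed

text \<open>The function a is this divided by K; leaving \<open>K\<close> out keeps a potential of
  the symmetric domain alone.\<close>

definition pot :: "complex^('p::finite uprod + 'r::finite) \<Rightarrow> real" where
  "pot x = - ln (det_II (Z_part x))"

lemma smooth_on_pot: "smooth_on pot domain_II"
  unfolding pot_def[abs_def]
  by (intro smooth_on_minus smooth_on_ln smooth_on_det_II open_domain_II det_II_pos)

lemma trace_cnj: "trace (map_matrix cnj A) = cnj (trace A)"
  by (simp add: trace_def)

lemma trace_transpose: "trace (transpose A) = trace A"
  by (simp add: trace_def transpose_def)

text \<open>Jacobi's formula gives two traces, conjugate to each other by transposition and the
  symmetry of Z. Written as a conjugate pair, they let the Wirtinger derivatives be read
  off.\<close>

lemma has_derivative_pot:
  fixes x :: "complex^('p::finite uprod + 'r::finite)"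
  assumes x: "x \<in> domain_II"
  defines "M \<equiv> matrix_inv (gram x)"
  shows "((\<lambda>x. complex_of_real (pot x)) has_derivative
     (\<lambda>v. trace (M ** Z_part x ** cZ_part v) + cnj (trace (M ** Z_part x ** cZ_part v)))) (at x)"
proof -
  let ?d = "\<lambda>v. - (Z_part x ** cZ_part v + Z_part v ** cZ_part x)"
  have pd: "hermitian_pos_def (gram x)" using x by (simp add: domain_II_def)
  note inv = gram_inverse[OF x, folded M_def]
  have "((\<lambda>x. det (gram x)) has_derivative (\<lambda>v. det (gram x) * trace (?d v ** M))) (at x)"
    by (rule has_derivative_compose[OF has_derivative_gram has_derivative_det[OF inv(2)]])
  then have "((\<lambda>x. Re (det (gram x))) has_derivative (\<lambda>v. Re (det (gram x) * trace (?d v ** M)))) (at x)"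
    by (rule bounded_linear.has_derivative[OF bounded_linear_Re])
  moreover have "Re (det (gram x) * trace (?d v ** M)) = Re (det (gram x)) * Re (trace (?d v ** M))" for v :: "complex^('p uprod + 'r)"
    by (subst hermitian_pos_def_det_eq[OF pd]) simp
  ultimately have "((\<lambda>x. det_II (Z_part x)) has_derivative (\<lambda>v. det_II (Z_part x) * Re (trace (?d v ** M)))) (at x)"
    unfolding det_II_gram by (simp only:)
  then have "(pot has_derivative (\<lambda>v. - Re (trace (?d v ** M)))) (at x)"
    unfolding pot_def[abs_def] using det_II_pos[OF x]
    by (auto intro!: derivative_eq_intros simp: field_simps)
  then have D: "((\<lambda>x. complex_of_real (pot x)) has_derivative (\<lambda>v. complex_of_real (- Re (trace (?d v ** M))))) (at x)"
    by (rule has_derivative_of_real)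
  have "complex_of_real (- Re (trace (?d v ** M))) = trace (M ** Z_part x ** cZ_part v) + cnj (trace (M ** Z_part x ** cZ_part v))" for v :: "complex^('p uprod + 'r)"
  proof -
    have 1: "trace (Z_part x ** cZ_part v ** M) = trace (M ** Z_part x ** cZ_part v)"
      using trace_mul_sym[of M "Z_part x ** cZ_part v"] by (simp add: matrix_mul_assoc)
    have "cnj (trace (M ** Z_part x ** cZ_part v)) = trace (transpose M ** cZ_part x ** Z_part v)"
      using transpose_gram_inverse(3)[OF x, folded M_def]
      by (simp add: map_matrix_cnj_mult map_cnj_cnj flip: trace_cnj)
    also have "\<dots> = trace (transpose (transpose M ** cZ_part x ** Z_part v))" by (simp add: trace_transpose)
    also have "\<dots> = trace (Z_part v ** cZ_part x ** M)"
      by (simp add: matrix_transpose_mul transpose_Z_part transpose_cZ_part matrix_mul_assoc)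
    finally have 2: "trace (Z_part v ** cZ_part x ** M) = cnj (trace (M ** Z_part x ** cZ_part v))" by simp
    have "- trace (?d v ** M) = trace (M ** Z_part x ** cZ_part v) + cnj (trace (M ** Z_part x ** cZ_part v))"
      by (simp add: matrix_mult_minus_left matrix_mult_diff_left matrix_mult_add_left trace_minus trace_sub trace_add 1 2)
    then have "- Re (trace (?d v ** M)) = Re (trace (M ** Z_part x ** cZ_part v) + cnj (trace (M ** Z_part x ** cZ_part v)))"
      by (metis uminus_complex.sel(1))
    then show ?thesis by (simp add: complex_eq_iff)
  qed
  then show ?thesis using D by (simp only:)
qed

lemma Z_part_axis_ii: "Z_part (axis i \<i>) = mat \<i> ** E_basis i"
  by (simp add: axis_ii Z_part_scale)

lemmas Z_part_axis = Z_part_axis_ii cnj_mat_mult cnj_E_basis complex_cnj_i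

lemma wirtinger_bar_pot:
  assumes x: "x \<in> domain_II"
  shows "wirtinger_bar j (\<lambda>x. complex_of_real (pot x)) x = trace (matrix_inv (gram x) ** Z_part x ** E_basis j)"
  unfolding wirtinger_has_derivative(2)[OF has_derivative_pot[OF x]] Z_part_axis mat_mult_commute trace_mat_mult
  by (simp add: algebra_simps)

text \<open>The part of the derivative of M Z that is complex linear in the direction V is M V M^T;
  the conjugate linear part cancels in the Wirtinger combination.\<close>

lemma complex_hessian_pot:
  assumes x: "x \<in> domain_II"
  defines "M \<equiv> matrix_inv (gram x)"
  shows "complex_hessian pot x $ i $ j = trace (M ** E_basis i ** transpose M ** E_basis j)"
proof -
  note inv = gram_inverse[OF x, folded M_def]
  have "det (gram x) \<noteq> 0" using x hermitian_pos_def_det_nonzero by (auto simp: domain_II_def)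
  let ?Z = "Z_part x" and ?C = "cZ_part x"
  have "((\<lambda>x. matrix_inv (gram x)) has_derivative (\<lambda>v. - (M ** (- (?Z ** cZ_part v + Z_part v ** ?C)) ** M))) (at x)"
    unfolding M_def by (rule has_derivative_compose[OF has_derivative_gram has_derivative_matrix_inv]) fact
  then have "((\<lambda>x. matrix_inv (gram x) ** Z_part x) has_derivative
     (\<lambda>v. M ** Z_part v + (- (M ** (- (?Z ** cZ_part v + Z_part v ** ?C)) ** M)) ** ?Z)) (at x)"
    unfolding M_def
    by (intro has_derivative_matrix_mult bounded_linear_imp_has_derivative[OF bounded_linear_Z_part])
  \<comment> \<open>The terms in V combine to M V (I + C M Z), with C the conjugate of Z, and the
    bracket is \<open>transpose M\<close>.\<close>
  moreover have "M ** V + (- (M ** (- (?Z ** W + V ** ?C)) ** M)) ** ?Z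
      = M ** V ** transpose M + M ** ?Z ** W ** M ** ?Z" for V W
    unfolding transpose_gram_inverse_eq[OF x, folded M_def]
    by (simp add: matrix_mult_add_left matrix_mult_diff_left matrix_mult_diff_right matrix_mult_add_right
        matrix_mult_minus_left matrix_mult_minus_right matrix_mul_assoc)
  ultimately have "((\<lambda>x. matrix_inv (gram x) ** Z_part x) has_derivative
     (\<lambda>v. M ** Z_part v ** transpose M + M ** ?Z ** cZ_part v ** M ** ?Z)) (at x)"
    by (simp only:)
  then have "((\<lambda>x. matrix_inv (gram x) ** Z_part x ** E_basis j) has_derivative
     (\<lambda>v. (M ** ?Z) ** 0 + (M ** Z_part v ** transpose M + M ** ?Z ** cZ_part v ** M ** ?Z) ** E_basis j)) (at x)"
    unfolding M_def by (intro has_derivative_matrix_mult has_derivative_const)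
  from bounded_linear.has_derivative[OF bounded_linear_trace this]
  have D: "((\<lambda>x. trace (matrix_inv (gram x) ** Z_part x ** E_basis j)) has_derivative
     (\<lambda>v. trace ((M ** ?Z) ** 0 + (M ** Z_part v ** transpose M + M ** ?Z ** cZ_part v ** M ** ?Z) ** E_basis j))) (at x)" .
  have s1: "M ** (mat c ** E) ** N ** E' = mat c ** (M ** E ** N ** E')" for c E E' and N :: "complex^'a^'a"
    by (simp add: mat_mult_commute matrix_mul_assoc[symmetric])
  have s2: "M ** ?Z ** (mat c ** E) ** M ** ?Z ** E' = mat c ** (M ** ?Z ** E ** M ** ?Z ** E')" for c E E'
    by (simp add: mat_mult_commute matrix_mul_assoc[symmetric])
  have "wirtinger i (wirtinger_bar j (\<lambda>x. complex_of_real (pot x))) x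
      = wirtinger i (\<lambda>x. trace (matrix_inv (gram x) ** Z_part x ** E_basis j)) x"
    by (rule wirtinger_cong_open(1)[OF open_domain_II x wirtinger_bar_pot])
  also have "\<dots> = trace (M ** E_basis i ** transpose M ** E_basis j)"
    unfolding wirtinger_has_derivative(1)[OF D] Z_part_axis
    by (simp add: matrix_mult_add_left trace_add s1 s2 trace_mat_mult algebra_simps)
  finally show ?thesis by (simp add: complex_hessian_def)
qed

lemma psd_mat_1: "psd (mat 1)"
  by (rule hermitian_pos_def_imp_psd[OF hermitian_pos_def_mat_1])

lemma trace_mult_cadj: "trace (V ** cadj V) = complex_of_real (\<Sum>k\<in>UNIV. \<Sum>l\<in>UNIV. (norm (V $ k $ l))\<^sup>2)"
  by (simp add: trace_def matrix_matrix_mult_def cadj_def transpose_def complex_norm_square del: of_real_power)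

lemma Re_hform_pot:
  assumes x: "x \<in> domain_II"
  defines "M \<equiv> matrix_inv (gram x)"
  shows "hform (complex_hessian pot x) v = trace (M ** Z_part v ** transpose M ** cadj (Z_part v))"
proof -
  have "complex_hessian pot x = (\<chi> i j. trace (M ** E_basis i ** transpose M ** E_basis j))"
    using complex_hessian_pot[OF x] by (simp add: vec_eq_iff M_def)
  then show ?thesis by (simp add: hform_trace_form cadj_Z_part)
qed

text \<open>Both \<open>M\<close> and its transpose dominate the identity, and the trace does not
  increase when each in turn is replaced by the identity.\<close>

lemma Re_hform_pot_ge:
  assumes x: "x \<in> domain_II"
  shows "(\<Sum>k\<in>UNIV. \<Sum>l\<in>UNIV. (norm (Z_part v $ k $ l))\<^sup>2) \<le> Re (hform (complex_hessian pot x) v)"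
proof -
  define M where "M = matrix_inv (gram x)"
  let ?Z = "Z_part x" and ?V = "Z_part v"
  note T = transpose_gram_inverse_eq[OF x, folded M_def]
  have pM: "psd M" unfolding M_def by (rule hermitian_pos_def_imp_psd[OF gram_inverse(3)[OF x]])
  have 1: "psd (transpose M - mat 1)"
  proof -
    have "transpose M - mat 1 = cZ_part x ** M ** cadj (cZ_part x)"
      unfolding T by (simp add: cadj_def transpose_cZ_part map_cnj_cnj)
    then show ?thesis using psd_congruence[OF pM] by simp
  qed
  have 2: "psd (M - mat 1)" using psd_transpose[OF 1] by (simp add: transpose_diff transpose_mat)
  have "trace (M ** ?V ** transpose M ** cadj ?V) = trace ((M - mat 1) ** ?V ** transpose M ** cadj ?V)
      + trace (mat 1 ** ?V ** (transpose M - mat 1) ** cadj ?V) + trace (?V ** cadj ?V)"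
    by (simp add: matrix_mult_diff_left matrix_mult_diff_right trace_sub)
  then have "Re (hform (complex_hessian pot x) v) = Re (trace ((M - mat 1) ** ?V ** transpose M ** cadj ?V))
      + Re (trace (mat 1 ** ?V ** (transpose M - mat 1) ** cadj ?V)) + Re (trace (?V ** cadj ?V))"
    unfolding Re_hform_pot[OF x] M_def[symmetric] by simp
  moreover have "0 \<le> Re (trace ((M - mat 1) ** ?V ** transpose M ** cadj ?V))"
    by (intro trace_congruence_nonneg 2 psd_transpose pM)
  moreover have "0 \<le> Re (trace (mat 1 ** ?V ** (transpose M - mat 1) ** cadj ?V))"
    by (intro trace_congruence_nonneg 1 psd_mat_1)
  ultimately show ?thesis unfolding trace_mult_cadj by simp
qed

lemma cadj_mult: "cadj (A ** B) = cadj B ** cadj (A :: complex^'n^'m)"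
  by (simp add: cadj_def matrix_transpose_mul map_matrix_cnj_mult)

lemma cadj_cadj: "cadj (cadj A) = A"
  by (simp add: cadj_def vec_eq_iff transpose_def)

lemma trace_cadj: "trace (cadj A) = cnj (trace A)"
  by (simp add: cadj_def trace_cnj trace_transpose)

lemma domain_II_trace_le:
  fixes x :: "complex^('p::finite uprod + 'r::finite)"
  assumes x: "x \<in> domain_II"
  shows "Re (trace (Z_part x ** cZ_part x)) \<le> real CARD('p)"
proof -
  have "psd (gram x)" using x by (auto simp: domain_II_def intro: hermitian_pos_def_imp_psd)
  then have "0 \<le> Re (gram x $ k $ k)" for k by (rule psd_diag_nonneg)
  then have "0 \<le> Re (trace (gram x))" by (simp add: trace_def sum_nonneg)
  then show ?thesis by (simp add: gram_def trace_sub trace_I)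
qed

text \<open>Cauchy-Schwarz for the form \<open>tr (M V M\<^sup>T W\<^sup>*)\<close>, with the gradient represented by \<open>W = Z (gram x)\<^sup>T\<close>.\<close>

lemma norm_wirtinger_pot_le:
  fixes x :: "complex^('p::finite uprod + 'r::finite)"
  assumes x: "x \<in> domain_II"
  shows "(norm (trace (matrix_inv (gram x) ** Z_part x ** cZ_part v)))\<^sup>2
    \<le> real CARD('p) * Re (hform (complex_hessian pot x) v)"
proof -
  define M where "M = matrix_inv (gram x)"
  define B where "B U V = trace (M ** U ** transpose M ** cadj V)" for U V :: "complex^'p^'p"
  let ?V = "Z_part v" and ?Z = "Z_part x" and ?p = "real CARD('p)"
  define W where "W = Z_part x ** transpose (gram x)"
  note inv = gram_inverse[OF x, folded M_def] and tinv = transpose_gram_inverse[OF x, folded M_def]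
  have cM: "cadj M = M" using tinv(3) by (simp add: cadj_def map_cnj_cnj)
  have ctM: "cadj (transpose M) = transpose M"
    unfolding cadj_def transpose_transpose by (rule tinv(3)[symmetric])
  have cgram: "map_matrix cnj (gram x) = transpose (gram x)" using herm_gram[of x] by (simp add: herm_iff)
  have cW: "cadj W = transpose (gram x) ** cZ_part x"
    unfolding W_def cadj_mult cadj_Z_part by (simp add: cadj_def cgram)
  define s where "s = trace (M ** ?Z ** cZ_part v)"
  \<comment> \<open>Pairing with \<open>W\<close> is the differential: the factor
    \<open>transpose (gram x)\<close> in \<open>W\<close> cancels
    \<open>transpose M\<close>.\<close>
  have BWV: "B W ?V = s"
  proof -
    have "M ** W ** transpose M ** cadj ?V = M ** ?Z ** (transpose (gram x) ** transpose M) ** cadj ?V"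
      by (simp add: W_def matrix_mul_assoc)
    then show ?thesis by (simp add: B_def tinv(2) s_def cadj_Z_part)
  qed
  have BVW: "B ?V W = cnj s"
  proof -
    have "B ?V W = trace (M ** (?V ** transpose M ** cadj W))" by (simp add: B_def matrix_mul_assoc)
    also have "\<dots> = trace (?V ** transpose M ** cadj W ** M)" by (rule trace_mul_sym)
    also have "\<dots> = trace (cadj (M ** W ** transpose M ** cadj ?V))"
      by (simp add: cadj_mult cadj_cadj cM ctM matrix_mul_assoc)
    also have "\<dots> = cnj (B W ?V)" by (simp add: trace_cadj B_def)
    finally show ?thesis by (simp add: BWV)
  qed
  \<comment> \<open>The squared length of the gradient reduces to tr(Z Z-bar), because Z commutes
    past the Gram matrix up to transposition of the latter.\<close>
  have BWW: "B W W = trace (?Z ** cZ_part x)"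
  proof -
    have "M ** W ** transpose M ** cadj W = M ** ?Z ** (transpose (gram x) ** transpose M) ** transpose (gram x) ** cZ_part x"
      unfolding cW by (simp add: W_def matrix_mul_assoc)
    also have "\<dots> = M ** ?Z ** transpose (gram x) ** cZ_part x" by (simp add: tinv(2))
    also have "\<dots> = M ** (gram x ** (?Z ** cZ_part x))"
      unfolding transpose_gram by (simp add: gram_def matrix_mult_diff_left matrix_mult_diff_right matrix_mul_assoc)
    also have "\<dots> = ?Z ** cZ_part x" by (simp add: matrix_mul_assoc inv)
    finally show ?thesis by (simp add: B_def)
  qed
  \<comment> \<open>The coefficient of the projection to \<open>W\<close>, with the bound
    \<open>?p\<close> in place of the squared length \<open>B W W\<close>, so that the division is
    safe even for zero \<open>W\<close>.\<close>
  define c where "c = cnj s / of_real ?p"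
  have p: "?p > 0" by (simp add: card_gt_0_iff)
  have expand: "B (?V - mat c ** W) (?V - mat c ** W) = B ?V ?V - c * B W ?V - cnj c * B ?V W + c * cnj c * B W W"
  proof -
    have m: "A ** (mat d ** C) = mat d ** (A ** C)" "(mat d ** A) ** C = mat d ** (A ** C)" for d and A C :: "complex^'p^'p"
      by (rule mat_mult_commute) (rule matrix_mul_assoc[symmetric])
    have ca: "cadj (?V - mat c ** W) = cadj ?V - mat (cnj c) ** cadj W"
      by (simp add: cadj_def transpose_def vec_eq_iff mat_mult_component)
    have e1: "M ** (mat c ** W) ** transpose M ** X = mat c ** (M ** W ** transpose M ** X)" for X :: "complex^'p^'p"
      unfolding m(1)[of M] m(2) ..
    have e2: "Y ** (mat d ** X) = mat d ** (Y ** X)" for d and X Y :: "complex^'p^'p" by (rule mat_mult_commute)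
    show ?thesis
      unfolding B_def ca matrix_mult_diff_left matrix_mult_diff_right e1 e2[of "_ ** transpose M"]
      by (simp only: trace_sub trace_mat_mult e2[of "mat c ** _"]) (simp add: algebra_simps)
  qed
  have "0 \<le> Re (B (?V - mat c ** W) (?V - mat c ** W))"
    unfolding B_def by (intro trace_congruence_nonneg psd_transpose hermitian_pos_def_imp_psd inv)
  moreover have "c * s = complex_of_real ((norm s)\<^sup>2 / ?p)"
    unfolding c_def of_real_divide complex_norm_square by simp
  moreover have "cnj c * cnj s = complex_of_real ((norm s)\<^sup>2 / ?p)"
    unfolding c_def of_real_divide complex_norm_square by simp
  moreover have "c * cnj c = complex_of_real ((norm s)\<^sup>2 / ?p\<^sup>2)"
    unfolding c_def of_real_divide complex_norm_square by (simp add: power2_eq_square)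
  ultimately have "0 \<le> Re (B ?V ?V) - (norm s)\<^sup>2 / ?p - (norm s)\<^sup>2 / ?p + (norm s)\<^sup>2 / ?p\<^sup>2 * Re (B W W)"
    unfolding expand BWV BVW by simp
  also have "(norm s)\<^sup>2 / ?p\<^sup>2 * Re (B W W) \<le> (norm s)\<^sup>2 / ?p\<^sup>2 * ?p"
    unfolding BWW by (intro mult_left_mono domain_II_trace_le x) simp
  also have "(norm s)\<^sup>2 / ?p\<^sup>2 * ?p = (norm s)\<^sup>2 / ?p" using p by (simp add: power2_eq_square)
  finally have "(norm s)\<^sup>2 \<le> ?p * Re (B ?V ?V)" using p by (simp add: field_simps)
  then show ?thesis by (simp add: Re_hform_pot[OF x] s_def M_def B_def)
qed

section \<open>Geometry of the domain\<close>

text \<open>A vector on which a semidefinite form vanishes lies in the kernel, as variation in the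
  coordinate directions shows. Limits of points of the domain are at first only semidefinite; this
  recovers definiteness.\<close>

lemma psd_det_nonzero_imp_pos_def:
  assumes A: "psd A" and d: "det A \<noteq> 0"
  shows "hermitian_pos_def A"
proof -
  have h: "herm A" and p: "\<And>v. 0 \<le> Re (hform A v)" using A by (auto simp: psd_def)
  have "Re (hform A v) \<noteq> 0" if v: "v \<noteq> 0" for v
  proof
    assume z: "Re (hform A v) = 0"
    have "(\<Sum>k\<in>UNIV. A $ k $ i * v $ k) = 0" for i
    proof (rule ccontr)
      define s where "s = (\<Sum>k\<in>UNIV. A $ k $ i * v $ k)"
      assume "(\<Sum>k\<in>UNIV. A $ k $ i * v $ k) \<noteq> 0"
      then have s: "(norm s)\<^sup>2 > 0" by (simp add: s_def)
      define q where "q = Re (A $ i $ i)"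
      have q: "q \<ge> 0" unfolding q_def by (rule psd_diag_nonneg[OF A])
      \<comment> \<open>Keeps t q \<le> 1, so that the quadratic term cannot outweigh the linear
        decrease.\<close>
      define t where "t = 1 / (q + 1)"
      have t: "t > 0" "t * q \<le> 1" using q by (auto simp: t_def field_simps)
      have "cnj (- (complex_of_real t * s)) * s = complex_of_real (- t * (norm s)\<^sup>2)"
      proof -
        have "cnj (- (complex_of_real t * s)) * s = - complex_of_real t * (s * cnj s)" by simp
        then show ?thesis by (simp only: complex_norm_square of_real_minus of_real_mult)
      qed
      then have R: "Re (cnj (- (complex_of_real t * s)) * s) = - t * (norm s)\<^sup>2"
        by (simp only: Re_complex_of_real)
      have nt: "norm (- (complex_of_real t * s)) = t * norm s" using t by (simp add: norm_mult)
      have "0 \<le> 2 * (- t * (norm s)\<^sup>2) + (t * norm s)\<^sup>2 * q"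
        using p[of "v + (- (complex_of_real t * s)) *s axis i 1"]
        unfolding hform_add_axis[OF h] z s_def[symmetric] q_def[symmetric] R nt by linarith
      also have "\<dots> = t * (norm s)\<^sup>2 * (t * q - 2)" by (simp add: power2_eq_square algebra_simps)
      also have "\<dots> < 0" using s t by (intro mult_pos_neg) auto
      finally show False by simp
    qed
    then have "transpose A *v v = 0"
      by (simp add: vec_eq_iff matrix_vector_mult_def transpose_def)
    then have "\<not> invertible (transpose A)"
      using v matrix_left_invertible_ker[of "transpose A"] invertible_left_inverse[of "transpose A"] by blast
    then show False using d by (simp add: invertible_det_nz det_transpose)
  qed
  then show ?thesis using h p by (simp add: hermitian_pos_def_iff order_less_le)
qed

text \<open>For t in [0,1] a convex combination with \<open>mat 1\<close>, so that a semidefinite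
  Gram matrix becomes definite once t < 1.\<close>

lemma gram_dilation: "gram (t *\<^sub>R x) = (1 - t\<^sup>2) *\<^sub>R mat 1 + t\<^sup>2 *\<^sub>R gram x"
proof -
  have "Z_part (t *\<^sub>R x) = t *\<^sub>R Z_part x" by (rule linear.scaleR[OF Z_part_linear])
  moreover from this have "cZ_part (t *\<^sub>R x) = t *\<^sub>R cZ_part x"
    by (simp add: linear.scaleR[OF bounded_linear.linear[OF bounded_linear_cnj_matrix]])
  ultimately show ?thesis
    by (simp add: gram_def matrix_mult_scaleR_left matrix_mult_scaleR_right algebra_simps power2_eq_square)
qed

lemma psd_mat_1_diff_gram: "psd (mat 1 - gram x)"
proof -
  have "mat 1 - gram x = Z_part x ** mat 1 ** cadj (Z_part x)"
    by (simp add: gram_def cadj_Z_part)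
  then show ?thesis using psd_congruence[OF psd_mat_1] by metis
qed

lemma psd_gram_det_nonneg: assumes "psd (gram x)" shows "0 \<le> det_II (Z_part x)"
proof (cases "det (gram x) = 0")
  case False
  then show ?thesis
    using hermitian_pos_def_det_pos[OF psd_det_nonzero_imp_pos_def[OF assms]] by (simp add: det_II_gram)
qed (simp add: det_II_gram)

lemma det_II_eq_0_iff: "det_II (Z_part x) = 0 \<longleftrightarrow> det (gram x) = 0"
  using det_hermitian_real[OF herm_gram, of x] by (auto simp: det_II_gram complex_eq_iff)

text \<open>The difference of the Gram matrices is (1 - t^2) Z Z-bar, which is semidefinite.
  Monotonicity of the determinant starts from a definite matrix, hence the separate singular
  case.\<close>

lemma det_II_dilation_mono:
  assumes x: "psd (gram x)" and t: "0 \<le> t" "t \<le> 1"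
  shows "det_II (Z_part x) \<le> det_II (Z_part (t *\<^sub>R x))"
proof -
  have t2: "t\<^sup>2 \<le> 1" using t by (simp add: power_le_one)
  show ?thesis
  proof (cases "det (gram x) = 0")
    case True
    have "psd (gram (t *\<^sub>R x))" unfolding gram_dilation
      by (intro psd_add psd_scaleR psd_mat_1 x) (use t2 in auto)
    then show ?thesis using psd_gram_det_nonneg[of "t *\<^sub>R x"] True by (simp add: det_II_gram)
  next
    case False
    have "gram (t *\<^sub>R x) - gram x = (1 - t\<^sup>2) *\<^sub>R (mat 1 - gram x)"
      by (simp add: gram_dilation algebra_simps)
    then have "psd (gram (t *\<^sub>R x) - gram x)"
      using t2 by (simp only:) (intro psd_scaleR psd_mat_1_diff_gram, simp)
    then show ?thesis
      unfolding det_II_gram by (intro Re_det_mono psd_det_nonzero_imp_pos_def x False)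
  qed
qed

lemma gram_0: "gram 0 = mat 1"
  by (simp add: gram_def linear_0[OF Z_part_linear])

lemma det_II_le_1: "psd (gram x) \<Longrightarrow> det_II (Z_part x) \<le> 1"
  using det_II_dilation_mono[of x 0] by (simp add: det_II_gram gram_0)

section \<open>The defining function and the closure of the domain\<close>

definition norm_w :: "complex^('p::finite uprod + 'r::finite) \<Rightarrow> real" where
  "norm_w x = (norm (w_part x))\<^sup>2"

lemma norm_w_sum: "norm_w x = (\<Sum>j\<in>UNIV. (norm (x $ Inr j))\<^sup>2)"
  by (simp add: norm_w_def norm_vec_def L2_set_def sum_nonneg w_part_def)

lemma norm_w_dilation: "norm_w (t *\<^sub>R x) = t\<^sup>2 * norm_w x"
  by (simp add: norm_w_sum power_mult_distrib sum_distrib_left)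

lemma norm_w_nonneg: "0 \<le> norm_w x"
  by (simp add: norm_w_def)

lemma smooth_on_norm_w: "open S \<Longrightarrow> smooth_on norm_w S"
proof -
  assume S: "open S"
  have e: "norm_w x = (\<Sum>j\<in>UNIV. Re (x $ Inr j * cnj (x $ Inr j)))" for x :: "complex^('a uprod + 'b)"
    unfolding norm_w_sum by (simp only: complex_norm_square[symmetric] Re_complex_of_real)
  show ?thesis
    unfolding e[abs_def]
    by (intro smooth_on_sum smooth_on_linear_compose[OF bounded_linear_Re] smooth_on_mult smooth_on_linear
        bounded_linear_vec_nth bounded_linear_compose[OF bounded_linear_cnj bounded_linear_vec_nth] S)
qed

lemma Y_II_iff: "x \<in> Y_II K \<longleftrightarrow> x \<in> domain_II \<and> norm_w x < det_II (Z_part x) powr (1 / K)"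
  by (auto simp: Y_II_def R_II_def domain_II_def gram_def norm_w_def transpose_Z_part)

definition phi :: "real \<Rightarrow> complex^('p::finite uprod + 'r::finite) \<Rightarrow> real" where
  "phi K x = det_II (Z_part x) powr (1 / K) - norm_w x"

lemma Y_II_phi: "x \<in> Y_II K \<longleftrightarrow> x \<in> domain_II \<and> 0 < phi K x"
  by (auto simp: Y_II_iff phi_def)

lemma powr_eq_exp_pot: "x \<in> domain_II \<Longrightarrow> det_II (Z_part x) powr (1 / K) = exp (- (1 / K) * pot x)"
  using det_II_pos[of x] by (simp add: powr_def pot_def)

lemma smooth_on_phi: "smooth_on (phi K) domain_II"
proof -
  have "smooth_on (\<lambda>x. exp (- (1 / K) * pot x) - norm_w x) domain_II"
    by (intro smooth_on_diff smooth_on_exp smooth_on_mult smooth_on_const smooth_on_pot smooth_on_norm_w open_domain_II)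
  then show ?thesis
    by (subst smooth_on_cong[OF open_domain_II, where g = "\<lambda>x. exp (- (1 / K) * pot x) - norm_w x"])
       (simp_all add: phi_def powr_eq_exp_pot)
qed

lemma open_Y_II: "open (Y_II K :: (complex^('p::finite uprod + 'r::finite)) set)"
proof -
  have "open ((domain_II :: (complex^('p uprod + 'r)) set) \<inter> phi K -` {0<..})"
    by (rule continuous_open_preimage[OF smooth_on_continuous_on[OF smooth_on_phi] open_domain_II open_greaterThan])
  moreover have "Y_II K = (domain_II :: (complex^('p uprod + 'r)) set) \<inter> phi K -` {0<..}" by (auto simp: Y_II_phi)
  ultimately show ?thesis by simp
qed

lemma continuous_on_det_II: "continuous_on S (\<lambda>x. det_II (Z_part x))"
  using smooth_on_continuous_on[OF smooth_on_det_II[OF open_UNIV]] continuous_on_subset by blast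

text \<open>The exponent 1/K is positive, so the power stays continuous down to determinant zero,
  where boundary points may lie.\<close>

lemma continuous_on_phi:
  assumes "K > 0"
  shows "continuous_on {x. 0 \<le> det_II (Z_part x)} (phi K)"
  unfolding phi_def[abs_def]
  by (intro continuous_on_diff continuous_on_powr' continuous_on_det_II continuous_on_const
      continuous_on_subset[OF smooth_on_continuous_on[OF smooth_on_norm_w[OF open_UNIV]]])
     (use assms in auto)

lemma closure_Y_II_subset:
  fixes K :: real
  assumes K: "K > 0"
  shows "closure (Y_II K :: (complex^('p::finite uprod + 'r::finite)) set) \<subseteq> {x. psd (gram x) \<and> 0 \<le> phi K x}"
proof (rule closure_minimal)
  show "(Y_II K :: (complex^('p uprod + 'r)) set) \<subseteq> {x. psd (gram x) \<and> 0 \<le> phi K x}"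
    by (auto simp: Y_II_phi domain_II_def hermitian_pos_def_imp_psd)
  let ?S = "{x :: complex^('p uprod + 'r). 0 \<le> det_II (Z_part x)}"
  have S: "closed ?S" by (intro closed_Collect_le continuous_on_const continuous_on_det_II)
  have 1: "closed {x :: complex^('p uprod + 'r). psd (gram x)}"
  proof -
    have "{x :: complex^('p uprod + 'r). psd (gram x)} = (\<Inter>v. {x. 0 \<le> Re (hform (gram x) v)})"
      by (auto simp: psd_def herm_gram)
    moreover have "closed {x :: complex^('p uprod + 'r). 0 \<le> Re (hform (gram x) v)}" for v
      by (intro closed_Collect_le continuous_on_const continuous_on_hform continuous_on_gram)
    ultimately show ?thesis by auto
  qed
  have 2: "closed (?S \<inter> phi K -` {0..})"
    by (rule continuous_closed_preimage[OF continuous_on_phi[OF K] S]) simp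
  have "{x :: complex^('p uprod + 'r). psd (gram x) \<and> 0 \<le> phi K x} = {x :: complex^('p uprod + 'r). psd (gram x)} \<inter> (?S \<inter> phi K -` {0..})"
    using psd_gram_det_nonneg by auto
  then show "closed {x :: complex^('p uprod + 'r). psd (gram x) \<and> 0 \<le> phi K x}" by (simp only: closed_Int[OF 1 2])
qed

text \<open>A positive value of \<open>phi K\<close> forces a nonzero determinant, which upgrades
  semidefinite to definite. Hence \<open>phi K\<close> vanishes at every boundary point, also where
  the determinant itself is zero.\<close>

lemma Y_II_I:
  assumes "K > 0" "psd (gram x)" "0 < phi K x"
  shows "x \<in> Y_II K"
proof -
  have "0 < det_II (Z_part x) powr (1 / K)"
    using assms(3) norm_w_nonneg[of x] unfolding phi_def by linarith
  then have "det_II (Z_part x) \<noteq> 0" by auto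
  then have "hermitian_pos_def (gram x)"
    using psd_det_nonzero_imp_pos_def[OF assms(2)] by (simp add: det_II_eq_0_iff)
  then show ?thesis using assms by (simp add: Y_II_phi domain_II_def)
qed

lemma phi_frontier:
  assumes K: "K > 0" and b: "b \<in> frontier (Y_II K)"
  shows "phi K b = 0" "0 \<le> det_II (Z_part b)"
proof -
  have "b \<in> closure (Y_II K)" "b \<notin> Y_II K" using b by (auto simp: frontier_def interior_open[OF open_Y_II])
  then have "psd (gram b)" "0 \<le> phi K b" "\<not> 0 < phi K b"
    using closure_Y_II_subset[OF K] Y_II_I[OF K] by auto
  then show "phi K b = 0" "0 \<le> det_II (Z_part b)" using psd_gram_det_nonneg by auto
qed

lemma minus_ln_phi_at_frontier:
  fixes b :: "complex^('p::finite uprod + 'r::finite)"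
  assumes K: "K > 0" and b: "b \<in> frontier (Y_II K)"
  shows "filterlim (\<lambda>x. - ln (phi K x)) at_top (at b within Y_II K)"
proof -
  have "(phi K \<longlongrightarrow> phi K b) (at b within {x :: complex^('p uprod + 'r). 0 \<le> det_II (Z_part x)})"
    by (rule continuous_on_phi[OF K, unfolded continuous_on_def, rule_format])
       (simp add: phi_frontier(2)[OF K b])
  then have "(phi K \<longlongrightarrow> 0) (at b within Y_II K)"
    unfolding phi_frontier(1)[OF K b]
  proof (rule tendsto_within_subset, intro subsetI)
    fix x :: "complex^('p uprod + 'r)" assume "x \<in> Y_II K"
    then have "x \<in> domain_II" by (simp add: Y_II_iff)
    then show "x \<in> {x. 0 \<le> det_II (Z_part x)}" using det_II_pos[of x] by simp
  qed
  moreover have "\<forall>\<^sub>F x in at b within Y_II K. phi K x \<in> {0<..}"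
    by (auto simp: eventually_at_filter Y_II_phi)
  ultimately have "filterlim (phi K) (at_right 0) (at b within Y_II K)"
    by (auto simp: filterlim_at eventually_conj_iff elim: eventually_mono)
  then have "filterlim (\<lambda>x. ln (phi K x)) at_bot (at b within Y_II K)"
    by (rule filterlim_compose[OF ln_at_0])
  then show ?thesis by (simp add: filterlim_uminus_at_top)
qed

text \<open>The determinant does not decrease under the dilation while |w|^2 shrinks strictly; for w
  = 0 strictness comes from the positive determinant instead.\<close>

lemma Y_II_star:
  fixes x :: "complex^('p::finite uprod + 'r::finite)"
  assumes K: "K > 0" and t: "0 < t" "t < 1" and x: "x \<in> closure (Y_II K)"
  shows "t *\<^sub>R x \<in> Y_II K"
proof -
  have p: "psd (gram x)" and ph: "0 \<le> phi K x" using closure_Y_II_subset[OF K] x by auto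
  have t2: "t\<^sup>2 < 1" "0 < t\<^sup>2" using t by (auto simp: power_less_one_iff)
  have "hermitian_pos_def (gram (t *\<^sub>R x))"
    unfolding gram_dilation
    by (intro hermitian_pos_def_add hermitian_pos_def_scaleR hermitian_pos_def_mat_1 psd_scaleR p) (use t2 in auto)
  then have dom: "t *\<^sub>R x \<in> domain_II" by (simp add: domain_II_def)
  have "det_II (Z_part x) powr (1 / K) \<le> det_II (Z_part (t *\<^sub>R x)) powr (1 / K)"
    using det_II_dilation_mono[OF p, of t] t K psd_gram_det_nonneg[OF p] by (intro powr_mono2) auto
  then have le: "norm_w x \<le> det_II (Z_part (t *\<^sub>R x)) powr (1 / K)" using ph by (simp add: phi_def)
  have "norm_w (t *\<^sub>R x) < det_II (Z_part (t *\<^sub>R x)) powr (1 / K)"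
  proof (cases "norm_w x = 0")
    case True
    then show ?thesis using det_II_pos[OF dom] by (simp add: norm_w_dilation)
  next
    case False
    then have "t\<^sup>2 * norm_w x < 1 * norm_w x" using t2 norm_w_nonneg[of x] by (intro mult_strict_right_mono) auto
    then show ?thesis using le by (simp add: norm_w_dilation)
  qed
  then show ?thesis using dom by (simp add: Y_II_iff)
qed

lemma zero_in_Y_II: "(0 :: complex^('p::finite uprod + 'r::finite)) \<in> Y_II K"
proof -
  have "norm_w (0 :: complex^('p uprod + 'r)) = 0" by (simp add: norm_w_sum)
  then show ?thesis
    by (simp add: Y_II_iff domain_II_def gram_0 hermitian_pos_def_mat_1 det_II_gram)
qed

lemma Y_II_segment:
  assumes K: "K > 0" and x: "x \<in> Y_II K"
  shows "closed_segment 0 x \<subseteq> Y_II K"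
proof
  fix y assume "y \<in> closed_segment 0 x"
  then obtain t where t: "0 \<le> t" "t \<le> 1" "y = t *\<^sub>R x" by (auto simp: in_segment)
  then consider "t = 0" | "t = 1" | "0 < t" "t < 1" by linarith
  then show "y \<in> Y_II K"
    using t x zero_in_Y_II Y_II_star[OF K _ _ closure_subset[THEN subsetD, OF x]] by cases auto
qed

text \<open>The factor 2 undoes the weight 1/sqrt 2 of the off-diagonal coordinates.\<close>

lemma Inl_component_le:
  fixes x :: "complex^('p::finite uprod + 'r::finite)"
  shows "(norm (x $ Inl u))\<^sup>2 \<le> 2 * (\<Sum>k\<in>UNIV. \<Sum>l\<in>UNIV. (norm (Z_part x $ k $ l))\<^sup>2)"
proof (cases u)
  case (Upair a b)
  have "(norm (x $ Inl u))\<^sup>2 \<le> 2 * (norm (Z_part x $ a $ b))\<^sup>2"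
    unfolding Z_part_component Upair by (simp add: norm_mult norm_divide power_divide)
  also have "(norm (Z_part x $ a $ b))\<^sup>2 \<le> (\<Sum>l\<in>UNIV. (norm (Z_part x $ a $ l))\<^sup>2)"
    by (rule member_le_sum) auto
  also have "\<dots> \<le> (\<Sum>k\<in>UNIV. \<Sum>l\<in>UNIV. (norm (Z_part x $ k $ l))\<^sup>2)"
    by (rule member_le_sum[where f = "\<lambda>k. \<Sum>l\<in>UNIV. (norm (Z_part x $ k $ l))\<^sup>2"]) (auto intro: sum_nonneg)
  finally show ?thesis by simp
qed

lemma norm_square_split:
  fixes v :: "complex^('p::finite uprod + 'r::finite)"
  shows "(norm v)\<^sup>2 = (\<Sum>u\<in>UNIV. (norm (v $ Inl u))\<^sup>2) + (\<Sum>j\<in>UNIV. (norm (v $ Inr j))\<^sup>2)"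
  by (simp add: norm_vec_def L2_set_def sum_nonneg sum_UNIV_sum add_nonneg_nonneg)

lemma norm_square_le:
  fixes v :: "complex^('p::finite uprod + 'r::finite)"
  shows "(norm v)\<^sup>2 \<le> 2 * real CARD('p uprod) * (\<Sum>k\<in>UNIV. \<Sum>l\<in>UNIV. (norm (Z_part v $ k $ l))\<^sup>2)
     + (\<Sum>j\<in>UNIV. (norm (v $ Inr j))\<^sup>2)"
proof -
  let ?s = "\<Sum>k\<in>UNIV. \<Sum>l\<in>UNIV. (norm (Z_part v $ k $ l))\<^sup>2"
  have "(\<Sum>u\<in>UNIV. (norm (v $ Inl u))\<^sup>2) \<le> real CARD('p uprod) * (2 * ?s)"
    using sum_bounded_above[of "UNIV :: 'p uprod set" "\<lambda>u. (norm (v $ Inl u))\<^sup>2" "2 * ?s"] Inl_component_le[of v]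
    by auto
  then show ?thesis unfolding norm_square_split[of v] by (simp add: mult_ac)
qed

lemma phi_le:
  assumes K: "K > 0" and x: "x \<in> Y_II K"
  shows "0 < phi K x" "phi K x \<le> det_II (Z_part x) powr (1 / K)" "det_II (Z_part x) powr (1 / K) \<le> 1"
proof -
  have d: "0 < det_II (Z_part x)" "det_II (Z_part x) \<le> 1"
    using x det_II_pos det_II_le_1 hermitian_pos_def_imp_psd by (auto simp: Y_II_iff domain_II_def)
  show "0 < phi K x" "phi K x \<le> det_II (Z_part x) powr (1 / K)"
    using x norm_w_nonneg[of x] by (auto simp: Y_II_phi phi_def)
  show "det_II (Z_part x) powr (1 / K) \<le> 1" using powr_mono2[of "1 / K" "det_II (Z_part x)" 1] d K by simp
qed

text \<open>Z is bounded by tr(Z Z-bar) \<le> p, and w because the determinant is at most 1.\<close>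

lemma bounded_Y_II:
  assumes K: "K > 0"
  shows "bounded (Y_II K :: (complex^('p::finite uprod + 'r::finite)) set)"
proof -
  have "norm x \<le> sqrt (2 * real CARD('p uprod) * real CARD('p) + 1)" if x: "x \<in> Y_II K" for x :: "complex^('p uprod + 'r)"
  proof -
    have "(\<Sum>k\<in>UNIV. \<Sum>l\<in>UNIV. (norm (Z_part x $ k $ l))\<^sup>2) = Re (trace (Z_part x ** cZ_part x))"
      using trace_mult_cadj[of "Z_part x"] by (simp add: cadj_Z_part)
    also have "\<dots> \<le> real CARD('p)" using x by (intro domain_II_trace_le) (simp add: Y_II_iff)
    finally have 1: "(\<Sum>k\<in>UNIV. \<Sum>l\<in>UNIV. (norm (Z_part x $ k $ l))\<^sup>2) \<le> real CARD('p)" .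
    have "(\<Sum>j\<in>UNIV. (norm (x $ Inr j))\<^sup>2) \<le> 1"
      using phi_le[OF K x] by (simp add: phi_def norm_w_sum)
    then have "(norm x)\<^sup>2 \<le> 2 * real CARD('p uprod) * real CARD('p) + 1"
      using norm_square_le[of x] mult_left_mono[OF 1, of "2 * real CARD('p uprod)"] by linarith
    then show ?thesis by (rule real_le_rsqrt)
  qed
  then show ?thesis unfolding bounded_iff by blast
qed

section \<open>The Hessian of the generating function\<close>

lemma frechet_derivative_wirtinger:
  fixes f :: "complex^'n \<Rightarrow> real"
  assumes f: "f differentiable (at z)"
  shows "frechet_derivative f (at z) v = 2 * Re (\<Sum>i\<in>UNIV. wirtinger i (\<lambda>x. complex_of_real (f x)) z * v $ i)"
proof -
  note lin = linear_frechet_derivative[OF f]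
  have "frechet_derivative f (at z) v
      = (\<Sum>i\<in>UNIV. Re (v $ i) * frechet_derivative f (at z) (axis i 1) + Im (v $ i) * frechet_derivative f (at z) (axis i \<i>))"
    by (subst complex_vec_expand[of v]) (simp add: linear_sum[OF lin] linear_add[OF lin] linear.scaleR[OF lin])
  also have "\<dots> = (\<Sum>i\<in>UNIV. 2 * Re (wirtinger i (\<lambda>x. complex_of_real (f x)) z * v $ i))"
    by (intro sum.cong refl) (simp add: wirtinger_def frechet_derivative_of_real[OF f] algebra_simps)
  finally show ?thesis by (simp add: sum_distrib_left)
qed

lemma wirtinger_pot:
  assumes x: "x \<in> domain_II"
  shows "wirtinger i (\<lambda>x. complex_of_real (pot x)) x = cnj (trace (matrix_inv (gram x) ** Z_part x ** E_basis i))"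
  using wirtinger_bar_real[OF smooth_on_differentiable[OF smooth_on_pot x], of i] wirtinger_bar_pot[OF x, of i]
  by simp

lemma sum_wirtinger_pot:
  assumes x: "x \<in> domain_II"
  shows "(\<Sum>i\<in>UNIV. wirtinger i (\<lambda>x. complex_of_real (pot x)) x * v $ i)
    = cnj (trace (matrix_inv (gram x) ** Z_part x ** cZ_part v))"
  unfolding cnj_Z_part_expand[of v] matrix_mult_sum_right trace_sum mat_mult_commute trace_mat_mult wirtinger_pot[OF x]
  by (simp add: mult_ac)

definition w_coord :: "'p::finite uprod + 'r::finite \<Rightarrow> complex^('p uprod + 'r) \<Rightarrow> complex" where
  "w_coord i x = (case i of Inl u \<Rightarrow> 0 | Inr j \<Rightarrow> x $ Inr j)"

lemma w_coord_simps [simp]: "w_coord (Inl u) x = 0" "w_coord (Inr j) x = x $ Inr j"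
  by (simp_all add: w_coord_def)

lemma has_derivative_norm_w:
  "((\<lambda>x. complex_of_real (norm_w x)) has_derivative
    (\<lambda>v. \<Sum>j\<in>UNIV. x $ Inr j * cnj (v $ Inr j) + v $ Inr j * cnj (x $ Inr j))) (at x)"
proof -
  have "(\<lambda>x :: complex^('a uprod + 'b). complex_of_real (norm_w x)) = (\<lambda>x. \<Sum>j\<in>UNIV. x $ Inr j * cnj (x $ Inr j))"
    by (rule ext) (simp only: norm_w_sum of_real_sum complex_norm_square)
  then show ?thesis
    by (simp only:) (intro has_derivative_sum has_derivative_mult bounded_linear_imp_has_derivative
        bounded_linear_vec_nth bounded_linear_compose[OF bounded_linear_cnj bounded_linear_vec_nth])
qed

lemma wirtinger_bar_norm_w: "wirtinger_bar i (\<lambda>x. complex_of_real (norm_w x)) x = w_coord i x"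
proof (cases i)
  case (Inl u)
  then show ?thesis
    by (simp add: wirtinger_has_derivative(2)[OF has_derivative_norm_w]) (simp add: axis_def)
next
  case (Inr k)
  have ax: "(\<Sum>j\<in>UNIV. x $ Inr j * cnj (axis (Inr k) c $ Inr j) + axis (Inr k) c $ Inr j * cnj (x $ Inr j))
      = x $ Inr k * cnj c + c * cnj (x $ Inr k)" for c
  proof -
    have "(\<Sum>j\<in>UNIV. x $ Inr j * cnj (axis (Inr k) c $ Inr j) + axis (Inr k) c $ Inr j * cnj (x $ Inr j))
      = (\<Sum>j\<in>UNIV. if j = k then x $ Inr k * cnj c + c * cnj (x $ Inr k) else 0)"
      by (intro sum.cong refl) (auto simp: axis_def)
    then show ?thesis by simp
  qed
  show ?thesis
    unfolding wirtinger_has_derivative(2)[OF has_derivative_norm_w] Inr ax by (simp add: algebra_simps)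
qed

lemma smooth_differentiable_norm_w: "norm_w differentiable (at x)"
  by (rule smooth_on_differentiable[OF smooth_on_norm_w[OF open_UNIV] UNIV_I])

lemma wirtinger_norm_w: "wirtinger i (\<lambda>x. complex_of_real (norm_w x)) x = cnj (w_coord i x)"
  using wirtinger_bar_real[OF smooth_differentiable_norm_w, of i x] wirtinger_bar_norm_w[of i x] by simp

definition w_form :: "complex^('p::finite uprod + 'r::finite)^('p uprod + 'r)" where
  "w_form = block_diag 0 (mat 1)"

lemma complex_hessian_norm_w: "complex_hessian norm_w x = w_form"
proof -
  have "complex_hessian norm_w x $ i $ j = w_form $ i $ j" for i j
  proof -
    have "complex_hessian norm_w x $ i $ j = wirtinger i (w_coord j) x"
      by (simp add: complex_hessian_def wirtinger_bar_norm_w[abs_def])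
    also have "\<dots> = w_form $ i $ j"
    proof (cases j)
      case (Inl u)
      then have "w_coord j = (\<lambda>_. 0)" by auto
      then show ?thesis using Inl by (cases i) (simp_all add: wirtinger_const w_form_def block_diag_def)
    next
      case (Inr k)
      have "(w_coord j has_derivative (\<lambda>v. v $ Inr k)) (at x)"
        unfolding Inr w_coord_simps[abs_def] by (intro bounded_linear_imp_has_derivative bounded_linear_vec_nth)
      then show ?thesis
        unfolding wirtinger_has_derivative(1)[OF \<open>(w_coord j has_derivative _) (at x)\<close>]
        by (cases i) (auto simp: Inr axis_def w_form_def block_diag_def mat_def)
    qed
    finally show ?thesis .
  qed
  then show ?thesis by (simp add: vec_eq_iff)
qed

lemma hform_w_form: "hform w_form v = complex_of_real (norm_w v)"
proof -
  have "hform w_form v = (\<Sum>j\<in>UNIV. v $ Inr j * cnj (v $ Inr j))"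
    by (simp add: hform_def w_form_def block_diag_def sum_UNIV_sum mat_def if_distrib[of "\<lambda>x. x * _"] cong: if_cong)
  then show ?thesis by (simp only: norm_w_sum of_real_sum complex_norm_square)
qed

definition rank_one :: "complex^'n \<Rightarrow> complex^'n^'n" where
  "rank_one b = (\<chi> i j. b $ i * cnj (b $ j))"

lemma hform_rank_one: "hform (rank_one b) v = complex_of_real ((norm (\<Sum>i\<in>UNIV. b $ i * v $ i))\<^sup>2)"
proof -
  have "hform (rank_one b) v = (\<Sum>i\<in>UNIV. b $ i * v $ i) * cnj (\<Sum>i\<in>UNIV. b $ i * v $ i)"
    by (simp add: hform_def rank_one_def sum_product mult_ac)
  then show ?thesis by (simp only: complex_norm_square)
qed

lemma herm_rank_one: "herm (rank_one b)"
  by (simp add: herm_def rank_one_def mult.commute)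

lemma psd_rank_one: "psd (rank_one b)"
  by (simp add: psd_def herm_rank_one hform_rank_one del: of_real_power)

lemma scaleR_component:
  fixes b :: "complex^'n" and A :: "complex^'n^'m"
  shows "(t *\<^sub>R b) $ i = complex_of_real t * b $ i" "(t *\<^sub>R A) $ k $ l = complex_of_real t * A $ k $ l"
  by (simp_all add: scaleR_conv_of_real[where 'a = complex])

definition da :: "real \<Rightarrow> complex^('p::finite uprod + 'r::finite) \<Rightarrow> complex^('p uprod + 'r)" where
  "da K x = (\<chi> i. wirtinger i (\<lambda>x. complex_of_real (pot x)) x / complex_of_real K)"

text \<open>The components of the (1,0)-differential of |w|^2.\<close>

definition dw :: "complex^('p::finite uprod + 'r::finite) \<Rightarrow> complex^('p uprod + 'r)" where
  "dw x = (\<chi> i. cnj (w_coord i x))"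

text \<open>This is e^-a on the cylinder, the bound for |w|^2.\<close>

abbreviation expa :: "real \<Rightarrow> complex^('p::finite uprod + 'r::finite) \<Rightarrow> real" where
  "expa K x \<equiv> det_II (Z_part x) powr (1 / K)"

lemma wirtinger_expa:
  assumes x: "x \<in> domain_II" and K: "K > 0"
  shows "wirtinger i (\<lambda>x. complex_of_real (expa K x)) x = - complex_of_real (expa K x) * da K x $ i"
    and "complex_hessian (expa K) x
      = expa K x *\<^sub>R rank_one (da K x) - (expa K x / K) *\<^sub>R complex_hessian pot x"
    and "smooth_on (expa K) domain_II"
proof -
  let ?F = "\<lambda>t. exp (- (1 / K) * t)" and ?F' = "\<lambda>t. - (1 / K) * exp (- (1 / K) * t)"
  have F: "(?F has_real_derivative ?F' t) (at t)" for t
    using K by (auto intro!: derivative_eq_intros)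
  have F': "(?F' has_real_derivative (1 / K)\<^sup>2 * exp (- (1 / K) * t)) (at t)" for t
    using K by (auto intro!: derivative_eq_intros simp: power2_eq_square)
  note eq = powr_eq_exp_pot[of _ K]
  have "wirtinger i (\<lambda>x. complex_of_real (expa K x)) x = wirtinger i (\<lambda>x. complex_of_real (?F (pot x))) x"
    by (rule wirtinger_cong_open(1)[OF open_domain_II x]) (simp only: eq)
  also have "\<dots> = - complex_of_real (expa K x) * da K x $ i"
    by (simp only: wirtinger_compose_real(1)[OF smooth_on_differentiable[OF smooth_on_pot x] F] eq[OF x])
       (simp add: da_def)
  finally show "wirtinger i (\<lambda>x. complex_of_real (expa K x)) x = - complex_of_real (expa K x) * da K x $ i" .
  have "complex_hessian (expa K) x = complex_hessian (\<lambda>x. ?F (pot x)) x"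
    by (rule complex_hessian_cong_open[OF open_domain_II x]) (simp only: eq)
  also have "\<dots> = expa K x *\<^sub>R rank_one (da K x) - (expa K x / K) *\<^sub>R complex_hessian pot x"
  proof -
    have "complex_hessian (\<lambda>x. ?F (pot x)) x $ i $ j
      = (expa K x *\<^sub>R rank_one (da K x) - (expa K x / K) *\<^sub>R complex_hessian pot x) $ i $ j" for i j
      unfolding complex_hessian_compose[OF open_domain_II x smooth_on_pot F F'] eq[OF x]
      using K by (simp only: vector_minus_component scaleR_component rank_one_def da_def vec_lambda_beta)
        (simp add: field_simps power2_eq_square)
    then show ?thesis by (simp add: vec_eq_iff)
  qed
  finally show "complex_hessian (expa K) x
      = expa K x *\<^sub>R rank_one (da K x) - (expa K x / K) *\<^sub>R complex_hessian pot x" .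
  have "smooth_on (\<lambda>x. ?F (pot x)) domain_II"
    by (intro smooth_on_exp smooth_on_mult smooth_on_const smooth_on_pot open_domain_II)
  then show "smooth_on (expa K) domain_II"
    by (subst smooth_on_cong[OF open_domain_II, where g = "\<lambda>x. ?F (pot x)"]) (simp_all only: eq)
qed

lemma wirtinger_phi:
  fixes x :: "complex^('p::finite uprod + 'r::finite)"
  assumes x: "x \<in> domain_II" and K: "K > 0"
  shows "wirtinger i (\<lambda>x. complex_of_real (phi K x)) x = - (complex_of_real (expa K x) * da K x $ i + dw x $ i)"
    and "complex_hessian (phi K) x
      = expa K x *\<^sub>R rank_one (da K x) - (expa K x / K) *\<^sub>R complex_hessian pot x - w_form"
proof -
  note s = wirtinger_expa(3)[OF x K]
  have n: "smooth_on (\<lambda>x. -1 * norm_w x) (domain_II :: (complex^('p uprod + 'r)) set)"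
    by (intro smooth_on_mult smooth_on_const smooth_on_norm_w open_domain_II)
  have eq: "phi K = (\<lambda>x. expa K x + -1 * norm_w x)" by (auto simp: phi_def)
  have "wirtinger i (\<lambda>x. complex_of_real (expa K x) + complex_of_real (-1 * norm_w x)) x
    = wirtinger i (\<lambda>x. complex_of_real (expa K x)) x + wirtinger i (\<lambda>x. complex_of_real (-1 * norm_w x)) x"
    by (intro wirtinger_add(1) smooth_on_differentiable[OF smooth_on_of_real[OF open_domain_II s] x]
        smooth_on_differentiable[OF smooth_on_of_real[OF open_domain_II n] x])
  also have "wirtinger i (\<lambda>x. complex_of_real (-1 * norm_w x)) x = complex_of_real (-1) * wirtinger i (\<lambda>x. complex_of_real (norm_w x)) x"
    by (rule wirtinger_compose_real(1)[OF smooth_differentiable_norm_w, of "\<lambda>t. -1 * t"])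
       (auto intro!: derivative_eq_intros)
  finally show "wirtinger i (\<lambda>x. complex_of_real (phi K x)) x = - (complex_of_real (expa K x) * da K x $ i + dw x $ i)"
    unfolding eq by (simp add: wirtinger_expa(1)[OF x K] wirtinger_norm_w dw_def)
  have "complex_hessian (phi K) x = complex_hessian (expa K) x + complex_hessian (\<lambda>x. -1 * norm_w x) x"
    unfolding eq by (rule complex_hessian_add[OF open_domain_II x s n])
  also have "complex_hessian (\<lambda>x. -1 * norm_w x) x = -1 *\<^sub>R w_form"
    by (simp only: complex_hessian_cmult[OF open_UNIV UNIV_I smooth_on_norm_w[OF open_UNIV]] complex_hessian_norm_w)
  finally show "complex_hessian (phi K) x
      = expa K x *\<^sub>R rank_one (da K x) - (expa K x / K) *\<^sub>R complex_hessian pot x - w_form"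
    by (simp add: wirtinger_expa(2)[OF x K])
qed

lemma E_basis_Inr: "E_basis (Inr j) = 0"
  by (simp add: vec_eq_iff Z_part_component axis_def)

lemma da_Inr: "x \<in> domain_II \<Longrightarrow> da K x $ Inr j = 0"
  by (simp add: da_def wirtinger_pot E_basis_Inr) (simp add: trace_def)

lemma complex_hessian_pot_Inr:
  assumes "x \<in> domain_II"
  shows "complex_hessian pot x $ Inr j $ i = 0" "complex_hessian pot x $ i $ Inr j = 0"
  by (simp_all add: complex_hessian_pot[OF assms] E_basis_Inr) (simp_all add: trace_def matrix_matrix_mult_def)

lemma herm_complex_hessian_pot:
  fixes x :: "complex^('p::finite uprod + 'r::finite)"
  assumes x: "x \<in> domain_II"
  shows "herm (complex_hessian pot x)"
  unfolding herm_def
proof (intro allI)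
  fix i j :: "'p uprod + 'r"
  define M where "M = matrix_inv (gram x)"
  have tM: "map_matrix cnj M = transpose M" "map_matrix cnj (transpose M) = M"
    using transpose_gram_inverse(3)[OF x] by (simp_all add: M_def map_cnj_cnj)
  have "cnj (trace (M ** E_basis i ** transpose M ** E_basis j))
      = trace (map_matrix cnj (M ** E_basis i ** transpose M ** E_basis j))"
    by (rule trace_cnj[symmetric])
  also have "\<dots> = trace (transpose M ** E_basis i ** M ** E_basis j)"
    by (simp only: map_matrix_cnj_mult tM cnj_E_basis)
  also have "\<dots> = trace (transpose (transpose M ** E_basis i ** M ** E_basis j))" by (rule trace_transpose[symmetric])
  also have "\<dots> = trace ((E_basis j ** transpose M ** E_basis i) ** M)"
    by (simp add: matrix_transpose_mul transpose_Z_part matrix_mul_assoc)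
  also have "\<dots> = trace (M ** (E_basis j ** transpose M ** E_basis i))" by (rule trace_mul_sym)
  finally show "complex_hessian pot x $ j $ i = cnj (complex_hessian pot x $ i $ j)"
    by (simp add: complex_hessian_pot[OF x] M_def matrix_mul_assoc)
qed

section \<open>The negative logarithm of the defining function plus a constant\<close>

context
  fixes K c :: real and g :: "complex^('p::finite uprod + 'r::finite) \<Rightarrow> real"
  assumes K: "K > 0" and g: "\<And>x. x \<in> Y_II K \<Longrightarrow> g x = - ln (phi K x) + c"
begin

lemma g_smooth: "smooth_on g (Y_II K)"
proof -
  have "smooth_on (\<lambda>x. - ln (phi K x) + c) (Y_II K :: (complex^('p uprod + 'r)) set)"
    by (intro smooth_on_add smooth_on_minus smooth_on_ln smooth_on_const open_Y_II
        smooth_on_subset[OF smooth_on_phi]) (auto simp: Y_II_phi)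
  then show ?thesis by (subst smooth_on_cong[OF open_Y_II g])
qed

lemma g_wirtinger:
  assumes x: "x \<in> Y_II K"
  shows "wirtinger i (\<lambda>x. complex_of_real (g x)) x
    = (complex_of_real (expa K x) * da K x $ i + dw x $ i) / complex_of_real (phi K x)"
    and "complex_hessian g x = (expa K x / (K * phi K x)) *\<^sub>R complex_hessian pot x
       - (expa K x / phi K x) *\<^sub>R rank_one (da K x) + (1 / phi K x) *\<^sub>R w_form
       + (1 / (phi K x)\<^sup>2) *\<^sub>R rank_one (expa K x *\<^sub>R da K x + dw x)"
proof -
  have dom: "x \<in> domain_II" and p: "phi K x > 0" using x by (auto simp: Y_II_phi)
  have sub: "(Y_II K :: (complex^('p uprod + 'r)) set) \<subseteq> domain_II" by (auto simp: Y_II_phi)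
  note ps = smooth_on_subset[OF smooth_on_phi sub]
  let ?F = "\<lambda>t :: real. - ln t + c" and ?F' = "\<lambda>t :: real. - (1 / t)"
  have F: "(?F has_real_derivative ?F' (phi K y)) (at (phi K y))" if "y \<in> Y_II K" for y :: "complex^('p uprod + 'r)"
    using that by (auto simp: Y_II_phi intro!: derivative_eq_intros)
  have F': "(?F' has_real_derivative 1 / (phi K x)\<^sup>2) (at (phi K x))"
    using p by (auto intro!: derivative_eq_intros simp: power2_eq_square field_simps)
  have "wirtinger i (\<lambda>x. complex_of_real (g x)) x = wirtinger i (\<lambda>x. complex_of_real (?F (phi K x))) x"
    by (rule wirtinger_cong_open(1)[OF open_Y_II x]) (simp only: g)
  also have "\<dots> = complex_of_real (- (1 / phi K x)) * wirtinger i (\<lambda>x. complex_of_real (phi K x)) x"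
    by (rule wirtinger_compose_real(1)[OF smooth_on_differentiable[OF ps x] F[OF x]])
  finally show "wirtinger i (\<lambda>x. complex_of_real (g x)) x
    = (complex_of_real (expa K x) * da K x $ i + dw x $ i) / complex_of_real (phi K x)"
    unfolding wirtinger_phi(1)[OF dom K]
    by (simp only: of_real_minus of_real_divide of_real_1 minus_mult_minus times_divide_eq_left mult_1_left)
  have "complex_hessian g x = complex_hessian (\<lambda>x. ?F (phi K x)) x"
    by (rule complex_hessian_cong_open[OF open_Y_II x]) (simp only: g)
  moreover have "complex_hessian (\<lambda>x. ?F (phi K x)) x $ i $ j = ((expa K x / (K * phi K x)) *\<^sub>R complex_hessian pot x
       - (expa K x / phi K x) *\<^sub>R rank_one (da K x) + (1 / phi K x) *\<^sub>R w_form
       + (1 / (phi K x)\<^sup>2) *\<^sub>R rank_one (expa K x *\<^sub>R da K x + dw x)) $ i $ j" for i j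
  proof -
    have "complex_hessian (\<lambda>x. ?F (phi K x)) x $ i $ j
      = complex_of_real (- (1 / phi K x)) * complex_hessian (phi K) x $ i $ j
      + complex_of_real (1 / (phi K x)\<^sup>2) * wirtinger i (\<lambda>x. complex_of_real (phi K x)) x * cnj (wirtinger j (\<lambda>x. complex_of_real (phi K x)) x)"
      by (rule complex_hessian_compose[OF open_Y_II x ps F F'])
    then show ?thesis
      unfolding wirtinger_phi[OF dom K]
      using p K by (simp only: vector_add_component vector_minus_component scaleR_component rank_one_def vec_lambda_beta)
        (simp add: divide_simps, simp add: algebra_simps power2_eq_square)
  qed
  ultimately show "complex_hessian g x = (expa K x / (K * phi K x)) *\<^sub>R complex_hessian pot x
       - (expa K x / phi K x) *\<^sub>R rank_one (da K x) + (1 / phi K x) *\<^sub>R w_form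
       + (1 / (phi K x)\<^sup>2) *\<^sub>R rank_one (expa K x *\<^sub>R da K x + dw x)"
    by (simp add: vec_eq_iff)
qed

lemma Y_domain: "x \<in> Y_II K \<Longrightarrow> x \<in> (domain_II :: (complex^('p uprod + 'r)) set)"
  by (simp add: Y_II_phi)

lemma sum_dw: "(\<Sum>i\<in>UNIV. dw x $ i * v $ i) = (\<Sum>j\<in>UNIV. cnj (x $ Inr j) * v $ Inr j)"
  by (simp add: dw_def sum_UNIV_sum)

text \<open>Completing squares with e = phi + |w|^2: the coefficient e^2/phi^2 - e/phi of
  |\<alpha>|^2 equals |w|^2/phi + |w|^4/phi^2, which absorbs the negative term and leaves three
  nonnegative ones.\<close>

lemma hform_complex_hessian_g:
  assumes x: "x \<in> Y_II K"
  defines "\<alpha> \<equiv> \<lambda>v. \<Sum>i\<in>UNIV. da K x $ i * v $ i"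
    and "\<omega> \<equiv> \<lambda>v. \<Sum>j\<in>UNIV. cnj (x $ Inr j) * v $ Inr j"
  shows "Re (hform (complex_hessian g x) v) = expa K x / phi K x * (Re (hform (complex_hessian pot x) v) / K)
     + (\<Sum>j\<in>UNIV. (norm (v $ Inr j + x $ Inr j * \<alpha> v))\<^sup>2) / phi K x
     + (norm (\<omega> v + complex_of_real (norm_w x) * \<alpha> v))\<^sup>2 / (phi K x)\<^sup>2"
proof -
  define P A W n e p cr where "P = Re (hform (complex_hessian pot x) v)" and "A = (norm (\<alpha> v))\<^sup>2"
    and "W = (norm (\<omega> v))\<^sup>2" and "n = norm_w x" and "e = expa K x" and "p = phi K x" and "cr = Re (\<omega> v * cnj (\<alpha> v))"
  have p: "p > 0" using x by (simp add: p_def Y_II_phi)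
  have e: "e = p + n" by (simp add: e_def p_def n_def phi_def)
  have sq: "(norm (a + complex_of_real t * b))\<^sup>2 = (norm a)\<^sup>2 + t\<^sup>2 * (norm b)\<^sup>2 + 2 * t * Re (a * cnj b)" for a b t
    by (simp add: cmod_power2) (simp add: power2_eq_square algebra_simps)
  have sq2: "(norm (a + y * b))\<^sup>2 = (norm a)\<^sup>2 + (norm y)\<^sup>2 * (norm b)\<^sup>2 + 2 * Re (cnj y * a * cnj b)" for a b y
    by (simp add: cmod_power2) (simp add: power2_eq_square algebra_simps)
  have "(\<Sum>i\<in>UNIV. (expa K x *\<^sub>R da K x + dw x) $ i * v $ i) = complex_of_real e * \<alpha> v + \<omega> v"
    unfolding \<alpha>_def \<omega>_def sum_dw[symmetric] e_def
    by (simp add: sum_distrib_left distrib_right sum.distrib) (simp add: scaleR_conv_of_real mult_ac)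
  then have N: "(norm (\<Sum>i\<in>UNIV. (expa K x *\<^sub>R da K x + dw x) $ i * v $ i))\<^sup>2 = W + e\<^sup>2 * A + 2 * e * cr"
    using sq[of "\<omega> v" e "\<alpha> v"] by (simp add: W_def A_def cr_def add.commute)
  then have L: "Re (hform (complex_hessian g x) v)
     = e / (K * p) * P - e / p * A + norm_w v / p + (W + e\<^sup>2 * A + 2 * e * cr) / p\<^sup>2"
    unfolding g_wirtinger(2)[OF x] hform_add_matrix hform_diff_matrix hform_scaleR_matrix hform_w_form hform_rank_one
      plus_complex.sel minus_complex.sel scaleR_complex.sel Re_complex_of_real N
    by (simp add: P_def A_def e_def p_def \<alpha>_def)
  have "(\<Sum>j\<in>UNIV. (norm (v $ Inr j + x $ Inr j * \<alpha> v))\<^sup>2) = norm_w v + n * A + 2 * cr"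
    unfolding sq2 norm_w_sum n_def A_def cr_def \<omega>_def
    by (simp add: sum.distrib sum_distrib_left sum_distrib_right del: times_complex.sel)
  moreover have "(norm (\<omega> v + complex_of_real (norm_w x) * \<alpha> v))\<^sup>2 = W + n\<^sup>2 * A + 2 * n * cr"
    unfolding sq by (simp add: W_def A_def n_def cr_def)
  moreover have "e / (K * p) * P - e / p * A + norm_w v / p + (W + e\<^sup>2 * A + 2 * e * cr) / p\<^sup>2
    = e / p * (P / K) + (norm_w v + n * A + 2 * cr) / p + (W + n\<^sup>2 * A + 2 * n * cr) / p\<^sup>2"
    unfolding e using p K by (simp add: divide_simps) (simp add: power2_eq_square algebra_simps)
  ultimately show ?thesis unfolding L by (simp only: P_def p_def e_def)
qed

lemma norm_da_le:
  fixes x :: "complex^('p uprod + 'r)"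
  assumes x: "x \<in> Y_II K"
  shows "(norm (\<Sum>i\<in>UNIV. da K x $ i * v $ i))\<^sup>2 \<le> real CARD('p) / K * (Re (hform (complex_hessian pot x) v) / K)"
proof -
  have "(\<Sum>i\<in>UNIV. da K x $ i * v $ i) = cnj (trace (matrix_inv (gram x) ** Z_part x ** cZ_part v)) / complex_of_real K"
    unfolding sum_wirtinger_pot[OF Y_domain[OF x], symmetric] by (simp add: da_def sum_divide_distrib)
  then have "(norm (\<Sum>i\<in>UNIV. da K x $ i * v $ i))\<^sup>2
      = (norm (trace (matrix_inv (gram x) ** Z_part x ** cZ_part v)))\<^sup>2 / K\<^sup>2"
    by (simp add: norm_divide power_divide)
  also have "\<dots> \<le> real CARD('p) * Re (hform (complex_hessian pot x) v) / K\<^sup>2"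
    by (intro divide_right_mono norm_wirtinger_pot_le Y_domain x) simp
  finally show ?thesis by (simp add: power2_eq_square)
qed

text \<open>As 0 < phi \<le> e \<le> 1, the denominators only help: the potential term controls Z
  and \<open>\<alpha>\<close>, the second term the w-components up to w \<open>\<alpha>\<close>, and
  the third is the rest of the gradient.\<close>

lemma hform_g_bounds:
  fixes v :: "complex^('p uprod + 'r)"
  assumes x: "x \<in> Y_II K"
  defines "X \<equiv> Re (hform (complex_hessian g x) v)"
  shows "(norm v)\<^sup>2 \<le> (2 * real CARD('p uprod) * K + 2 + 2 * real CARD('p) / K) * X"
    and "(frechet_derivative g (at x) v)\<^sup>2 \<le> 8 * (real CARD('p) / K + 1) * X"
    and "0 \<le> X"
proof -
  define \<alpha> \<omega> where "\<alpha> = (\<Sum>i\<in>UNIV. da K x $ i * v $ i)" and "\<omega> = (\<Sum>j\<in>UNIV. cnj (x $ Inr j) * v $ Inr j)"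
  define l \<Theta> \<tau> where "l = Re (hform (complex_hessian pot x) v) / K"
    and "\<Theta> = (\<Sum>j\<in>UNIV. (norm (v $ Inr j + x $ Inr j * \<alpha>))\<^sup>2)"
    and "\<tau> = \<omega> + complex_of_real (norm_w x) * \<alpha>"
  define e p n where "e = expa K x" and "p = phi K x" and "n = norm_w x"
  define S where "S = (\<Sum>k\<in>UNIV. \<Sum>l\<in>UNIV. (norm (Z_part v $ k $ l))\<^sup>2)"
  have X: "X = e / p * l + \<Theta> / p + (norm \<tau>)\<^sup>2 / p\<^sup>2"
    unfolding X_def hform_complex_hessian_g[OF x] by (simp add: e_def p_def l_def \<Theta>_def \<tau>_def \<alpha>_def \<omega>_def)
  have b: "0 < p" "p \<le> e" "e \<le> 1" using phi_le[OF K x] by (auto simp: p_def e_def)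
  have n: "0 \<le> n" "e = p + n" by (auto simp: n_def e_def p_def phi_def norm_w_nonneg)
  have S: "0 \<le> S" "S \<le> K * l"
    using Re_hform_pot_ge[OF Y_domain[OF x], of v] K by (auto simp: S_def l_def intro!: sum_nonneg)
  have l: "0 \<le> l" using S K by (metis mult_le_cancel_left_pos mult_zero_right order_trans)
  have \<Theta>: "0 \<le> \<Theta>" unfolding \<Theta>_def by (intro sum_nonneg) auto
  have pos: "0 \<le> e / p * l" "0 \<le> \<Theta> / p" "0 \<le> (norm \<tau>)\<^sup>2 / p\<^sup>2"
    using b l \<Theta> by auto
  then show X0: "0 \<le> X" by (simp add: X)
  have lX: "l \<le> X"
  proof -
    have "1 * l \<le> e / p * l" using b l by (intro mult_right_mono) auto
    then show ?thesis unfolding X using pos by linarith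
  qed
  have \<Theta>X: "\<Theta> \<le> X"
  proof -
    have "\<Theta> * p \<le> \<Theta> * 1" using b \<Theta> by (intro mult_left_mono) auto
    then have "\<Theta> \<le> \<Theta> / p" using b by (simp add: field_simps)
    then show ?thesis unfolding X using pos by linarith
  qed
  have \<tau>X: "(norm (\<tau> / complex_of_real p))\<^sup>2 \<le> X"
    using pos b by (simp add: X norm_divide power_divide)
  have \<alpha>: "(norm \<alpha>)\<^sup>2 \<le> real CARD('p) / K * l"
    unfolding \<alpha>_def l_def by (rule norm_da_le[OF x])
  have \<alpha>X: "(norm \<alpha>)\<^sup>2 \<le> real CARD('p) / K * X"
    by (rule order_trans[OF \<alpha>]) (use lX K in \<open>intro mult_left_mono, auto\<close>)
  have two: "(norm (a + b))\<^sup>2 \<le> 2 * (norm a)\<^sup>2 + 2 * (norm b)\<^sup>2" for a b :: complex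
  proof -
    have "(norm (a + b))\<^sup>2 \<le> (norm a + norm b)\<^sup>2" by (intro power_mono norm_triangle_ineq) auto
    also have "\<dots> \<le> 2 * (norm a)\<^sup>2 + 2 * (norm b)\<^sup>2"
      using zero_le_power2[of "norm a - norm b"] by (simp add: power2_eq_square algebra_simps)
    finally show ?thesis .
  qed
  \<comment> \<open>The w-component is \<theta>_j minus w_j \<open>\<alpha>\<close>, and both parts
    are under control.\<close>
  have "(norm (v $ Inr j))\<^sup>2 \<le> 2 * (norm (v $ Inr j + x $ Inr j * \<alpha>))\<^sup>2 + 2 * ((norm (x $ Inr j))\<^sup>2 * (norm \<alpha>)\<^sup>2)" for j
    using two[of "v $ Inr j + x $ Inr j * \<alpha>" "- (x $ Inr j * \<alpha>)"] by (simp add: norm_mult power_mult_distrib)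
  then have "(\<Sum>j\<in>UNIV. (norm (v $ Inr j))\<^sup>2)
     \<le> (\<Sum>j\<in>UNIV. 2 * (norm (v $ Inr j + x $ Inr j * \<alpha>))\<^sup>2 + 2 * ((norm (x $ Inr j))\<^sup>2 * (norm \<alpha>)\<^sup>2))"
    by (rule sum_mono)
  also have "\<dots> = 2 * \<Theta> + 2 * (n * (norm \<alpha>)\<^sup>2)"
    by (simp add: sum.distrib \<Theta>_def n_def norm_w_sum sum_distrib_left sum_distrib_right)
  also have "\<dots> \<le> 2 * X + 2 * (real CARD('p) / K * X)"
  proof -
    have "n * (norm \<alpha>)\<^sup>2 \<le> 1 * (norm \<alpha>)\<^sup>2" using n b by (intro mult_right_mono) auto
    then show ?thesis using \<Theta>X \<alpha>X by linarith
  qed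
  finally have nv: "(\<Sum>j\<in>UNIV. (norm (v $ Inr j))\<^sup>2) \<le> 2 * X + 2 * (real CARD('p) / K * X)" .
  have "S \<le> K * X" using S lX K by (meson mult_left_mono less_imp_le order_trans)
  then have "2 * real CARD('p uprod) * S \<le> 2 * real CARD('p uprod) * (K * X)" by (intro mult_left_mono) auto
  then show "(norm v)\<^sup>2 \<le> (2 * real CARD('p uprod) * K + 2 + 2 * real CARD('p) / K) * X"
  proof -
    have "(2 * real CARD('p uprod) * K + 2 + 2 * real CARD('p) / K) * X
        = 2 * real CARD('p uprod) * (K * X) + (2 * X + 2 * (real CARD('p) / K * X))"
      by (simp add: algebra_simps)
    then show ?thesis
      using norm_square_le[of v] nv \<open>2 * real CARD('p uprod) * S \<le> _\<close> unfolding S_def[symmetric] by linarith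
  qed
  have gd: "g differentiable (at x)" by (rule smooth_on_differentiable[OF g_smooth x])
  have "(\<Sum>i\<in>UNIV. wirtinger i (\<lambda>x. complex_of_real (g x)) x * v $ i) = (complex_of_real e * \<alpha> + \<omega>) / complex_of_real p"
  proof -
    have "(\<Sum>i\<in>UNIV. wirtinger i (\<lambda>x. complex_of_real (g x)) x * v $ i)
      = (\<Sum>i\<in>UNIV. complex_of_real e * (da K x $ i * v $ i) + dw x $ i * v $ i) / complex_of_real p"
      unfolding g_wirtinger(1)[OF x] sum_divide_distrib
      by (intro sum.cong refl) (simp add: e_def p_def algebra_simps)
    then show ?thesis by (simp only: \<alpha>_def \<omega>_def sum_dw[symmetric] sum.distrib sum_distrib_left)
  qed
  \<comment> \<open>Since e = phi + |w|^2, the differential splits into exactly the two quantities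
    bounded above.\<close>
  also have "\<dots> = \<alpha> + \<tau> / complex_of_real p"
    using b by (simp add: \<tau>_def n_def[symmetric] n(2) field_simps)
  finally have D: "frechet_derivative g (at x) v = 2 * Re (\<alpha> + \<tau> / complex_of_real p)"
    by (simp only: frechet_derivative_wirtinger[OF gd])
  have "(frechet_derivative g (at x) v)\<^sup>2 = 4 * (Re (\<alpha> + \<tau> / complex_of_real p))\<^sup>2"
    unfolding D power_mult_distrib by simp
  also have "\<dots> \<le> 4 * (norm (\<alpha> + \<tau> / complex_of_real p))\<^sup>2"
  proof -
    have "(Re y)\<^sup>2 \<le> (norm y)\<^sup>2" for y by (simp add: cmod_power2)
    then show ?thesis by (rule mult_left_mono) simp
  qed
  also have "\<dots> \<le> 4 * (2 * (norm \<alpha>)\<^sup>2 + 2 * (norm (\<tau> / complex_of_real p))\<^sup>2)"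
    by (intro mult_left_mono two) simp
  \<comment> \<open>The constant is 4 from squaring twice a real part, times 2 from the square of a
    sum.\<close>
  also have "\<dots> \<le> 8 * (real CARD('p) / K + 1) * X"
  proof -
    have "4 * (2 * s + 2 * t) \<le> 8 * (q + 1) * X" if "s \<le> q * X" "t \<le> X" for s t q :: real
      using that by (simp add: algebra_simps)
    from this[OF \<alpha>X \<tau>X] show ?thesis .
  qed
  finally show "(frechet_derivative g (at x) v)\<^sup>2 \<le> 8 * (real CARD('p) / K + 1) * X" .
qed

lemma hermitian_pos_def_complex_hessian_g:
  assumes x: "x \<in> Y_II K"
  shows "hermitian_pos_def (complex_hessian g x)"
proof -
  have w: "herm (w_form :: complex^('p uprod + 'r)^('p uprod + 'r))"
    unfolding herm_def w_form_def block_diag_def by (auto simp: mat_def split: sum.split)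
  have "herm (complex_hessian g x)"
    unfolding g_wirtinger(2)[OF x]
    by (intro herm_add herm_diff herm_scaleR herm_rank_one herm_complex_hessian_pot w Y_domain x)
  moreover have "0 < Re (hform (complex_hessian g x) v)" if "v \<noteq> 0" for v
  proof -
    have "0 < (norm v)\<^sup>2" using that by simp
    then show ?thesis using hform_g_bounds(1,3)[OF x, of v] by (auto simp: order_less_le)
  qed
  ultimately show ?thesis by (simp add: hermitian_pos_def_iff)
qed

lemma g_at_frontier:
  fixes b :: "complex^('p uprod + 'r)"
  assumes b: "b \<in> frontier (Y_II K)"
  shows "filterlim g at_top (at b within Y_II K)"
proof -
  have "filterlim (\<lambda>x. c + - ln (phi K x)) at_top (at b within Y_II K)"
    by (rule filterlim_tendsto_add_at_top[OF tendsto_const minus_ln_phi_at_frontier[OF K b]])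
  moreover have "\<forall>\<^sub>F x in at b within Y_II K. c + - ln (phi K x) = g x"
    by (auto simp: eventually_at_filter g)
  ultimately show ?thesis by (rule filterlim_mono_eventually[OF _ order_refl order_refl])
qed

lemma complete_kaehler_g: "complete_kaehler_metric_on (Y_II K) (complex_hessian g)"
proof -
  let ?Y = "Y_II K :: (complex^('p uprod + 'r)) set"
  note gs = g_smooth
  note gc = smooth_on_of_real[OF open_Y_II gs]
  have e: "(\<lambda>z. complex_hessian g z $ i $ j) = wirtinger i (wirtinger_bar j (\<lambda>x. complex_of_real (g x)))" for i j
    by (simp add: complex_hessian_def)
  have sm: "smooth_on (\<lambda>z. complex_hessian g z $ i $ j) ?Y" for i j
    unfolding e by (intro smooth_on_wirtinger gc open_Y_II)
  have "kaehler_metric_on ?Y (complex_hessian g)"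
    unfolding kaehler_metric_on_def
  proof (intro conjI allI ballI)
    show "smooth_on (\<lambda>z. complex_hessian g z $ i $ j) ?Y" for i j by (rule sm)
    show "hermitian_pos_def (complex_hessian g z)" if "z \<in> ?Y" for z
      by (rule hermitian_pos_def_complex_hessian_g[OF that])
    show "wirtinger k (\<lambda>x. complex_hessian g x $ i $ j) z = wirtinger i (\<lambda>x. complex_hessian g x $ k $ j) z"
      if "z \<in> ?Y" for z i j k
      unfolding e by (rule wirtinger_commute[OF open_Y_II that smooth_on_wirtinger(2)[OF open_Y_II gc]])
  qed
  moreover have "Metric_space ?Y (metric_dist ?Y (complex_hessian g)) \<and> Metric_space.mcomplete ?Y (metric_dist ?Y (complex_hessian g))"
  proof (rule complete_metric_dist[where g = g and g' = "\<lambda>x. frechet_derivative g (at x)"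
        and A = "sqrt (2 * real CARD('p uprod) * K + 2 + 2 * real CARD('p) / K)"
        and C = "sqrt (8 * (real CARD('p) / K + 1))"])
    show "closed_segment 0 x \<subseteq> ?Y" if "x \<in> ?Y" for x by (rule Y_II_segment[OF K that])
    show "continuous_on ?Y (\<lambda>x. complex_hessian g x $ i $ j)" for i j by (rule smooth_on_continuous_on[OF sm])
    show "hermitian_pos_def (complex_hessian g x)" if "x \<in> ?Y" for x
      by (rule hermitian_pos_def_complex_hessian_g[OF that])
    show "norm v \<le> sqrt (2 * real CARD('p uprod) * K + 2 + 2 * real CARD('p) / K) * sqrt (Re (hform (complex_hessian g x) v))"
      if "x \<in> ?Y" for x v
      using real_le_rsqrt[OF hform_g_bounds(1)[OF that, of v]] by (simp add: real_sqrt_mult)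
    show "\<bar>frechet_derivative g (at x) v\<bar> \<le> sqrt (8 * (real CARD('p) / K + 1)) * sqrt (Re (hform (complex_hessian g x) v))"
      if "x \<in> ?Y" for x v
      using real_sqrt_le_mono[OF hform_g_bounds(2)[OF that, of v]] by (simp only: real_sqrt_mult real_sqrt_abs)
    show "(g has_derivative frechet_derivative g (at x)) (at x)" if "x \<in> ?Y" for x
      by (rule smooth_on_has_derivative[OF gs that])
    show "filterlim g at_top (at b within ?Y)" if "b \<in> frontier ?Y" for b
      by (rule g_at_frontier[OF that])
  qed (rule open_Y_II)
  ultimately show ?thesis by (simp add: complete_kaehler_metric_on_def)
qed

section \<open>The determinant of the Hessian\<close>

lemma complex_hessian_pot_Inl:
  assumes x: "x \<in> (domain_II :: (complex^('p uprod + 'r)) set)"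
  shows "complex_hessian pot x $ Inl u $ Inl v
    = sym_op TYPE('r) (matrix_inv (gram x)) (matrix_inv (gram x)) $ u $ v"
  by (simp add: complex_hessian_pot[OF x] sym_op_def)

text \<open>This is the Z-block of the Hessian of \<open>pot\<close>; extending test vectors by zero
  reduces positivity to the lower bound for that Hessian.\<close>

lemma sym_op_pos_def:
  assumes x: "x \<in> (domain_II :: (complex^('p uprod + 'r)) set)"
  shows "hermitian_pos_def (sym_op TYPE('r) (matrix_inv (gram x)) (matrix_inv (gram x)))"
proof -
  let ?S = "sym_op TYPE('r) (matrix_inv (gram x)) (matrix_inv (gram x))"
  have "herm ?S"
    unfolding herm_def complex_hessian_pot_Inl[OF x, symmetric]
    using hermD[OF herm_complex_hessian_pot[OF x]] by blast
  moreover have "0 < Re (hform ?S q)" if q: "q \<noteq> 0" for q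
  proof -
    define v :: "complex^('p uprod + 'r)" where "v = (\<chi> i. case i of Inl u \<Rightarrow> q $ u | Inr j \<Rightarrow> 0)"
    have "hform (complex_hessian pot x) v = hform ?S q"
      by (simp add: hform_def sum_UNIV_sum v_def complex_hessian_pot_Inl[OF x])
    moreover obtain u where "q $ u \<noteq> 0" using q by (auto simp: vec_eq_iff)
    then have "0 < (norm (v $ Inl u))\<^sup>2" by (simp add: v_def)
    then have "0 < Re (hform (complex_hessian pot x) v)"
      using Inl_component_le[of v u] Re_hform_pot_ge[OF x, of v] by linarith
    ultimately show ?thesis by simp
  qed
  ultimately show ?thesis by (simp add: hermitian_pos_def_iff)
qed

text \<open>The passage from dw to \<theta> is a congruence with a block diagonal matrix. The
  Z-block yields the powers of e/(K phi) and of det(I - Z Z-bar), the w-block the last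
  bracket.\<close>

lemma det_complex_hessian_g:
  assumes x: "x \<in> Y_II K"
  shows "det (complex_hessian g x) = complex_of_real ((expa K x / (K * phi K x)) ^ CARD('p uprod)
    * (1 / det_II (Z_part x)) ^ (CARD('p) + 1) * ((1 / phi K x) ^ CARD('r) * (expa K x / phi K x)))"
proof -
  have dom: "x \<in> domain_II" by (rule Y_domain[OF x])
  define e p n where "e = expa K x" and "p = phi K x" and "n = norm_w x"
  have p: "0 < p" "0 \<le> n" "e = p + n" using x norm_w_nonneg[of x] by (auto simp: p_def n_def e_def Y_II_phi phi_def)
  let ?M = "matrix_inv (gram x)" and ?S = "sym_op TYPE('r) (matrix_inv (gram x)) (matrix_inv (gram x))"
  define w :: "complex^'r" where "w = (\<chi> k. cnj (x $ Inr k))"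
  define A where "A = (e / (K * p)) *\<^sub>R ?S"
  \<comment> \<open>The form |\<theta>|^2/phi + |(\<theta>,w)|^2/phi^2 in the frame
    \<theta>.\<close>
  define B where "B = (1 / p) *\<^sub>R (mat 1 + (1 / p) *\<^sub>R rank_one w)"
  \<comment> \<open>Row \<open>Inr k\<close> of \<open>mat 1 + T\<close> expresses \<theta>_k in the
    coordinate differentials.\<close>
  define T :: "complex^('p uprod + 'r)^('p uprod + 'r)" where
    "T = (\<chi> s i. case s of Inl u \<Rightarrow> 0 | Inr k \<Rightarrow> (case i of Inl u \<Rightarrow> x $ Inr k * da K x $ i | Inr k' \<Rightarrow> 0))"
  have ww: "(\<Sum>k\<in>UNIV. x $ Inr k * cnj (x $ Inr k)) = complex_of_real n"
    by (simp only: n_def norm_w_sum of_real_sum complex_norm_square)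
  have Bkk: "B $ k $ k' = (if k = k' then 1 / complex_of_real p else 0) + cnj (x $ Inr k) * x $ Inr k' / (complex_of_real p)\<^sup>2" for k k'
    unfolding B_def by (simp only: scaleR_component vector_add_component)
      (simp add: mat_def rank_one_def w_def add_divide_distrib power2_eq_square)
  \<comment> \<open>The eigenvalue of \<open>B\<close> on the line of w, by which both contractions
    below multiply.\<close>
  have e2: "complex_of_real e / (complex_of_real p)\<^sup>2 = 1 / complex_of_real p + complex_of_real n / (complex_of_real p)\<^sup>2"
    using p by (simp add: power2_eq_square field_simps)
  have b1: "(\<Sum>k\<in>UNIV. x $ Inr k * B $ k $ k') = complex_of_real e / (complex_of_real p)\<^sup>2 * x $ Inr k'" for k'
  proof -
    have "(\<Sum>k\<in>UNIV. x $ Inr k * B $ k $ k') = (\<Sum>k\<in>UNIV. if k = k' then x $ Inr k' / complex_of_real p else 0)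
       + (\<Sum>k\<in>UNIV. x $ Inr k * cnj (x $ Inr k)) * (x $ Inr k' / (complex_of_real p)\<^sup>2)"
      unfolding Bkk sum_distrib_right sum.distrib[symmetric] by (intro sum.cong refl) (auto simp: field_simps)
    then show ?thesis unfolding ww e2 by (simp add: algebra_simps)
  qed
  have b2: "(\<Sum>k'\<in>UNIV. B $ k $ k' * cnj (x $ Inr k')) = complex_of_real e / (complex_of_real p)\<^sup>2 * cnj (x $ Inr k)" for k
  proof -
    have "(\<Sum>k'\<in>UNIV. B $ k $ k' * cnj (x $ Inr k')) = (\<Sum>k'\<in>UNIV. if k' = k then cnj (x $ Inr k) / complex_of_real p else 0)
       + (\<Sum>k'\<in>UNIV. x $ Inr k' * cnj (x $ Inr k')) * (cnj (x $ Inr k) / (complex_of_real p)\<^sup>2)"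
      unfolding Bkk sum_distrib_right sum.distrib[symmetric] by (intro sum.cong refl) (auto simp: field_simps)
    then show ?thesis unfolding ww e2 by (simp add: algebra_simps)
  qed
  have H: "complex_hessian g x $ i $ j = complex_of_real (e / (K * p)) * complex_hessian pot x $ i $ j
     - complex_of_real (e / p) * (da K x $ i * cnj (da K x $ j)) + complex_of_real (1 / p) * w_form $ i $ j
     + complex_of_real (1 / p\<^sup>2) * ((complex_of_real e * da K x $ i + dw x $ i) * cnj (complex_of_real e * da K x $ j + dw x $ j))" for i j
    unfolding g_wirtinger(2)[OF x] vector_add_component vector_minus_component scaleR_component rank_one_def vec_lambda_beta
    by (simp add: e_def p_def)
  let ?R = "transpose (mat 1 + T) ** block_diag A B ** map_matrix cnj (mat 1 + T)"
  define Q where "Q i t = (\<Sum>s\<in>UNIV. (mat 1 + T) $ s $ i * block_diag A B $ s $ t)" for i t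
  have D: "?R $ i $ j
     = (\<Sum>u\<in>UNIV. Q i (Inl u) * cnj ((mat 1 + T) $ Inl u $ j)) + (\<Sum>k\<in>UNIV. Q i (Inr k) * cnj ((mat 1 + T) $ Inr k $ j))" for i j
    unfolding sum_UNIV_sum[where f = "\<lambda>t. Q i t * cnj ((mat 1 + T) $ t $ j)", symmetric]
    by (simp add: Q_def matrix_matrix_mult_def transpose_def)
  have T: "(mat 1 + T) $ Inl u $ Inl v = (if u = v then 1 else 0)" "(mat 1 + T) $ Inl u $ Inr k = 0"
    "(mat 1 + T) $ Inr k $ Inl u = x $ Inr k * da K x $ Inl u" "(mat 1 + T) $ Inr k $ Inr k' = (if k = k' then 1 else 0)" for u v k k'
    by (simp_all add: T_def mat_def)
  have bd: "block_diag A B $ Inl u $ Inl v = A $ u $ v" "block_diag A B $ Inl u $ Inr k = 0"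
    "block_diag A B $ Inr k $ Inl u = 0" "block_diag A B $ Inr k $ Inr k' = B $ k $ k'" for u v k k'
    by (simp_all add: block_diag_def)
  have i2: "(\<Sum>b\<in>UNIV. x $ Inr b * da K x $ Inl u * B $ b $ k)
      = da K x $ Inl u * (complex_of_real e / (complex_of_real p)\<^sup>2 * x $ Inr k)" for u k
    unfolding b1[symmetric] sum_distrib_left by (simp add: mult_ac)
  have inner: "Q (Inl u) (Inl v) = A $ u $ v"
    "Q (Inl u) (Inr k) = da K x $ Inl u * (complex_of_real e / (complex_of_real p)\<^sup>2 * x $ Inr k)"
    "Q (Inr k) (Inl v) = 0"
    "Q (Inr k) (Inr k') = B $ k $ k'" for u v k k'
    unfolding Q_def sum_UNIV_sum T bd
    by (simp_all add: i2 if_distrib[of "\<lambda>y. y * _"] cong: if_cong)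
  have "complex_hessian g x = ?R"
    unfolding vec_sum_eq_iff
  proof (intro conjI allI)
    fix u v
    have "?R $ Inl u $ Inl v
        = A $ u $ v + (\<Sum>k\<in>UNIV. da K x $ Inl u * (complex_of_real e / (complex_of_real p)\<^sup>2 * x $ Inr k) * cnj (x $ Inr k * da K x $ Inl v))"
      unfolding D inner T
      by (simp add: if_distrib[of cnj] if_distrib[of "\<lambda>y. _ * y"] cong: if_cong)
    also have "(\<Sum>k\<in>UNIV. da K x $ Inl u * (complex_of_real e / (complex_of_real p)\<^sup>2 * x $ Inr k) * cnj (x $ Inr k * da K x $ Inl v))
        = da K x $ Inl u * cnj (da K x $ Inl v) * (complex_of_real e / (complex_of_real p)\<^sup>2) * (\<Sum>k\<in>UNIV. x $ Inr k * cnj (x $ Inr k))"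
      unfolding sum_distrib_left by (intro sum.cong refl) (simp add: mult_ac)
    finally have "?R $ Inl u $ Inl v
      = complex_of_real (e / (K * p)) * ?S $ u $ v + da K x $ Inl u * cnj (da K x $ Inl v) * (complex_of_real e / (complex_of_real p)\<^sup>2) * complex_of_real n"
      unfolding ww A_def scaleR_component .
    moreover have "complex_hessian g x $ Inl u $ Inl v = complex_of_real (e / (K * p)) * ?S $ u $ v
       + da K x $ Inl u * cnj (da K x $ Inl v) * (complex_of_real e * complex_of_real e / (complex_of_real p)\<^sup>2 - complex_of_real e / complex_of_real p)"
      unfolding H complex_hessian_pot_Inl[OF dom]
      by (simp add: w_form_def block_diag_def dw_def algebra_simps diff_divide_distrib add_divide_distrib)
    moreover have "complex_of_real e * complex_of_real e / (complex_of_real p)\<^sup>2 - complex_of_real e / complex_of_real p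
        = complex_of_real e / (complex_of_real p)\<^sup>2 * complex_of_real n"
      using p by (simp add: power2_eq_square field_simps)
    ultimately show "complex_hessian g x $ Inl u $ Inl v = ?R $ Inl u $ Inl v"
      by (simp only: mult.assoc)
  next
    fix u k
    have "?R $ Inl u $ Inr k
        = da K x $ Inl u * (complex_of_real e / (complex_of_real p)\<^sup>2 * x $ Inr k)"
      unfolding D inner T
      by (simp add: if_distrib[of cnj] if_distrib[of "\<lambda>y. _ * y"] cong: if_cong)
    then show "complex_hessian g x $ Inl u $ Inr k = ?R $ Inl u $ Inr k"
      unfolding H by (simp add: complex_hessian_pot_Inr[OF dom] da_Inr[OF dom] w_form_def block_diag_def dw_def)
  next
    fix k u
    have "?R $ Inr k $ Inl u
        = (\<Sum>k'\<in>UNIV. B $ k $ k' * cnj (x $ Inr k')) * cnj (da K x $ Inl u)"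
      unfolding D inner T sum_distrib_right by (simp add: mult.assoc)
    then show "complex_hessian g x $ Inr k $ Inl u = ?R $ Inr k $ Inl u"
      unfolding H b2 by (simp add: complex_hessian_pot_Inr[OF dom] da_Inr[OF dom] w_form_def block_diag_def dw_def)
  next
    fix k k'
    have "?R $ Inr k $ Inr k' = B $ k $ k'"
      unfolding D inner T
      by (simp add: if_distrib[of cnj] if_distrib[of "\<lambda>y. _ * y"] cong: if_cong)
    then show "complex_hessian g x $ Inr k $ Inr k' = ?R $ Inr k $ Inr k'"
      unfolding H Bkk by (simp add: complex_hessian_pot_Inr[OF dom] da_Inr[OF dom] w_form_def block_diag_def dw_def mat_def)
  qed
  then have "det (complex_hessian g x) = det (mat 1 + T) * det (block_diag A B) * cnj (det (mat 1 + T))"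
    by (simp only: det_mul det_transpose det_cnj)
  \<comment> \<open>\<open>T\<close> maps between the two blocks in one direction only, so its
    square and its trace are zero.\<close>
  also have "det (mat 1 + T) = 1"
    using det_mat_1_add[of T 0] by (simp add: T_def vec_sum_eq_iff matrix_matrix_mult_def sum_UNIV_sum trace_def)
  also have "det (block_diag A B) = det A * det B"
  proof (rule det_block_diag)
    have "0 < e / (K * p)" using p K by (simp add: divide_pos_pos)
    then show "hermitian_pos_def A" unfolding A_def by (intro hermitian_pos_def_scaleR sym_op_pos_def dom)
    show "hermitian_pos_def B" unfolding B_def
      by (intro hermitian_pos_def_scaleR hermitian_pos_def_add hermitian_pos_def_mat_1 psd_scaleR psd_rank_one) (use p in auto)
  qed
  also have "det A = complex_of_real ((e / (K * p)) ^ CARD('p uprod)) * det ?M ^ (CARD('p) + 1)"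
    unfolding A_def det_scaleR det_sym_op[OF gram_inverse(3)[OF dom]] ..
  also have "det ?M = complex_of_real (1 / det_II (Z_part x))"
  proof -
    have pd: "hermitian_pos_def (gram x)" using dom by (simp add: domain_II_def)
    have "det (gram x) * det ?M = 1" using gram_inverse(1)[OF dom] by (metis det_I det_mul)
    moreover have "det (gram x) = complex_of_real (det_II (Z_part x))"
      unfolding det_II_gram by (rule hermitian_pos_def_det_eq[OF pd])
    ultimately show ?thesis using det_II_pos[OF dom] by (simp add: field_simps)
  qed
  \<comment> \<open>The identity is perturbed on the line of w only, with eigenvalue 1 + |w|^2/phi =
    e/phi.\<close>
  also have "det B = complex_of_real ((1 / p) ^ CARD('r) * (e / p))"
  proof -
    have wn: "(\<Sum>k\<in>UNIV. w $ k * cnj (w $ k)) = complex_of_real n"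
      unfolding ww[symmetric] by (simp add: w_def mult.commute)
    have "rank_one w ** rank_one w = n *\<^sub>R rank_one w"
    proof -
      have "(rank_one w ** rank_one w) $ k $ k' = (\<Sum>l\<in>UNIV. w $ l * cnj (w $ l)) * (w $ k * cnj (w $ k'))" for k k'
        unfolding rank_one_def matrix_matrix_mult_def vec_lambda_beta sum_distrib_right
        by (intro sum.cong refl) (simp add: mult_ac)
      then show ?thesis unfolding wn by (simp add: vec_eq_iff scaleR_component del: vector_scaleR_component) (simp add: rank_one_def)
    qed
    moreover have "trace (rank_one w) = complex_of_real n" using wn by (simp add: trace_def rank_one_def)
    ultimately have "det (mat 1 + (1 / p) *\<^sub>R rank_one w) = complex_of_real (1 + n / p)"
      using p by (intro det_mat_1_add) (simp_all add: matrix_mult_scaleR_left matrix_mult_scaleR_right trace_scaleR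
        scaleR_conv_of_real[where 'a = complex])
    moreover have "1 + n / p = e / p" using p by (simp add: field_simps)
    ultimately show ?thesis unfolding B_def det_scaleR by simp
  qed
  finally show ?thesis by (simp add: e_def p_def)
qed

text \<open>The logarithm of the determinant is \<open>t\<close> times the potential, so the Ricci
  form is -t times the Kaehler form; for the Monge-Ampere equation t is N + 1.\<close>

lemma einstein_g:
  assumes ma: "\<And>x. x \<in> Y_II K \<Longrightarrow> det (complex_hessian g x) = complex_of_real (exp (t * g x))"
  shows "einstein_on (Y_II K) (complex_hessian g)"
proof -
  have "complex_hessian (\<lambda>x. ln (Re (det (complex_hessian g x)))) z = t *\<^sub>R complex_hessian g z" if z: "z \<in> Y_II K" for z
  proof -
    have "complex_hessian (\<lambda>x. ln (Re (det (complex_hessian g x)))) z = complex_hessian (\<lambda>x. t * g x) z"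
      by (rule complex_hessian_cong_open[OF open_Y_II z]) (simp only: ma Re_complex_of_real ln_exp)
    then show ?thesis by (simp only: complex_hessian_cmult[OF open_Y_II z g_smooth])
  qed
  then have "- complex_hessian (\<lambda>x. ln (Re (det (complex_hessian g x)))) z $ i $ j
      = complex_of_real (- t) * complex_hessian g z $ i $ j" if "z \<in> Y_II K" for z i j
    using that by (simp only: scaleR_component of_real_minus mult_minus_left)
  then show ?thesis unfolding einstein_on_def by blast
qed

end

text \<open>Here the value of \<open>K\<close> enters: K (p+1) = n + 1, where n = p(p+1)/2 is the
  number of Z-coordinates.\<close>

lemma expa_power:
  fixes x :: "complex^('p::finite uprod + 'r::finite)"
  assumes x: "x \<in> domain_II" and K: "K = real CARD('p) / 2 + 1 / (real CARD('p) + 1)"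
  shows "expa K x ^ (CARD('p uprod) + 1) = det_II (Z_part x) ^ (CARD('p) + 1)"
proof -
  have d: "0 < det_II (Z_part x)" by (rule det_II_pos[OF x])
  have n: "real CARD('p uprod) = real CARD('p) * (real CARD('p) + 1) / 2"
  proof -
    have "2 dvd CARD('p) * (CARD('p) + 1)" by simp
    then have "2 * CARD('p uprod) = CARD('p) * (CARD('p) + 1)"
      by (simp add: card_UNIV_uprod)
    then have "2 * real CARD('p uprod) = real CARD('p) * (real CARD('p) + 1)"
      by (metis of_nat_1 of_nat_add of_nat_mult of_nat_numeral)
    then show ?thesis by simp
  qed
  have K0: "K > 0" unfolding K by (simp add: add_nonneg_pos)
  have "1 / K * (real CARD('p uprod) + 1) = real CARD('p) + 1"
  proof -
    have "K * (real CARD('p) + 1) = real CARD('p uprod) + 1"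
      unfolding K n by (simp add: field_simps)
    then show ?thesis using K0 by (simp add: field_simps)
  qed
  moreover have "expa K x ^ (CARD('p uprod) + 1) = expa K x powr (real (CARD('p uprod) + 1))"
    by (rule powr_realpow[symmetric]) (use d in simp)
  moreover have "\<dots> = det_II (Z_part x) powr (1 / K * (real CARD('p uprod) + 1))"
    by (simp add: powr_powr add.commute)
  moreover have "det_II (Z_part x) ^ (CARD('p) + 1) = det_II (Z_part x) powr (real (CARD('p) + 1))"
    by (rule powr_realpow[symmetric, OF d])
  ultimately show ?thesis by (simp add: add.commute)
qed

theorem mainTheorem1:
  fixes p r N :: nat and K :: real
    and Y :: "(complex ^ ('p::finite uprod + 'r::finite)) set"
    and X g :: "complex ^ ('p uprod + 'r) \<Rightarrow> real"
  assumes "p = CARD('p)" and "r = CARD('r)"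
    and "p > 1" and "r \<ge> 1"
    and "K = real p / 2 + 1 / (real p + 1)"
    and "N = p * (p + 1) div 2 + r"
    and "Y = Y_II K"
    and "\<And>x. x \<in> Y \<Longrightarrow> X x = (norm (w_part x))\<^sup>2 * det_II (Z_part x) powr (- (1 / K))"
    and "\<And>x. x \<in> Y \<Longrightarrow>
           g x = ln (1 / (1 - X x) * det_II (Z_part x) powr (- (1 / K))
                       * K powr ((real r - real N) / (1 + real N)))"
  shows "monge_ampere_solution Y g
       \<and> (\<forall>h. monge_ampere_solution Y h \<longrightarrow> (\<forall>x\<in>Y. h x = g x))
       \<and> complete_kaehler_metric_on Y (complex_hessian g)
       \<and> einstein_on Y (complex_hessian g)"
proof -
  define q where "q = (real r - real N) / (1 + real N)"
  have K: "K > 0" unfolding assms(5) by (simp add: add_nonneg_pos)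
  have Y: "Y = Y_II K" by (rule assms(7))
  have n: "N = CARD('p uprod) + r" using assms(1,6) by (simp add: card_UNIV_uprod)
  have card: "CARD('p uprod + 'r) = N" using n assms(2) by simp
  \<comment> \<open>From 1 - X = phi/e the first two factors in the logarithm reduce to 1/phi, and
    the power of \<open>K\<close> becomes the additive constant.\<close>
  have g: "g x = - ln (phi K x) + q * ln K" if x: "x \<in> Y_II K" for x
  proof -
    have ph: "phi K x > 0" and dom: "x \<in> domain_II" using x by (auto simp: Y_II_phi)
    have d: "expa K x > 0" using det_II_pos[OF dom] by simp
    have "1 / (1 - X x) * det_II (Z_part x) powr (- (1 / K)) = 1 / phi K x"
    proof -
      have "X x = norm_w x / expa K x"
        using assms(8)[of x] x by (simp add: Y norm_w_def powr_minus divide_inverse)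
      then have "1 - X x = phi K x / expa K x" using d by (simp add: phi_def field_simps)
      then show ?thesis using d ph by (simp add: powr_minus divide_inverse)
    qed
    then have "g x = ln (1 / phi K x * K powr q)" using assms(9)[of x] x by (simp add: Y q_def)
    also have "\<dots> = ln (1 / phi K x) + ln (K powr q)" using ph K by (intro ln_mult_pos) auto
    finally show ?thesis using ph K by (simp add: ln_div ln_powr)
  qed
  have det: "det (complex_hessian g x) = complex_of_real (exp ((real N + 1) * g x))" if x: "x \<in> Y_II K" for x
  proof -
    have ph: "phi K x > 0" and dom: "x \<in> domain_II" using x by (auto simp: Y_II_phi)
    have d: "det_II (Z_part x) > 0" by (rule det_II_pos[OF dom])
    let ?n = "CARD('p uprod)" and ?e = "expa K x" and ?f = "phi K x"
    have "(?e / (K * ?f)) ^ ?n * (1 / det_II (Z_part x)) ^ (CARD('p) + 1) * ((1 / ?f) ^ r * (?e / ?f))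
       = (1 / K) ^ ?n * (1 / ?f) ^ (N + 1) * (?e ^ (?n + 1) * (1 / det_II (Z_part x)) ^ (CARD('p) + 1))"
      unfolding n by (simp add: power_divide power_mult_distrib power_add mult_ac)
    \<comment> \<open>The powers of det(I - Z Z-bar) cancel by the choice of
      \<open>K\<close>.\<close>
    also have "?e ^ (?n + 1) * (1 / det_II (Z_part x)) ^ (CARD('p) + 1) = 1"
      unfolding expa_power[OF dom assms(5)[unfolded assms(1)]] using d by (simp add: power_divide)
    also have "(1 / K) ^ ?n * (1 / ?f) ^ (N + 1) * 1 = exp ((real N + 1) * g x)"
    proof -
      have "(real N + 1) * g x = real ?n * ln (1 / K) + real (N + 1) * ln (1 / ?f)"
      proof -
        \<comment> \<open>r - N is minus the number of Z-coordinates, so the constant in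
          \<open>g\<close> reproduces the factor \<open>(1 / K) ^ ?n\<close>.\<close>
        have "(real N + 1) * q = - real ?n" unfolding q_def n by (simp add: field_simps)
        then have "(real N + 1) * (q * ln K) = - real ?n * ln K" by (metis mult.assoc)
        then show ?thesis using ph K by (simp add: g[OF x] ln_div algebra_simps)
      qed
      then show ?thesis using ph K by (simp only: exp_add exp_of_nat_mult) (simp add: exp_ln)
    qed
    finally have e: "(?e / (K * ?f)) ^ ?n * (1 / det_II (Z_part x)) ^ (CARD('p) + 1) * ((1 / ?f) ^ r * (?e / ?f))
       = exp ((real N + 1) * g x)" .
    have "det (complex_hessian g x) = complex_of_real ((?e / (K * ?f)) ^ ?n
        * (1 / det_II (Z_part x)) ^ (CARD('p) + 1) * ((1 / ?f) ^ CARD('r) * (?e / ?f)))"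
      by (rule det_complex_hessian_g[OF K g x])
    then show ?thesis by (simp only: e[unfolded assms(2)])
  qed
  note complete = complete_kaehler_g[OF K g]
  have ma: "monge_ampere_solution Y g"
    unfolding monge_ampere_solution_def card Y
    using g_smooth[OF K g] complete det g_at_frontier[OF K g] by blast
  \<comment> \<open>The comparison holds for any ordered pair of solutions and is used in both
    directions.\<close>
  have uniq: "h x = g x" if h: "monge_ampere_solution Y h" and x: "x \<in> Y" for h x
  proof (rule antisym)
    note c = monge_ampere_comparison[where D = Y, unfolded Y, OF open_Y_II bounded_Y_II[OF K] Y_II_star[OF K]]
    show "h x \<le> g x" by (rule c) (use ma h x in \<open>auto simp: Y\<close>)
    show "g x \<le> h x" by (rule c) (use ma h x in \<open>auto simp: Y\<close>)
  qed
  have "einstein_on Y (complex_hessian g)"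
    unfolding Y by (rule einstein_g[OF K g det])
  then show ?thesis using ma uniq complete by (auto simp: Y)
qed

end
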